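(* Let $x(t;x_0)$, $t\ge0$, be an orbit of a $C^{1+\epsilon}$ ($\epsilon>0$) dynamical system $\dot x(t)=f(x)$ in $\mathbb{R}^d$ which falls into a hyperbolic, attracting cycle $\gamma$ as $t\to\infty$. Then its $E(t)$ is linearly bounded from above, i.e. there is a constant $K>0$ such that $E(t)\le Kt$ for all $t\ge0$.
   Context: Norms are Euclidean. $C^{1+\epsilon}$ means that $f:\mathbb{R}^d\to\mathbb{R}^d$ is $C^1$ with locally $\epsilon$-Hölder continuous derivative. A cycle $\gamma$ is the set of points of a (nonconstant) periodic orbit. Its characteristic multipliers are the $d-1$ eigenvalues of the linearization at a point $p\in\gamma$ of the Poincaré map of a cross-section to the flow at $p$. The cycle is hyperbolic and attracting if all its characteristic multipliers are strictly less than $1$ in magnitude. $x(t;x_0)$ is the solution with $x(0)=x_0$; "falls into $\gamma$" means that the distance from $x(t;x_0)$ to $\gamma$ tends to $0$ as $t\to\infty$. Definition of $E$: let $\dot y=F(t,y)$ with $F(t,0)\equiv0$, $F$ continuous in $t$ and locally Lipschitz in $y$, and let $y(t;s,\eta)$ denote the solution with $y(s)=\eta$. Let $\alpha:[0,\infty)\to[0,\infty)$ be any continuous strictly increasing function with $\alpha(0)=0$. For $h>0$ the family $\tilde Y_\alpha(h)$ of approximations to the zero solution consists of all functions $\tilde y(\cdot;h)$ obtained from sequences $v_1,v_2,\dots\in\mathbb{R}^d$ with $\|v_n\|\le 1$ by $\tilde y(0;h)=0$, $\tilde y(nh;h)=y(nh;(n-1)h,\tilde y((n-1)h;h))+h\alpha(h)v_n$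 for $n\ge1$, and $\tilde y(t;h)=y(t;(n-1)h,\tilde y((n-1)h;h))$ for $(n-1)h\le t<nh$. For every $T>0$ all these approximations exist on $[0,T]$ once $h$ is small enough. Define $e_\alpha(t;h)=\sup_{\tilde y\in\tilde Y_\alpha(h)}\|\tilde y(t;h)\|$ and $E(t)=E_\alpha(t)=\limsup_{h\to0^+} e_\alpha(t;h)/\alpha(h)$; this value does not depend on the choice of $\alpha$. The $E(t)$ of an orbit $x(t;x_0)$ of $\dot x=f(x)$ is by definition the $E(t)$ of the zero solution of $\dot y=f(y+x(t;x_0))-f(x(t;x_0))$. *)

theory Defs
  imports "HOL-Analysis.Analysis"
begin

definition C1_hoelder :: "real \<Rightarrow> ('a::euclidean_space \<Rightarrow> 'a) \<Rightarrow> bool" where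
  "C1_hoelder \<epsilon> f \<longleftrightarrow>
    (\<exists>f' :: 'a \<Rightarrow> 'a \<Rightarrow>\<^sub>L 'a.
      (\<forall>x. (f has_derivative blinfun_apply (f' x)) (at x)) \<and>
      continuous_on UNIV f' \<and>
      (\<forall>x. \<exists>r>0. \<exists>C. \<forall>y\<in>ball x r. \<forall>z\<in>ball x r.
         norm (f' y - f' z) \<le> C * dist y z powr \<epsilon>))"

definition solves :: "(real \<Rightarrow> 'a::euclidean_space \<Rightarrow> 'a) \<Rightarrow> real set \<Rightarrow> (real \<Rightarrow> 'a) \<Rightarrow> bool" where
  "solves F J y \<longleftrightarrow> (\<forall>t\<in>J. (y has_vector_derivative F t (y t)) (at t within J))"


subsection \<open>Cycles and their characteristic multipliers\<close>

definition cycle :: "('a::euclidean_space \<Rightarrow> 'a) \<Rightarrow> 'a set \<Rightarrow> bool" where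
  "cycle f \<gamma> \<longleftrightarrow>
    (\<exists>\<phi> T. solves (\<lambda>_. f) UNIV \<phi> \<and> T > 0 \<and> (\<forall>t. \<phi> (t + T) = \<phi> t) \<and>
       (\<exists>t. \<phi> t \<noteq> \<phi> 0) \<and> \<gamma> = range \<phi>)"

text \<open>\<open>S\<close> is a \<open>C\<^sup>1\<close> hypersurface through \<open>p\<close>, everywhere transversal to the flow, and \<open>H\<close> is
  its tangent space at \<open>p\<close>. The hypersurface is the zero set of a function \<open>g\<close> with continuous
  gradient \<open>n\<close>; transversality makes the gradient nonzero on \<open>S\<close>.\<close>

definition cross_section ::
    "('a::euclidean_space \<Rightarrow> 'a) \<Rightarrow> 'a \<Rightarrow> 'a set \<Rightarrow> 'a set \<Rightarrow> bool" where
  "cross_section f p S H \<longleftrightarrow>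
    (\<exists>U (g :: 'a \<Rightarrow> real) n.
       open U \<and> S = {x \<in> U. g x = 0} \<and> p \<in> S \<and>
       (\<forall>x\<in>U. (g has_derivative (\<lambda>v. n x \<bullet> v)) (at x)) \<and> continuous_on U n \<and>
       (\<forall>x\<in>S. n x \<bullet> f x \<noteq> 0) \<and>
       H = {v. n p \<bullet> v = 0})"

text \<open>First return to \<open>S\<close> of the forward orbit of \<open>q\<close>, at the time \<open>\<tau>\<close> and in the point \<open>q'\<close>.\<close>

definition first_return ::
    "('a::euclidean_space \<Rightarrow> 'a) \<Rightarrow> 'a set \<Rightarrow> 'a \<Rightarrow> real \<Rightarrow> 'a \<Rightarrow> bool" where
  "first_return f S q \<tau> q' \<longleftrightarrow>
    \<tau> > 0 \<and> q' \<in> S \<and>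
    (\<exists>y. solves (\<lambda>_. f) {0..\<tau>} y \<and> y 0 = q \<and> y \<tau> = q' \<and> (\<forall>t\<in>{0<..<\<tau>}. y t \<notin> S))"

text \<open>The Poincare map is a germ at \<open>p\<close>: only the values of \<open>P\<close> on \<open>S\<close> near \<open>p\<close> are constrained.
  \<open>P p = p\<close> says that the periodic orbit through \<open>p\<close> meets \<open>S\<close> only once per period; this is
  always achieved by shrinking \<open>S\<close>.\<close>

definition poincare_map ::
    "('a::euclidean_space \<Rightarrow> 'a) \<Rightarrow> 'a \<Rightarrow> 'a set \<Rightarrow> ('a \<Rightarrow> 'a) \<Rightarrow> bool" where
  "poincare_map f p S P \<longleftrightarrow>
    P p = p \<and>
    (\<exists>N \<tau>. open N \<and> p \<in> N \<and> continuous_on (S \<inter> N) \<tau> \<and>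
       (\<forall>q\<in>S \<inter> N. first_return f S q (\<tau> q) (P q)))"

text \<open>\<open>A\<close> on \<open>H\<close> is the linearization at some \<open>p \<in> \<gamma>\<close> of the Poincare map of a cross-section with
  tangent space \<open>H\<close>. The values of \<open>A\<close> outside \<open>H\<close> are irrelevant and not determined.\<close>

definition linearized_poincare ::
    "('a::euclidean_space \<Rightarrow> 'a) \<Rightarrow> 'a set \<Rightarrow> 'a set \<Rightarrow> ('a \<Rightarrow> 'a) \<Rightarrow> bool" where
  "linearized_poincare f \<gamma> H A \<longleftrightarrow>
    (\<exists>p\<in>\<gamma>. \<exists>S P. cross_section f p S H \<and> poincare_map f p S P \<and>
       (P has_derivative A) (at p within S))"

text \<open>Complex eigenvalues of the real linear map \<open>A\<close> on the invariant subspace \<open>H\<close>: in the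
  complexification of \<open>H\<close>, the vector \<open>u + \<i> w\<close> is nonzero and
  \<open>A (u + \<i> w) = \<mu> (u + \<i> w)\<close>, written out in real and imaginary parts.\<close>

definition eigenvalue_on :: "'a::euclidean_space set \<Rightarrow> ('a \<Rightarrow> 'a) \<Rightarrow> complex \<Rightarrow> bool" where
  "eigenvalue_on H A \<mu> \<longleftrightarrow>
    (\<exists>u\<in>H. \<exists>w\<in>H. (u \<noteq> 0 \<or> w \<noteq> 0) \<and>
       A u = Re \<mu> *\<^sub>R u - Im \<mu> *\<^sub>R w \<and>
       A w = Im \<mu> *\<^sub>R u + Re \<mu> *\<^sub>R w)"

text \<open>The eigenvalues do not depend on the point of \<open>\<gamma>\<close> nor on the cross-section, so one choice
  is enough.\<close>

definition hyperbolic_attracting_cycle :: "('a::euclidean_space \<Rightarrow> 'a) \<Rightarrow> 'a set \<Rightarrow> bool" where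
  "hyperbolic_attracting_cycle f \<gamma> \<longleftrightarrow>
    cycle f \<gamma> \<and>
    (\<exists>H A. linearized_poincare f \<gamma> H A \<and> (\<forall>\<mu>. eigenvalue_on H A \<mu> \<longrightarrow> cmod \<mu> < 1))"

definition falls_into :: "(real \<Rightarrow> 'a::euclidean_space) \<Rightarrow> 'a set \<Rightarrow> bool" where
  "falls_into x \<gamma> \<longleftrightarrow> ((\<lambda>t. infdist (x t) \<gamma>) \<longlongrightarrow> 0) at_top"


subsection \<open>Approximations of the zero solution and their error\<close>

text \<open>\<open>\<zeta> = y(t; s, \<eta>)\<close>, including that this solution exists on \<open>[s, t]\<close>.\<close>

definition evolves ::
    "(real \<Rightarrow> 'a::euclidean_space \<Rightarrow> 'a) \<Rightarrow> real \<Rightarrow> 'a \<Rightarrow> real \<Rightarrow> 'a \<Rightarrow> bool" where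
  "evolves F s \<eta> t \<zeta> \<longleftrightarrow> (\<exists>y. solves F {s..t} y \<and> y s = \<eta> \<and> y t = \<zeta>)"

definition error_scale :: "(real \<Rightarrow> real) \<Rightarrow> bool" where
  "error_scale \<alpha> \<longleftrightarrow> continuous_on {0..} \<alpha> \<and> strict_mono_on {0..} \<alpha> \<and> \<alpha> 0 = 0"

text \<open>The approximations with step \<open>h\<close> that exist on \<open>[0, T]\<close>. An approximation need not exist for
  all times, and its values outside \<open>[0, T]\<close> are not constrained here. The sequence is indexed
  from \<open>0\<close>, that is, \<open>v n\<close> is the perturbation at the time \<open>(n + 1) h\<close>.\<close>

definition approximations ::
    "(real \<Rightarrow> 'a::euclidean_space \<Rightarrow> 'a) \<Rightarrow> (real \<Rightarrow> real) \<Rightarrow> real \<Rightarrow> real \<Rightarrow> (real \<Rightarrow> 'a) set" where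
  "approximations F \<alpha> h T =
    {y. \<exists>v :: nat \<Rightarrow> 'a. (\<forall>n. norm (v n) \<le> 1) \<and> y 0 = 0 \<and>
      (\<forall>n. real (Suc n) * h \<le> T \<longrightarrow>
        (\<exists>\<zeta>. evolves F (real n * h) (y (real n * h)) (real (Suc n) * h) \<zeta> \<and>
          y (real (Suc n) * h) = \<zeta> + (h * \<alpha> h) *\<^sub>R v n)) \<and>
      (\<forall>n t. real n * h \<le> t \<and> t < real (Suc n) * h \<and> t \<le> T \<longrightarrow>
        evolves F (real n * h) (y (real n * h)) t (y t))}"

definition approx_error ::
    "(real \<Rightarrow> 'a::euclidean_space \<Rightarrow> 'a) \<Rightarrow> (real \<Rightarrow> real) \<Rightarrow> real \<Rightarrow> real \<Rightarrow> ereal" where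
  "approx_error F \<alpha> t h = (SUP y\<in>approximations F \<alpha> h t. ereal (norm (y t)))"

definition E_zero ::
    "(real \<Rightarrow> 'a::euclidean_space \<Rightarrow> 'a) \<Rightarrow> (real \<Rightarrow> real) \<Rightarrow> real \<Rightarrow> ereal" where
  "E_zero F \<alpha> t = Limsup (at_right 0) (\<lambda>h. approx_error F \<alpha> t h / ereal (\<alpha> h))"

definition E_orbit ::
    "('a::euclidean_space \<Rightarrow> 'a) \<Rightarrow> (real \<Rightarrow> 'a) \<Rightarrow> (real \<Rightarrow> real) \<Rightarrow> real \<Rightarrow> ereal" where
  "E_orbit f x \<alpha> t = E_zero (\<lambda>s y. f (y + x s) - f (x s)) \<alpha> t"

end

(* Write X(t,s) for the evolution operator of the variational equation along x.  If |X(t,s)| <= K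
   for all 0 <= s <= t, then an error h alpha(h) made at any step reaches size at most about
   K h alpha(h) at the time t, and there are t/h steps, so E(t) grows at most linearly.

   To bound X, follow the successive hits q_k of x with the cross-section: q_(k+1) = P(q_k), and
   the spectral hypothesis on the linearized Poincare map makes q_k converge to p geometrically.
   The return times then converge geometrically to the period, and by Hoelder continuity of the
   derivative of f the variation over one return differs from the monodromy M of the cycle by a
   summable error.  M is power bounded: it fixes the flow direction f(p) and induces, modulo f(p),
   the linearized Poincare map.  Products of summable perturbations of a power bounded operator
   are bounded. *)
theory Submission
  imports Defs "HOL-Computational_Algebra.Fundamental_Theorem_Algebra"
begin

section \<open>Gronwall estimates\<close>

text \<open>A bound \<open>K\<close> for the evolution operators is useless if it is paid at every
  step: over t/h steps it would enter as a power of \<open>K\<close>. Products are therefore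
  measured in adapted norms, the supremum of the sizes that a vector attains along its future. There
  the unperturbed maps do not expand, and a perturbation costs a factor 1 + small; the product of
  these factors stays bounded. For the approximations the small terms add up to at most 1 on [0, t],
  which gives the constant 3 K because exp 1 \<le> 3. How small h must be depends on t, the constant
  does not.

  The Poincare map is given by weak data: the return time is assumed only continuous, P
  differentiable only at p along S, and A is determined only on the tangent space of S. Its
  expansion is thus derived from the flow. The return time is Lipschitz at p because the cycle moves
  through p with nonzero speed; projecting along f(p) removes the time shift, so that no derivative
  of the return time occurs; and A agrees with the projected monodromy on vectors approximated by
  chords of S.\<close>

lemma has_vector_derivative_at_interior:
  fixes w :: "real \<Rightarrow> 'a::real_normed_vector"
  assumes "(w has_vector_derivative w') (at t within {a..b})" "t \<in> {a<..<b}"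
  shows "(w has_vector_derivative w') (at t)"
proof -
  have "at t within {a..b} = at t"
    using assms(2) by (intro at_within_interior) (auto simp: interior_atLeastAtMost_real)
  then show ?thesis using assms(1) by simp
qed

lemma has_vector_derivative_imp_continuous_on:
  assumes "\<And>t. t \<in> S \<Longrightarrow> (w has_vector_derivative w' t) (at t within S)"
  shows "continuous_on S w"
  using assms by (meson continuous_on_eq_continuous_within has_vector_derivative_continuous)

text \<open>The quantity \<open>exp (- L * (t - a)) * norm (w t) - c * (t - a)\<close> does not
  increase. The growth bound is required only in the open interval, so that the estimate can be
  applied up to a first exit time, using only what holds strictly before it.\<close>

lemma gronwall_end:
  fixes w :: "real \<Rightarrow> 'a::real_inner"
  assumes ab: "a \<le> b"
    and der: "\<And>t. t \<in> {a..b} \<Longrightarrow> (w has_vector_derivative w' t) (at t within {a..b})"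
    and bnd: "\<And>t. t \<in> {a<..<b} \<Longrightarrow> norm (w' t) \<le> L * norm (w t) + c"
    and L: "L \<ge> 0" and c: "c \<ge> 0"
  shows "norm (w b) \<le> exp (L * (b - a)) * (norm (w a) + c * (b - a))"
proof (rule field_le_epsilon)
  fix e :: real assume e: "e > 0"
  \<comment> \<open>The smoothing adds at most \<open>d\<close> to the initial value, and the
    Gronwall factor turns this into exactly \<open>e\<close>.\<close>
  define d where "d = e / exp (L * (b - a))"
  have d: "d > 0" using e by (simp add: d_def)
  \<comment> \<open>smoothing of the norm, which is not differentiable at the zeros of \<open>w\<close>\<close>
  define \<psi> where "\<psi> t = sqrt (w t \<bullet> w t + d\<^sup>2)" for t
  have pos: "w t \<bullet> w t + d\<^sup>2 > 0" for t
    using d by (simp add: add_nonneg_pos)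
  have \<psi>pos: "\<psi> t > 0" for t using pos by (simp add: \<psi>_def)
  have \<psi>ge: "norm (w t) \<le> \<psi> t" for t
    unfolding \<psi>_def norm_eq_sqrt_inner by (simp add: d)
  have \<psi>a: "\<psi> a \<le> norm (w a) + d"
    unfolding \<psi>_def using d by (simp add: sqrt_sum_squares_le_sum power2_norm_eq_inner[symmetric])
  define h where "h t = exp (- L * (t - a)) * \<psi> t - c * (t - a)" for t
  have cont: "continuous_on {a..b} w"
    using der by (rule has_vector_derivative_imp_continuous_on)
  have "h b \<le> h a"
  proof (rule DERIV_nonpos_imp_decreasing_open[OF ab])
    show "continuous_on {a..b} h"
      unfolding h_def \<psi>_def by (intro continuous_intros cont)
    fix t assume t: "a < t" "t < b"
    have D: "(w has_vector_derivative w' t) (at t)"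
      using der[of t] t by (intro has_vector_derivative_at_interior[of _ _ _ a b]) auto
    have D1: "((\<lambda>t. w t \<bullet> w t) has_real_derivative (2 * (w t \<bullet> w' t))) (at t)"
      unfolding has_real_derivative_iff_has_vector_derivative
      using D by (auto intro!: derivative_eq_intros simp: has_vector_derivative_def inner_commute algebra_simps)
    have D2: "(\<psi> has_real_derivative (w t \<bullet> w' t) / \<psi> t) (at t)"
      using DERIV_chain2[OF DERIV_real_sqrt[OF pos[of t]] DERIV_add[OF D1 DERIV_const[of "d\<^sup>2"]]]
      unfolding \<psi>_def by (simp add: field_simps)
    have D3: "(h has_real_derivative
        exp (- L * (t - a)) * (- L * \<psi> t + (w t \<bullet> w' t) / \<psi> t) - c) (at t)"
      unfolding h_def by (rule derivative_eq_intros D2 refl)+ (simp add: algebra_simps)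
    have "w t \<bullet> w' t \<le> norm (w t) * norm (w' t)" by (rule norm_cauchy_schwarz)
    also have "\<dots> \<le> \<psi> t * (L * \<psi> t + c)"
      using bnd[of t] t \<psi>ge[of t] L c
      by (intro mult_mono order_trans[OF bnd]) (auto intro!: mult_left_mono less_imp_le[OF \<psi>pos])
    finally have "(w t \<bullet> w' t) / \<psi> t \<le> L * \<psi> t + c"
      using \<psi>pos[of t] by (simp add: field_simps)
    then have "- L * \<psi> t + (w t \<bullet> w' t) / \<psi> t \<le> c" by simp
    then have "exp (- L * (t - a)) * (- L * \<psi> t + (w t \<bullet> w' t) / \<psi> t) \<le> exp (- L * (t - a)) * c"
      by (intro mult_left_mono) auto
    also have "\<dots> \<le> 1 * c" using c L t by (intro mult_right_mono) auto
    finally show "\<exists>y. (h has_real_derivative y) (at t) \<and> y \<le> 0" using D3 by auto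
  qed
  then have *: "exp (- L * (b - a)) * \<psi> b \<le> \<psi> a + c * (b - a)"
    by (simp add: h_def)
  have "\<psi> b = exp (L * (b - a)) * (exp (- L * (b - a)) * \<psi> b)"
    by (simp add: mult.assoc[symmetric] exp_add[symmetric])
  also have "\<dots> \<le> exp (L * (b - a)) * (norm (w a) + d + c * (b - a))"
    using * \<psi>a by (intro mult_left_mono) auto
  also have "\<dots> = exp (L * (b - a)) * (norm (w a) + c * (b - a)) + e"
    by (simp add: d_def algebra_simps)
  finally show "norm (w b) \<le> exp (L * (b - a)) * (norm (w a) + c * (b - a)) + e"
    using \<psi>ge[of b] by linarith
qed

lemma gronwall:
  fixes w :: "real \<Rightarrow> 'a::real_inner"
  assumes der: "\<And>t. t \<in> {a..b} \<Longrightarrow> (w has_vector_derivative w' t) (at t within {a..b})"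
    and bnd: "\<And>t. t \<in> {a<..<b} \<Longrightarrow> norm (w' t) \<le> L * norm (w t) + c"
    and "L \<ge> 0" "c \<ge> 0" and t: "t \<in> {a..b}"
  shows "norm (w t) \<le> exp (L * (t - a)) * (norm (w a) + c * (t - a))"
proof (rule gronwall_end)
  show "a \<le> t" using t by simp
  show "(w has_vector_derivative w' s) (at s within {a..t})" if "s \<in> {a..t}" for s
    using der[of s] that t by (auto intro: has_vector_derivative_within_subset)
  show "norm (w' s) \<le> L * norm (w s) + c" if "s \<in> {a<..<t}" for s
    using bnd[of s] that t by auto
qed fact+

text \<open>Continuation argument for a growth bound known only inside the ball of radius \<rho>: at
  the first time when \<open>norm (w r)\<close> reaches \<rho>, the Gronwall bound is still smaller
  than \<rho>.\<close>

lemma gronwall_local: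
  fixes w :: "real \<Rightarrow> 'a::real_inner"
  assumes der: "\<And>t. t \<in> {a..b} \<Longrightarrow> (w has_vector_derivative w' t) (at t within {a..b})"
    and bnd: "\<And>t. t \<in> {a..b} \<Longrightarrow> norm (w t) \<le> \<rho> \<Longrightarrow> norm (w' t) \<le> L * norm (w t)"
    and L: "L \<ge> 0" and small: "exp (L * (b - a)) * norm (w a) < \<rho>" and t: "t \<in> {a..b}"
  shows "norm (w t) \<le> exp (L * (t - a)) * norm (w a)"
proof -
  have cont: "continuous_on {a..b} w"
    using der by (rule has_vector_derivative_imp_continuous_on)
  have less: "norm (w s) < \<rho>" if s: "s \<in> {a..b}" for s
  proof (rule ccontr)
    assume "\<not> norm (w s) < \<rho>"
    define Z where "Z = {r \<in> {a..b}. \<rho> \<le> norm (w r)}"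
    have "closed Z"
      unfolding Z_def by (intro continuous_on_closed_Collect_le continuous_intros cont)
    moreover have "Z \<noteq> {}" "Z \<subseteq> {a..b}"
      using \<open>\<not> norm (w s) < \<rho>\<close> s by (auto simp: Z_def)
    moreover have "bounded Z" using \<open>Z \<subseteq> {a..b}\<close> bounded_subset bounded_closed_interval by metis
    ultimately obtain r where r: "r \<in> Z" "\<And>q. q \<in> Z \<Longrightarrow> r \<le> q"
      using compact_attains_inf[of Z] compact_eq_bounded_closed by metis
    have rab: "r \<in> {a..b}" using r(1) by (simp add: Z_def)
    have "norm (w r) \<le> exp (L * (r - a)) * (norm (w a) + 0 * (r - a))"
    proof (rule gronwall_end[where w' = w'])
      show "a \<le> r" using rab by simp
      show "(w has_vector_derivative w' q) (at q within {a..r})" if "q \<in> {a..r}" for q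
        using der[of q] that rab by (auto intro: has_vector_derivative_within_subset)
      show "norm (w' q) \<le> L * norm (w q) + 0" if "q \<in> {a<..<r}" for q
      proof -
        have "q \<notin> Z" using r(2)[of q] that by auto
        then show ?thesis using bnd[of q] that rab by (auto simp: Z_def)
      qed
    qed (use L in auto)
    also have "\<dots> \<le> exp (L * (b - a)) * norm (w a)"
      using rab L by (auto intro!: mult_right_mono mult_left_mono)
    also have "\<dots> < \<rho>" by (rule small)
    finally show False using r(1) by (simp add: Z_def)
  qed
  have "norm (w t) \<le> exp (L * (t - a)) * (norm (w a) + 0 * (t - a))"
  proof (rule gronwall[OF der])
    show "norm (w' s) \<le> L * norm (w s) + 0" if "s \<in> {a<..<b}" for s
      using bnd[of s] less[of s] that by auto
  qed (use L t in auto)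
  then show "norm (w t) \<le> exp (L * (t - a)) * norm (w a)" by simp
qed

section \<open>Linear equations\<close>

text \<open>Picard iteration as a series: \<open>y n\<close> is the n-th increment. In the weight
  \<open>exp (2 * L * (t - a))\<close> each integration gains the factor 1/2, so the series
  converges on every compact interval at once. Its sum does not refer to \<open>b\<close>, hence one
  \<open>X\<close> serves all intervals.\<close>

lemma linear_ode_exists_Icc:
  fixes A :: "real \<Rightarrow> ('a::euclidean_space \<Rightarrow>\<^sub>L 'a)"
  assumes cA: "continuous_on {a..} A"
  shows "\<exists>X. X a = id_blinfun \<and>
    (\<forall>b. \<forall>t\<in>{a..b}. (X has_vector_derivative A t o\<^sub>L X t) (at t within {a..b}))"
proof -
  define y where "y = rec_nat (\<lambda>_. id_blinfun) (\<lambda>_ z t. integral {a..t} (\<lambda>r. A r o\<^sub>L z r))"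
  have y0: "y 0 = (\<lambda>_. id_blinfun)" and yS: "y (Suc n) = (\<lambda>t. integral {a..t} (\<lambda>r. A r o\<^sub>L y n r))" for n
    by (simp_all add: y_def)
  \<comment> \<open>\<open>D n\<close> is the derivative of \<open>y n\<close>. The index shift with
    \<open>D 0 = 0\<close> is what turns the sum of the derivatives into \<open>A t\<close> applied
    to the sum of the series.\<close>
  define D where "D n = (case n of 0 \<Rightarrow> (\<lambda>_. 0) | Suc m \<Rightarrow> (\<lambda>r. A r o\<^sub>L y m r))" for n
  have cont_der: "continuous_on {a..b} (y n) \<and>
      (\<forall>t\<in>{a..b}. (y n has_vector_derivative D n t) (at t within {a..b}))" for n b
  proof (induction n)
    case 0
    then show ?case by (auto simp: y0 D_def)
  next
    case (Suc n)
    have "continuous_on {a..b} (\<lambda>r. A r o\<^sub>L y n r)"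
      using Suc cA by (intro continuous_intros) (auto intro: continuous_on_subset)
    then have "\<forall>t\<in>{a..b}. (y (Suc n) has_vector_derivative D (Suc n) t) (at t within {a..b})"
      by (auto simp: yS D_def intro!: integral_has_vector_derivative)
    then show ?case using has_vector_derivative_imp_continuous_on by blast
  qed
  have ex: "\<exists>g. (\<forall>t\<in>{a..b}. (\<lambda>n. y n t) sums g t \<and>
      (g has_vector_derivative A t o\<^sub>L g t) (at t within {a..b}))" if ab: "a \<le> b" for b
  proof -
    have "compact (A ` {a..b})"
      by (intro compact_continuous_image continuous_on_subset[OF cA]) auto
    then obtain L0 where L0: "\<And>t. t \<in> {a..b} \<Longrightarrow> norm (A t) \<le> L0"
      by (meson bounded_iff compact_imp_bounded image_eqI)
    define L where "L = max L0 1"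
    have L: "L > 0" "\<And>t. t \<in> {a..b} \<Longrightarrow> norm (A t) \<le> L" using L0 by (auto simp: L_def max.coboundedI1)
    have bound: "norm (y n t) \<le> (1/2)^n * exp (2 * L * (t - a))" if "t \<in> {a..b}" for n t
      using that
    proof (induction n arbitrary: t)
      case 0
      have "norm (id_blinfun :: 'a \<Rightarrow>\<^sub>L 'a) \<le> 1" by (simp add: norm_blinfun_id_le)
      also have "1 \<le> exp (2 * L * (t - a))" using 0 L by simp
      finally show ?case by (simp add: y0)
    next
      case (Suc n)
      show ?case
      proof (cases "t = a")
        case True
        then show ?thesis by (simp add: yS)
      next
        case False
        define \<phi> where "\<phi> s = (1/2)^(Suc n) * exp (2 * L * (s - a))" for s
        have "norm (y (Suc n) t - y (Suc n) a) \<le> \<phi> t - \<phi> a"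
        proof (rule differentiable_bound_general)
          show "a < t" using False Suc by simp
          show "continuous_on {a..t} (y (Suc n))" using cont_der by blast
          show "continuous_on {a..t} \<phi>" unfolding \<phi>_def by (intro continuous_intros)
          fix s assume s: "a < s" "s < t"
          show "(y (Suc n) has_vector_derivative D (Suc n) s) (at s)"
            using cont_der[of t "Suc n"] s
            by (intro has_vector_derivative_at_interior[of _ _ _ a t]) auto
          show "(\<phi> has_vector_derivative L * ((1/2)^n * exp (2 * L * (s - a)))) (at s)"
            unfolding \<phi>_def has_real_derivative_iff_has_vector_derivative[symmetric]
            by (auto intro!: derivative_eq_intros simp: field_simps)
          have "norm (D (Suc n) s) \<le> norm (A s) * norm (y n s)"
            by (simp add: D_def norm_blinfun_compose)
          also have "\<dots> \<le> L * ((1/2)^n * exp (2 * L * (s - a)))"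
            using L Suc s by (intro mult_mono) auto
          finally show "norm (D (Suc n) s) \<le> L * ((1/2)^n * exp (2 * L * (s - a)))" .
        qed
        moreover have "\<phi> a \<ge> 0" by (simp add: \<phi>_def)
        ultimately have "norm (y (Suc n) t - y (Suc n) a) \<le> \<phi> t" by linarith
        then show ?thesis by (simp add: yS \<phi>_def)
      qed
    qed
    define E where "E = exp (2 * L * (b - a))"
    have bound': "norm (y n t) \<le> (1/2)^n * E" if "t \<in> {a..b}" for n t
      using bound[OF that, of n] that L
      by (auto simp: E_def elim!: order_trans intro!: mult_left_mono)
    have summ: "summable (\<lambda>n. y n t)" if "t \<in> {a..b}" for t
      by (rule summable_comparison_test'[where g = "\<lambda>n. (1/2)^n * E" and N = 0])
        (use bound'[OF that] in \<open>auto intro!: summable_mult2 summable_geometric\<close>)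
    define M where "M n = (case n of 0 \<Rightarrow> 0 | Suc m \<Rightarrow> L * ((1/2)^m * E))" for n
    have DM: "norm (D n t) \<le> M n" if "t \<in> {a..b}" for n t
    proof (cases n)
      case (Suc m)
      have "norm (D n t) \<le> norm (A t) * norm (y m t)"
        using Suc by (simp add: D_def norm_blinfun_compose)
      also have "\<dots> \<le> L * ((1/2)^m * E)"
        using L bound'[OF that] that by (intro mult_mono) auto
      finally show ?thesis using Suc by (simp add: M_def)
    qed (simp add: D_def M_def)
    have "summable (\<lambda>n. M (Suc n))"
      by (auto simp: M_def intro!: summable_mult summable_mult2 summable_geometric)
    then have "summable M" by (simp add: summable_Suc_iff)
    then have unif: "uniform_limit {a..b} (\<lambda>n t. \<Sum>i<n. D i t) (\<lambda>t. suminf (\<lambda>i. D i t)) sequentially"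
      using DM by (intro Weierstrass_m_test) auto
    have "\<exists>g. \<forall>t\<in>{a..b}. (\<lambda>n. y n t) sums g t \<and>
        (g has_derivative (\<lambda>h. h *\<^sub>R suminf (\<lambda>i. D i t))) (at t within {a..b})"
    proof (rule has_derivative_series)
      show "(y n has_derivative (\<lambda>h. h *\<^sub>R D n t)) (at t within {a..b})" if "t \<in> {a..b}" for n t
        using cont_der[of b n] that by (auto simp: has_vector_derivative_def)
      show "\<forall>\<^sub>F n in sequentially. \<forall>t\<in>{a..b}. \<forall>h.
          norm ((\<Sum>i<n. h *\<^sub>R D i t) - h *\<^sub>R suminf (\<lambda>i. D i t)) \<le> e * norm h" if "e > 0" for e
        using uniform_limitD[OF unif that]
      proof (rule eventually_mono)
        fix n assume *: "\<forall>t\<in>{a..b}. dist (\<Sum>i<n. D i t) (suminf (\<lambda>i. D i t)) < e"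
        show "\<forall>t\<in>{a..b}. \<forall>h.
          norm ((\<Sum>i<n. h *\<^sub>R D i t) - h *\<^sub>R suminf (\<lambda>i. D i t)) \<le> e * norm h"
        proof (intro ballI allI)
          fix t h :: real assume "t \<in> {a..b}"
          then have "norm ((\<Sum>i<n. D i t) - suminf (\<lambda>i. D i t)) \<le> e"
            using * by (auto simp: dist_norm less_imp_le)
          then have "\<bar>h\<bar> * norm ((\<Sum>i<n. D i t) - suminf (\<lambda>i. D i t)) \<le> \<bar>h\<bar> * e"
            by (intro mult_left_mono) auto
          then show "norm ((\<Sum>i<n. h *\<^sub>R D i t) - h *\<^sub>R suminf (\<lambda>i. D i t)) \<le> e * norm h"
            by (simp add: scaleR_sum_right[symmetric] scaleR_diff_right[symmetric] mult.commute)
        qed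
      qed
      show "a \<in> {a..b}" using ab by simp
      show "(\<lambda>n. y n a) sums (suminf (\<lambda>n. y n a))"
        using summ[of a] ab by (intro summable_sums) auto
    qed auto
    then obtain g where g: "\<And>t. t \<in> {a..b} \<Longrightarrow> (\<lambda>n. y n t) sums g t"
      "\<And>t. t \<in> {a..b} \<Longrightarrow> (g has_vector_derivative suminf (\<lambda>i. D i t)) (at t within {a..b})"
      unfolding has_vector_derivative_def by blast
    have "suminf (\<lambda>i. D i t) = A t o\<^sub>L g t" if t: "t \<in> {a..b}" for t
    proof -
      have "(\<lambda>n. A t o\<^sub>L y n t) sums (A t o\<^sub>L g t)"
        by (rule bounded_linear.sums[OF bounded_bilinear.bounded_linear_right[OF bounded_bilinear_blinfun_compose] g(1)[OF t]])
      then have "(\<lambda>n. D (Suc n) t) sums (A t o\<^sub>L g t)" by (simp add: D_def)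
      then have "(\<lambda>n. D n t) sums ((A t o\<^sub>L g t) + D 0 t)" by (rule sums_Suc)
      then show ?thesis by (simp add: sums_iff D_def)
    qed
    with g show ?thesis by (intro exI[where x = g] ballI conjI) simp_all
  qed
  define X where "X t = suminf (\<lambda>n. y n t)" for t
  have "(X has_vector_derivative A t o\<^sub>L X t) (at t within {a..b})" if t: "t \<in> {a..b}" for b t
  proof -
    have "a \<le> b" using t by simp
    from ex[OF this] obtain g where g: "\<forall>t\<in>{a..b}. (\<lambda>n. y n t) sums g t \<and>
      (g has_vector_derivative A t o\<^sub>L g t) (at t within {a..b})" by blast
    then have eq: "X s = g s" if "s \<in> {a..b}" for s
      using that by (auto simp: X_def sums_iff)
    have "(X has_vector_derivative A t o\<^sub>L g t) (at t within {a..b})"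
      using eq g t by (intro has_vector_derivative_transform[OF t, of X g]) blast+
    then show ?thesis by (simp only: eq[OF t])
  qed
  moreover have "X a = id_blinfun"
  proof -
    have "(\<lambda>n. y n a) sums (\<Sum>n\<in>{0}. y n a)"
    proof (rule sums_finite)
      show "y n a = 0" if "n \<notin> {0}" for n
        using that by (cases n) (simp_all add: yS)
    qed simp
    then show ?thesis by (simp add: X_def sums_iff y0)
  qed
  ultimately show ?thesis by blast
qed

lemma linear_ode_bound:
  fixes A :: "real \<Rightarrow> ('a::euclidean_space \<Rightarrow>\<^sub>L 'a)"
  assumes "\<And>t. t \<in> {a..b} \<Longrightarrow> (u has_vector_derivative A t (u t)) (at t within {a..b})"
    and "\<And>t. t \<in> {a..b} \<Longrightarrow> norm (A t) \<le> L" and t: "t \<in> {a..b}"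
  shows "norm (u t) \<le> exp (L * (t - a)) * norm (u a)"
proof -
  have "L \<ge> 0" using assms(2)[OF t] norm_ge_zero order_trans by blast
  moreover have "norm (A s (u s)) \<le> L * norm (u s) + 0" if "s \<in> {a<..<b}" for s
    using norm_blinfun[of "A s" "u s"] assms(2)[of s] that
    by (auto elim!: order_trans intro!: mult_right_mono)
  ultimately show ?thesis using gronwall[OF assms(1), of L 0 t] t by simp
qed

locale evolution =
  fixes A :: "real \<Rightarrow> ('a::euclidean_space \<Rightarrow>\<^sub>L 'a)" and X :: "real \<Rightarrow> real \<Rightarrow> ('a \<Rightarrow>\<^sub>L 'a)"
  assumes cA: "continuous_on {0..} A"
    and X_diag: "s \<ge> 0 \<Longrightarrow> X s s = id_blinfun"
    and X_deriv: "\<lbrakk>s \<ge> 0; t \<in> {s..b}\<rbrakk> \<Longrightarrow>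
      ((\<lambda>t. X t s) has_vector_derivative A t o\<^sub>L X t s) (at t within {s..b})"
begin

lemma X_apply_deriv:
  "\<lbrakk>s \<ge> 0; t \<in> {s..b}\<rbrakk> \<Longrightarrow>
    ((\<lambda>t. X t s v) has_vector_derivative A t (X t s v)) (at t within {s..b})"
  using bounded_linear.has_vector_derivative[OF bounded_bilinear.bounded_linear_left[OF bounded_bilinear_blinfun_apply] X_deriv, of s t b v]
  by simp

lemma X_unique:
  assumes s: "s \<ge> 0"
    and u: "\<And>t. t \<in> {s..b} \<Longrightarrow> (u has_vector_derivative A t (u t)) (at t within {s..b})"
    and t: "t \<in> {s..b}"
  shows "u t = X t s (u s)"
proof -
  have "compact (A ` {s..b})"
    using s by (intro compact_continuous_image continuous_on_subset[OF cA]) auto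
  then obtain L where L: "\<And>t. t \<in> {s..b} \<Longrightarrow> norm (A t) \<le> L"
    by (meson bounded_iff compact_imp_bounded image_eqI)
  have "norm (u t - X t s (u s)) \<le> exp (L * (t - s)) * norm (u s - X s s (u s))"
  proof (rule linear_ode_bound[OF _ L t])
    show "((\<lambda>t. u t - X t s (u s)) has_vector_derivative A t (u t - X t s (u s))) (at t within {s..b})"
      if "t \<in> {s..b}" for t
      using has_vector_derivative_diff[OF u[OF that] X_apply_deriv[OF s that, of "u s"]]
      by (simp add: blinfun.diff_right)
  qed
  then show ?thesis by (simp add: X_diag s)
qed

lemma X_comp:
  assumes "0 \<le> r" "r \<le> s" "s \<le> t"
  shows "X t s (X s r v) = X t r v"
proof -
  have "((\<lambda>t. X t r v) has_vector_derivative A q (X q r v)) (at q within {s..t})" if "q \<in> {s..t}" for q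
    using X_apply_deriv[of r q t v] that assms by (auto intro: has_vector_derivative_within_subset)
  from X_unique[OF _ this, of t] show ?thesis using assms by auto
qed

lemma X_bound:
  assumes "0 \<le> s" "s \<le> t" "\<And>r. r \<in> {s..t} \<Longrightarrow> norm (A r) \<le> L"
  shows "norm (X t s v) \<le> exp (L * (t - s)) * norm v"
  using linear_ode_bound[OF X_apply_deriv[of s _ t v], of L t] assms by (simp add: X_diag)

end

lemma evolution_exists:
  fixes A :: "real \<Rightarrow> ('a::euclidean_space \<Rightarrow>\<^sub>L 'a)"
  assumes "continuous_on {0..} A"
  shows "\<exists>X. evolution A X"
proof -
  \<comment> \<open>Vacuous for negative \<open>s\<close>, so that \<open>choice\<close> applies to
    all reals.\<close>
  define Q where "Q s Y \<longleftrightarrow> (s \<ge> 0 \<longrightarrow> Y s = id_blinfun \<and>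
    (\<forall>b. \<forall>t\<in>{s..b}. (Y has_vector_derivative A t o\<^sub>L Y t) (at t within {s..b})))" for s Y
  have "\<forall>s. \<exists>Y. Q s Y"
  proof
    fix s show "\<exists>Y. Q s Y"
    proof (cases "s \<ge> 0")
      case True
      then have "continuous_on {s..} A" using continuous_on_subset[OF assms] by simp
      from linear_ode_exists_Icc[OF this] show ?thesis unfolding Q_def by blast
    qed (simp add: Q_def)
  qed
  from choice[OF this] obtain Y where "\<forall>s. Q s (Y s)" ..
  then have "evolution A (\<lambda>t s. Y s t)"
    unfolding evolution_def Q_def using assms by blast
  then show ?thesis by blast
qed

section \<open>Perturbation of orbits\<close>

locale C1_field =
  fixes f :: "'a::euclidean_space \<Rightarrow> 'a" and f' :: "'a \<Rightarrow> 'a \<Rightarrow>\<^sub>L 'a"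
  assumes f_deriv: "(f has_derivative blinfun_apply (f' x)) (at x)"
    and cont_f': "continuous_on UNIV f'"
begin

lemma lipschitz_ball:
  obtains L where "L \<ge> 0" "\<And>y. norm y \<le> R \<Longrightarrow> norm (f' y) \<le> L"
    "\<And>y z. norm y \<le> R \<Longrightarrow> norm z \<le> R \<Longrightarrow> norm (f y - f z) \<le> L * norm (y - z)"
proof -
  have "compact (f' ` cball 0 R)"
    by (intro compact_continuous_image continuous_on_subset[OF cont_f']) auto
  then obtain L0 where L0: "\<And>y. y \<in> cball 0 R \<Longrightarrow> norm (f' y) \<le> L0"
    by (meson bounded_iff compact_imp_bounded image_eqI)
  define L where "L = max L0 0"
  have L: "norm (f' y) \<le> L" if "norm y \<le> R" for y
    using L0[of y] that by (simp add: L_def)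
  have "norm (f y - f z) \<le> L * norm (y - z)" if "norm y \<le> R" "norm z \<le> R" for y z
  proof (rule differentiable_bound[where S = "cball 0 R"])
    show "(f has_derivative blinfun_apply (f' x)) (at x within cball 0 R)" for x
      using f_deriv by (rule has_derivative_at_withinI)
    show "onorm (blinfun_apply (f' x)) \<le> L" if "x \<in> cball 0 R" for x
      using L[of x] that by (simp add: norm_blinfun.rep_eq)
  qed (use that in auto)
  then show ?thesis using that[of L] L by (auto simp: L_def)
qed

text \<open>Uniform continuity of \<open>f'\<close> on a ball makes the first-order remainder small
  uniformly in the base point. The radius \<open>R + 1\<close> leaves room for the segment from
  \<open>y\<close> to \<open>y + w\<close>.\<close>

lemma linearization_ball:
  assumes e: "e > 0"
  obtains d where "d > 0"
    "\<And>y w. norm y \<le> R \<Longrightarrow> norm w \<le> d \<Longrightarrow> norm (f (w + y) - f y - f' y w) \<le> e * norm w"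
proof -
  have "uniformly_continuous_on (cball 0 (R + 1)) f'"
    by (intro compact_uniformly_continuous continuous_on_subset[OF cont_f']) auto
  then obtain d0 where d0: "d0 > 0" "\<And>x y. \<lbrakk>x \<in> cball 0 (R + 1); y \<in> cball 0 (R + 1); dist x y < d0\<rbrakk>
      \<Longrightarrow> dist (f' x) (f' y) < e"
    using e unfolding uniformly_continuous_on_def by metis
  define d where "d = min 1 (d0 / 2)"
  have "norm (f (w + y) - f y - f' y w) \<le> e * norm w" if y: "norm y \<le> R" and w: "norm w \<le> d" for y w
  proof -
    define S where "S = (\<lambda>t. y + t *\<^sub>R w) ` {0..1::real}"
    have S: "norm (x - y) \<le> d" if "x \<in> S" for x
    proof -
      from that obtain t where t: "0 \<le> t" "t \<le> 1" "x = y + t *\<^sub>R w" by (auto simp: S_def)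
      have "\<bar>t\<bar> * norm w \<le> 1 * d" using t w by (intro mult_mono) auto
      then show ?thesis using t by simp
    qed
    have "norm (f (y + w) - f y - f' y ((y + w) - y)) \<le> norm ((y + w) - y) * e"
    proof (rule differentiable_bound_linearization[where S = S and f' = "\<lambda>x. blinfun_apply (f' x)"])
      show "y + t *\<^sub>R (y + w - y) \<in> S" if "t \<in> {0..1}" for t using that by (auto simp: S_def)
      show "(f has_derivative blinfun_apply (f' x)) (at x within S)" for x
        using f_deriv by (rule has_derivative_at_withinI)
      show "y \<in> S" by (auto simp: S_def intro!: image_eqI[of _ _ 0])
      show "onorm (blinfun_apply (f' x) - blinfun_apply (f' y)) \<le> e" if "x \<in> S" for x
      proof -
        have "norm x \<le> R + 1" "dist x y < d0"
          using S[OF that] y norm_triangle_ineq[of "x - y" y] d0(1)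
          by (auto simp: d_def dist_norm min_def split: if_splits)
        then have "dist (f' x) (f' y) < e" using d0(2)[of x y] y by auto
        then show ?thesis
          by (simp add: dist_norm norm_blinfun.rep_eq minus_blinfun.rep_eq fun_diff_def)
      qed
    qed
    then show ?thesis by (simp add: add.commute mult.commute)
  qed
  moreover have "d > 0" using d0(1) by (simp add: d_def)
  ultimately show ?thesis using that by blast
qed

text \<open>In the next two statements \<open>w\<close> is the deviation of a solution from the reference curve \<open>x\<close>.\<close>

lemma deviation_bound:
  assumes "D \<ge> 0"
  obtains C d where "C \<ge> 1" "d > 0"
    "\<And>a b x w. \<lbrakk>b - a \<le> D; \<And>t. t \<in> {a..b} \<Longrightarrow> norm (x t) \<le> R;
       \<And>t. t \<in> {a..b} \<Longrightarrow> (w has_vector_derivative f (w t + x t) - f (x t)) (at t within {a..b});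
       norm (w a) < d\<rbrakk> \<Longrightarrow> \<forall>t\<in>{a..b}. norm (w t) \<le> C * norm (w a)"
proof -
  obtain L where L: "L \<ge> 0"
    "\<And>y z. norm y \<le> R + 1 \<Longrightarrow> norm z \<le> R + 1 \<Longrightarrow> norm (f y - f z) \<le> L * norm (y - z)"
    using lipschitz_ball[of "R + 1"] by metis
  \<comment> \<open>A deviation starting below \<open>1 / C\<close> stays below 1 during the time
    \<open>D\<close>, so the deviating solution remains in the ball of radius \<open>R + 1\<close>,
    where \<open>L\<close> is a Lipschitz constant.\<close>
  define C where "C = exp (L * D)"
  have C: "C \<ge> 1" using L assms by (simp add: C_def)
  have "norm (w t) \<le> C * norm (w a)"
    if D: "b - a \<le> D" and x: "\<And>t. t \<in> {a..b} \<Longrightarrow> norm (x t) \<le> R"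
      and der: "\<And>t. t \<in> {a..b} \<Longrightarrow> (w has_vector_derivative f (w t + x t) - f (x t)) (at t within {a..b})"
      and wa: "norm (w a) < 1 / C" and t: "t \<in> {a..b}" for a b x w t
  proof -
    have mono: "exp (L * (s - a)) \<le> C" if "s \<in> {a..b}" for s
      using that D L by (auto simp: C_def intro!: mult_left_mono)
    have "norm (w t) \<le> exp (L * (t - a)) * norm (w a)"
    proof (rule gronwall_local[OF der _ \<open>L \<ge> 0\<close> _ t, where \<rho> = 1])
      show "norm (f (w s + x s) - f (x s)) \<le> L * norm (w s)" if "s \<in> {a..b}" "norm (w s) \<le> 1" for s
        using L(2)[of "w s + x s" "x s"] x[OF that(1)] that(2) norm_triangle_ineq[of "w s" "x s"] by simp
      have "exp (L * (b - a)) * norm (w a) \<le> C * norm (w a)"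
        using mono[of b] t by (intro mult_right_mono) auto
      also have "\<dots> < 1" using wa C by (simp add: field_simps)
      finally show "exp (L * (b - a)) * norm (w a) < 1" .
    qed
    also have "\<dots> \<le> C * norm (w a)" using mono[OF t] by (intro mult_right_mono) auto
    finally show ?thesis .
  qed
  moreover have "1 / C > 0" using C by simp
  ultimately show ?thesis using that C by metis
qed

lemma deviation_linearization:
  assumes "D \<ge> 0" "e > 0"
  obtains d where "d > 0"
    "\<And>a b x w u. \<lbrakk>b - a \<le> D; \<And>t. t \<in> {a..b} \<Longrightarrow> norm (x t) \<le> R;
       \<And>t. t \<in> {a..b} \<Longrightarrow> (w has_vector_derivative f (w t + x t) - f (x t)) (at t within {a..b});
       \<And>t. t \<in> {a..b} \<Longrightarrow> (u has_vector_derivative f' (x t) (u t)) (at t within {a..b});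
       u a = w a; norm (w a) < d\<rbrakk>
      \<Longrightarrow> \<forall>t\<in>{a..b}. norm (w t - u t) \<le> e * (t - a) * norm (w a)"
proof -
  obtain C d0 where C: "C \<ge> 1" "d0 > 0"
    "\<And>a b x w. \<lbrakk>b - a \<le> D; \<And>t. t \<in> {a..b} \<Longrightarrow> norm (x t) \<le> R;
       \<And>t. t \<in> {a..b} \<Longrightarrow> (w has_vector_derivative f (w t + x t) - f (x t)) (at t within {a..b});
       norm (w a) < d0\<rbrakk> \<Longrightarrow> \<forall>t\<in>{a..b}. norm (w t) \<le> C * norm (w a)"
    using deviation_bound[OF assms(1)] by metis
  obtain L where L: "L \<ge> 0" "\<And>y. norm y \<le> R \<Longrightarrow> norm (f' y) \<le> L"
    using lipschitz_ball[of R] by metis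
  define G where "G = exp (L * D)"
  have G: "G > 0" by (simp add: G_def)
  \<comment> \<open>Along a deviation of size at most \<open>C * norm (w a)\<close> the remainder
    acts as an inhomogeneity of size \<open>\<eta> * C * norm (w a)\<close>. Gronwall multiplies it
    by the elapsed time and at most \<open>G\<close>, and the result is to be \<open>e\<close> times
    the elapsed time.\<close>
  define \<eta> where "\<eta> = e / (G * C)"
  have \<eta>: "\<eta> > 0" "G * (\<eta> * C) = e" using assms(2) G C(1) by (auto simp: \<eta>_def)
  obtain d1 where d1: "d1 > 0"
    "\<And>y w. norm y \<le> R \<Longrightarrow> norm w \<le> d1 \<Longrightarrow> norm (f (w + y) - f y - f' y w) \<le> \<eta> * norm w"
    using linearization_ball[OF \<eta>(1)] by metis
  define d where "d = min d0 (d1 / C)"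
  have "norm (w t - u t) \<le> e * (t - a) * norm (w a)"
    if D: "b - a \<le> D" and x: "\<And>t. t \<in> {a..b} \<Longrightarrow> norm (x t) \<le> R"
      and w: "\<And>t. t \<in> {a..b} \<Longrightarrow> (w has_vector_derivative f (w t + x t) - f (x t)) (at t within {a..b})"
      and u: "\<And>t. t \<in> {a..b} \<Longrightarrow> (u has_vector_derivative f' (x t) (u t)) (at t within {a..b})"
      and ua: "u a = w a" and wa: "norm (w a) < d" and t: "t \<in> {a..b}" for a b x w u t
  proof -
    have wC: "\<forall>t\<in>{a..b}. norm (w t) \<le> C * norm (w a)"
      using C(3)[OF D x w] wa by (simp add: d_def)
    define c where "c = \<eta> * (C * norm (w a))"
    have "norm (w t - u t) \<le> exp (L * (t - a)) * (norm (w a - u a) + c * (t - a))"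
    proof (rule gronwall[OF _ _ \<open>L \<ge> 0\<close> _ t])
      show "((\<lambda>t. w t - u t) has_vector_derivative f (w s + x s) - f (x s) - f' (x s) (u s))
          (at s within {a..b})" if "s \<in> {a..b}" for s
        by (rule has_vector_derivative_diff[OF w[OF that] u[OF that]])
      show "c \<ge> 0" using \<eta> C by (simp add: c_def)
      fix s assume "s \<in> {a<..<b}"
      then have s: "s \<in> {a..b}" by simp
      have "norm (w s) \<le> C * norm (w a)" using wC s by blast
      also have "\<dots> \<le> d1" using wa C(1) by (simp add: d_def field_simps)
      finally have "norm (f (w s + x s) - f (x s) - f' (x s) (w s)) \<le> \<eta> * norm (w s)"
        using d1(2) x[OF s] by blast
      also have "\<dots> \<le> c" using wC s \<eta> by (simp add: c_def)
      finally have 1: "norm (f (w s + x s) - f (x s) - f' (x s) (w s)) \<le> c" .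
      have "norm (f' (x s) (w s - u s)) \<le> norm (f' (x s)) * norm (w s - u s)" by (rule norm_blinfun)
      also have "\<dots> \<le> L * norm (w s - u s)" using L(2) x[OF s] by (intro mult_right_mono) auto
      finally show "norm (f (w s + x s) - f (x s) - f' (x s) (u s)) \<le> L * norm (w s - u s) + c"
        using 1 norm_triangle_ineq[of "f' (x s) (w s - u s)" "f (w s + x s) - f (x s) - f' (x s) (w s)"]
        by (simp add: blinfun.diff_right algebra_simps)
    qed
    also have "\<dots> = exp (L * (t - a)) * (c * (t - a))" using ua by simp
    also have "\<dots> \<le> G * (c * (t - a))"
      using t D L \<eta> C by (auto simp: G_def c_def intro!: mult_right_mono mult_left_mono)
    also have "\<dots> = (G * (\<eta> * C)) * (t - a) * norm (w a)" by (simp add: c_def)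
    finally show ?thesis by (simp add: \<eta>)
  qed
  moreover have "d > 0" using C d1 by (simp add: d_def)
  ultimately show ?thesis using that by metis
qed

lemma autonomous_unique:
  assumes y: "\<And>t. t \<in> {a..b} \<Longrightarrow> (y has_vector_derivative f (y t)) (at t within {a..b})"
    and z: "\<And>t. t \<in> {a..b} \<Longrightarrow> (z has_vector_derivative f (z t)) (at t within {a..b})"
    and eq: "y a = z a" and t: "t \<in> {a..b}"
  shows "y t = z t"
proof -
  have "compact (y ` {a..b} \<union> z ` {a..b})"
    using has_vector_derivative_imp_continuous_on[OF y] has_vector_derivative_imp_continuous_on[OF z]
    by (intro compact_Un compact_continuous_image) auto
  then obtain R where R: "\<And>s. s \<in> {a..b} \<Longrightarrow> norm (y s) \<le> R \<and> norm (z s) \<le> R"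
    by (metis (no_types, lifting) UnCI bounded_iff compact_imp_bounded image_eqI)
  obtain L where L: "L \<ge> 0"
    "\<And>y z. norm y \<le> R \<Longrightarrow> norm z \<le> R \<Longrightarrow> norm (f y - f z) \<le> L * norm (y - z)"
    using lipschitz_ball[of R] by metis
  have "norm (y t - z t) \<le> exp (L * (t - a)) * (norm (y a - z a) + 0 * (t - a))"
  proof (rule gronwall[OF _ _ \<open>L \<ge> 0\<close> _ t])
    show "((\<lambda>t. y t - z t) has_vector_derivative f (y s) - f (z s)) (at s within {a..b})"
      if "s \<in> {a..b}" for s
      by (rule has_vector_derivative_diff[OF y[OF that] z[OF that]])
    show "norm (f (y s) - f (z s)) \<le> L * norm (y s - z s) + 0" if "s \<in> {a<..<b}" for s
      using L(2) R[of s] that by simp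
  qed simp
  then show ?thesis using eq by simp
qed

end

section \<open>Norms adapted to families of linear maps\<close>

lemma linear_funpow:
  fixes B :: "'a::real_vector \<Rightarrow> 'a"
  assumes "linear B"
  shows "linear (B ^^ k)"
proof (induction k)
  case (Suc k)
  then show ?case using linear_compose[OF Suc assms] by (simp only: funpow.simps)
qed (simp add: linear_id[unfolded id_def] id_def)


text \<open>Adapted norm of a family of maps. If composing with a further map sends the family into
  itself, that map does not expand this norm. It is used for the future evolution operators
  \<open>X r s\<close>, for the powers of \<open>M\<close>, and for the rescaled powers of
  \<open>B\<close>, where it yields a genuine contraction.\<close>

definition sup_norm :: "'i set \<Rightarrow> ('i \<Rightarrow> 'a::real_normed_vector \<Rightarrow> 'b::real_normed_vector) \<Rightarrow> 'a \<Rightarrow> real"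
  where "sup_norm I \<Lambda> v = (SUP i\<in>I. norm (\<Lambda> i v))"

locale bounded_family =
  fixes I :: "'i set" and \<Lambda> :: "'i \<Rightarrow> 'a::real_normed_vector \<Rightarrow> 'b::real_normed_vector" and K :: real
  assumes nonempty: "I \<noteq> {}" and lin: "i \<in> I \<Longrightarrow> linear (\<Lambda> i)"
    and bound: "i \<in> I \<Longrightarrow> norm (\<Lambda> i v) \<le> K * norm v"
begin

lemma sup_norm_le: "sup_norm I \<Lambda> v \<le> K * norm v"
  unfolding sup_norm_def using nonempty bound by (intro cSUP_least) auto

lemma le_sup_norm: "i \<in> I \<Longrightarrow> norm (\<Lambda> i v) \<le> sup_norm I \<Lambda> v"
  unfolding sup_norm_def using bound by (intro cSUP_upper bdd_aboveI2[where M = "K * norm v"]) auto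

lemma sup_norm_leI: "(\<And>i. i \<in> I \<Longrightarrow> norm (\<Lambda> i v) \<le> c) \<Longrightarrow> sup_norm I \<Lambda> v \<le> c"
  unfolding sup_norm_def using nonempty by (intro cSUP_least) auto

lemma sup_norm_triangle: "sup_norm I \<Lambda> (v + w) \<le> sup_norm I \<Lambda> v + sup_norm I \<Lambda> w"
proof (rule sup_norm_leI)
  fix i assume i: "i \<in> I"
  have "norm (\<Lambda> i (v + w)) \<le> norm (\<Lambda> i v) + norm (\<Lambda> i w)"
    using linear_add[OF lin[OF i]] by (simp add: norm_triangle_ineq)
  then show "norm (\<Lambda> i (v + w)) \<le> sup_norm I \<Lambda> v + sup_norm I \<Lambda> w"
    using le_sup_norm[OF i, of v] le_sup_norm[OF i, of w] by linarith
qed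

lemma sup_norm_perturb: "sup_norm I \<Lambda> z \<le> sup_norm I \<Lambda> v + K * norm (z - v)"
  using sup_norm_triangle[of v "z - v"] sup_norm_le[of "z - v"] by simp

end

section \<open>A bounded variational equation makes the error linear\<close>

context C1_field
begin

text \<open>In the norm \<open>V s v\<close>, the largest size that \<open>v\<close> reaches under the variational equation
  after the time \<open>s\<close>, the linearized flow does not expand, so the errors of the single steps add up.\<close>

lemma approximation_bound:
  fixes x :: "real \<Rightarrow> 'a" and \<alpha> :: "real \<Rightarrow> real"
  assumes cx: "continuous_on {0..} x"
    and X: "evolution (\<lambda>t. f' (x t)) X"
    and K: "K \<ge> 1" "\<And>s t v. 0 \<le> s \<Longrightarrow> s \<le> t \<Longrightarrow> norm (X t s v) \<le> K * norm v"
    and t: "t \<ge> 0"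
  shows "\<exists>d>0. \<forall>h>0. \<alpha> h \<ge> 0 \<and> 3 * K * t * \<alpha> h < d \<longrightarrow>
    (\<forall>y\<in>approximations (\<lambda>s y. f (y + x s) - f (x s)) \<alpha> h t. norm (y t) \<le> 3 * K * t * \<alpha> h)"
proof -
  interpret evolution "\<lambda>t. f' (x t)" X by (rule X)
  define F where "F = (\<lambda>s y. f (y + x s) - f (x s))"
  have "compact (x ` {0..t})"
    by (intro compact_continuous_image continuous_on_subset[OF cx]) auto
  then obtain R where R: "\<And>s. s \<in> {0..t} \<Longrightarrow> norm (x s) \<le> R"
    by (meson bounded_iff compact_imp_bounded image_eqI)
  define V where "V s = sup_norm {s..} (\<lambda>r. blinfun_apply (X r s))" for s
  have bf: "bounded_family {s..} (\<lambda>r. blinfun_apply (X r s)) K" if "s \<ge> 0" for s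
    using K(2) that
    by unfold_locales (auto simp: blinfun.add_right blinfun.scaleR_right)
  have normV: "norm v \<le> V s v" if "s \<ge> 0" for s v
    using bounded_family.le_sup_norm[OF bf[OF that], of s v] X_diag[OF that] by (simp add: V_def)
  \<comment> \<open>The nonlinear remainder at rate \<open>e\<close> enters \<open>V\<close> with
    the factor \<open>K\<close>. This choice makes the resulting growth rate \<kappa> satisfy
    \<open>\<kappa> * t \<le> 1\<close>, so all the growth factors together cost at most exp 1 \<le>
    3.\<close>
  define e where "e = 1 / (K * (t + 1))"
  have e: "e > 0" using K t by (simp add: e_def)
  define \<kappa> where "\<kappa> = K * e"
  have \<kappa>: "\<kappa> > 0" "\<kappa> * t \<le> 1" using K t e by (auto simp: \<kappa>_def e_def field_simps)
  have exp3: "exp (\<kappa> * s) \<le> 3" if "s \<le> t" for s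
  proof -
    have "\<kappa> * s \<le> 1" using mult_left_mono[OF that, of \<kappa>] \<kappa> by linarith
    then show ?thesis using exp_le by (meson exp_le_cancel_iff order_trans)
  qed
  obtain d where d: "d > 0" and lin: "\<And>a b x w u. \<lbrakk>b - a \<le> t; \<And>t. t \<in> {a..b} \<Longrightarrow> norm (x t) \<le> R;
       \<And>t. t \<in> {a..b} \<Longrightarrow> (w has_vector_derivative f (w t + x t) - f (x t)) (at t within {a..b});
       \<And>t. t \<in> {a..b} \<Longrightarrow> (u has_vector_derivative f' (x t) (u t)) (at t within {a..b});
       u a = w a; norm (w a) < d\<rbrakk>
      \<Longrightarrow> \<forall>t\<in>{a..b}. norm (w t - u t) \<le> e * (t - a) * norm (w a)"
    using deviation_linearization[OF t e, of R] by metis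
  have step: "V r \<zeta> \<le> (1 + \<kappa> * (r - s)) * V s \<eta>"
    if s: "0 \<le> s" "s \<le> r" "r \<le> t" and \<eta>: "norm \<eta> < d" and ev: "evolves F s \<eta> r \<zeta>" for s r \<eta> \<zeta>
  proof -
    from ev obtain y where y: "solves F {s..r} y" "y s = \<eta>" "y r = \<zeta>"
      by (auto simp: evolves_def)
    have "\<forall>q\<in>{s..r}. norm (y q - X q s \<eta>) \<le> e * (q - s) * norm (y s)"
    proof (rule lin[where x = x])
      show "(y has_vector_derivative f (y q + x q) - f (x q)) (at q within {s..r})"
        if "q \<in> {s..r}" for q
        using y(1) that by (auto simp: solves_def F_def)
      show "((\<lambda>q. X q s \<eta>) has_vector_derivative f' (x q) (X q s \<eta>)) (at q within {s..r})"
        if "q \<in> {s..r}" for q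
        using X_apply_deriv[OF s(1) that] .
    qed (use s R y \<eta> X_diag in auto)
    then have 1: "norm (\<zeta> - X r s \<eta>) \<le> e * (r - s) * norm \<eta>" using y s by auto
    \<comment> \<open>The future of \<open>X r s \<eta>\<close> from the time \<open>r\<close> on is
      part of the future of \<eta> from the time \<open>s\<close> on.\<close>
    have 2: "V r (X r s \<eta>) \<le> V s \<eta>"
      unfolding V_def[of r]
    proof (rule bounded_family.sup_norm_leI[OF bf])
      fix q assume "q \<in> {r..}"
      then have q: "r \<le> q" by simp
      have "X q r (X r s \<eta>) = X q s \<eta>" using X_comp[OF s(1,2) q] .
      then show "norm (X q r (X r s \<eta>)) \<le> V s \<eta>"
        using bounded_family.le_sup_norm[OF bf[OF s(1)], of q \<eta>] q s by (simp add: V_def)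
    qed (use s in auto)
    have "V r \<zeta> \<le> V r (X r s \<eta>) + K * norm (\<zeta> - X r s \<eta>)"
      unfolding V_def by (rule bounded_family.sup_norm_perturb[OF bf]) (use s in auto)
    also have "\<dots> \<le> V s \<eta> + K * (e * (r - s) * V s \<eta>)"
      using 1 2 normV[OF s(1), of \<eta>] K e s
      by (intro add_mono mult_left_mono order_trans[OF 1]) auto
    finally show ?thesis by (simp add: \<kappa>_def algebra_simps)
  qed
  have main: "norm (y t) \<le> 3 * K * t * \<alpha> h"
    if h: "h > 0" and \<alpha>: "\<alpha> h \<ge> 0" and small: "3 * K * t * \<alpha> h < d"
      and y: "y \<in> approximations F \<alpha> h t" for h y
  proof -
    from y obtain v where v: "\<And>n. norm (v n) \<le> 1" and y0: "y 0 = 0"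
      and jump: "\<And>n. real (Suc n) * h \<le> t \<Longrightarrow>
        (\<exists>\<zeta>. evolves F (real n * h) (y (real n * h)) (real (Suc n) * h) \<zeta> \<and>
          y (real (Suc n) * h) = \<zeta> + (h * \<alpha> h) *\<^sub>R v n)"
      and flow: "\<And>n q. \<lbrakk>real n * h \<le> q; q < real (Suc n) * h; q \<le> t\<rbrakk> \<Longrightarrow>
        evolves F (real n * h) (y (real n * h)) q (y q)"
      unfolding approximations_def by blast
    \<comment> \<open>\<open>K * s * \<alpha> h\<close> is the plain sum of the step errors up to
      the time \<open>s\<close>, each of size at most \<open>K * h * \<alpha> h\<close> in
      \<open>V\<close>; the exponential absorbs the factors \<open>1 + \<kappa> * h\<close>.\<close>
    define b where "b s = exp (\<kappa> * s) * (K * s * \<alpha> h)" for s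
    have b_le: "b s \<le> 3 * K * t * \<alpha> h" if "0 \<le> s" "s \<le> t" for s
    proof -
      have "b s \<le> 3 * (K * t * \<alpha> h)"
        unfolding b_def using exp3[OF that(2)] that K \<alpha>
        by (intro mult_mono) (auto intro!: mult_right_mono mult_left_mono)
      then show ?thesis by simp
    qed
    have grow: "(1 + \<kappa> * (r - s)) * b s \<le> exp (\<kappa> * r) * (K * s * \<alpha> h)" if "0 \<le> s" "s \<le> r" for s r
    proof -
      have "(1 + \<kappa> * (r - s)) * b s \<le> exp (\<kappa> * (r - s)) * b s"
        using that K \<alpha> exp_ge_add_one_self[of "\<kappa> * (r - s)"]
        by (intro mult_right_mono) (auto simp: b_def)
      also have "\<dots> = exp (\<kappa> * r) * (K * s * \<alpha> h)"
        by (simp add: b_def mult.assoc[symmetric] exp_add[symmetric]) (simp add: algebra_simps)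
      finally show ?thesis .
    qed
    have Vb: "V (real n * h) (y (real n * h)) \<le> b (real n * h)" if "real n * h \<le> t" for n
      using that
    proof (induction n)
      case 0
      then show ?case
        using bounded_family.sup_norm_le[OF bf, of 0 "0::'a"] by (simp add: V_def y0 b_def)
    next
      case (Suc n)
      define s where "s = real n * h"
      define r where "r = real (Suc n) * h"
      have rs: "r = s + h" by (simp add: r_def s_def algebra_simps)
      have s: "0 \<le> s" "s \<le> r" "r \<le> t" using Suc.prems h by (auto simp: s_def r_def algebra_simps)
      have IH: "V s (y s) \<le> b s" using Suc.IH s by (simp add: s_def)
      have "norm (y s) < d" using normV[OF s(1), of "y s"] IH b_le[of s] s small by linarith
      obtain \<zeta> where \<zeta>: "evolves F s (y s) r \<zeta>" "y r = \<zeta> + (h * \<alpha> h) *\<^sub>R v n"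
        using jump[OF Suc.prems] by (auto simp: s_def r_def)
      have "V r (y r) \<le> V r \<zeta> + K * norm (y r - \<zeta>)"
        unfolding V_def by (rule bounded_family.sup_norm_perturb[OF bf]) (use s in auto)
      also have "V r \<zeta> \<le> (1 + \<kappa> * (r - s)) * V s (y s)" by (rule step) fact+
      also have "\<dots> \<le> (1 + \<kappa> * (r - s)) * b s" using IH \<kappa> s by (intro mult_left_mono) auto
      also have "\<dots> \<le> exp (\<kappa> * r) * (K * s * \<alpha> h)" using grow s by simp
      also have "K * norm (y r - \<zeta>) \<le> K * (h * \<alpha> h)"
        using K h \<alpha> v[of n] by (auto simp: \<zeta>(2) abs_mult intro!: mult_left_le)
      also have "K * (h * \<alpha> h) \<le> exp (\<kappa> * r) * (K * (h * \<alpha> h))"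
        using K h \<alpha> \<kappa> s mult_right_mono[of 1 "exp (\<kappa> * r)" "K * (h * \<alpha> h)"] by auto
      also have "exp (\<kappa> * r) * (K * s * \<alpha> h) + exp (\<kappa> * r) * (K * (h * \<alpha> h)) = b r"
        by (simp add: b_def rs algebra_simps)
      finally show ?case by (simp add: r_def)
    qed
    \<comment> \<open>The last grid point not after \<open>t\<close>. From there to \<open>t\<close>
      only the flow acts, without a further perturbation.\<close>
    define n where "n = nat \<lfloor>t / h\<rfloor>"
    have "real n \<le> t / h" "t / h < real n + 1" using t h by (auto simp: n_def)
    then have n: "real n * h \<le> t" "t < real (Suc n) * h" using h by (auto simp: field_simps)
    define s where "s = real n * h"
    have s: "0 \<le> s" "s \<le> t" using n h by (auto simp: s_def)
    have IH: "V s (y s) \<le> b s" using Vb[OF n(1)] by (simp add: s_def)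
    have "norm (y s) < d" using normV[OF s(1), of "y s"] IH b_le[of s] s small by linarith
    have "norm (y t) \<le> V t (y t)" by (rule normV[OF t])
    also have "\<dots> \<le> (1 + \<kappa> * (t - s)) * V s (y s)"
      using flow[OF n(1,2)] by (intro step s order_refl \<open>norm (y s) < d\<close>) (simp add: s_def)
    also have "\<dots> \<le> (1 + \<kappa> * (t - s)) * b s" using IH \<kappa> s by (intro mult_left_mono) auto
    also have "\<dots> \<le> exp (\<kappa> * t) * (K * s * \<alpha> h)" using grow s by simp
    also have "\<dots> \<le> b t"
      unfolding b_def using s K \<alpha> by (auto intro!: mult_left_mono mult_right_mono)
    also have "\<dots> \<le> 3 * K * t * \<alpha> h" using b_le t by simp
    finally show ?thesis .
  qed
  show ?thesis using d main unfolding F_def by blast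
qed

text \<open>For fixed \<open>t\<close> the smallness threshold \<open>d\<close> is met by all small
  \<open>h\<close>, because \<open>\<alpha> h\<close> tends to 0. The division by
  \<open>\<alpha> h > 0\<close> then leaves a bound in which neither \<alpha> nor \<open>d\<close>
  occurs.\<close>

lemma E_orbit_le:
  fixes x :: "real \<Rightarrow> 'a"
  assumes cx: "continuous_on {0..} x"
    and X: "evolution (\<lambda>t. f' (x t)) X"
    and K: "K \<ge> 1" "\<And>s t v. 0 \<le> s \<Longrightarrow> s \<le> t \<Longrightarrow> norm (X t s v) \<le> K * norm v"
    and \<alpha>: "error_scale \<alpha>" and t: "t \<ge> 0"
  shows "E_orbit f x \<alpha> t \<le> ereal (3 * K * t)"
proof -
  have "\<exists>d>0. \<forall>h>0. \<alpha> h \<ge> 0 \<and> 3 * K * t * \<alpha> h < d \<longrightarrow>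
    (\<forall>y\<in>approximations (\<lambda>s y. f (y + x s) - f (x s)) \<alpha> h t. norm (y t) \<le> 3 * K * t * \<alpha> h)"
    using t by (intro approximation_bound[OF cx X K])
  then obtain d where d: "d > 0" "\<And>h. h > 0 \<Longrightarrow> \<alpha> h \<ge> 0 \<Longrightarrow> 3 * K * t * \<alpha> h < d \<Longrightarrow>
    (\<forall>y\<in>approximations (\<lambda>s y. f (y + x s) - f (x s)) \<alpha> h t. norm (y t) \<le> 3 * K * t * \<alpha> h)"
    by blast
  have pos: "\<alpha> h > 0" if "h > 0" for h
    using \<alpha> that strict_mono_onD[of "{0..}" \<alpha> 0 h] by (auto simp: error_scale_def)
  have "(\<alpha> \<longlongrightarrow> \<alpha> 0) (at 0 within {0..})"
    using \<alpha> unfolding error_scale_def continuous_on_def by (meson atLeast_iff order_refl)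
  then have "(\<alpha> \<longlongrightarrow> 0) (at_right 0)"
    using \<alpha> by (auto simp: error_scale_def intro: tendsto_within_subset)
  then have "((\<lambda>h. 3 * K * t * \<alpha> h) \<longlongrightarrow> 3 * K * t * 0) (at_right 0)"
    by (intro tendsto_intros)
  then have "\<forall>\<^sub>F h in at_right 0. 3 * K * t * \<alpha> h < d"
    using d(1) by (intro order_tendstoD) auto
  moreover have "\<forall>\<^sub>F h in at_right (0::real). h > 0" by (rule eventually_at_right_less)
  ultimately have "\<forall>\<^sub>F h in at_right 0.
    approx_error (\<lambda>s y. f (y + x s) - f (x s)) \<alpha> t h / ereal (\<alpha> h) \<le> ereal (3 * K * t)"
  proof eventually_elim
    case (elim h)
    have "approx_error (\<lambda>s y. f (y + x s) - f (x s)) \<alpha> t h \<le> ereal (3 * K * t * \<alpha> h)"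
      unfolding approx_error_def using d(2)[OF elim(2) _ elim(1)] pos[OF elim(2)]
      by (intro SUP_least) auto
    then have "approx_error (\<lambda>s y. f (y + x s) - f (x s)) \<alpha> t h / ereal (\<alpha> h)
        \<le> ereal (3 * K * t * \<alpha> h) / ereal (\<alpha> h)"
      using pos[OF elim(2)] by (intro ereal_divide_right_mono) auto
    also have "\<dots> = ereal (3 * K * t)" using pos[OF elim(2)] by simp
    finally show ?case .
  qed
  then show ?thesis unfolding E_orbit_def E_zero_def by (rule Limsup_bounded)
qed

end

section \<open>Geometric decay of powers from the spectrum\<close>

text \<open>The pair \<open>(u, w)\<close> stands for the vector \<open>u + \<i> w\<close> of the complexification.\<close>

definition cscale :: "complex \<Rightarrow> 'a::euclidean_space \<times> 'a \<Rightarrow> 'a \<times> 'a" where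
  "cscale \<mu> z = (Re \<mu> *\<^sub>R fst z - Im \<mu> *\<^sub>R snd z, Im \<mu> *\<^sub>R fst z + Re \<mu> *\<^sub>R snd z)"

lemma cscale_add_right: "cscale \<mu> (z + z') = cscale \<mu> z + cscale \<mu> z'"
  by (simp add: cscale_def algebra_simps)

lemma cscale_add_left: "cscale (\<mu> + \<nu>) z = cscale \<mu> z + cscale \<nu> z"
  by (simp add: cscale_def algebra_simps)

lemma cscale_mult: "cscale (\<mu> * \<nu>) z = cscale \<mu> (cscale \<nu> z)"
  by (simp add: cscale_def algebra_simps)

lemma cscale_minus: "cscale (- \<mu>) z = - cscale \<mu> z"
  by (simp add: cscale_def)

lemma cscale_0_left [simp]: "cscale 0 z = 0"
  by (simp add: cscale_def zero_prod_def)

lemma cscale_0_right [simp]: "cscale \<mu> 0 = 0"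
  by (simp add: cscale_def zero_prod_def)

lemma cscale_1 [simp]: "cscale 1 z = z"
  by (simp add: cscale_def)

lemma cscale_of_real: "cscale (of_real c) (u, w) = (c *\<^sub>R u, c *\<^sub>R w)"
  by (simp add: cscale_def)

text \<open>The norm of a pair is the Euclidean norm of the complexification; the mixed terms in the
  two squares cancel.\<close>

lemma norm_cscale: "norm (cscale \<mu> z) = cmod \<mu> * norm z"
proof -
  obtain u w where z: "z = (u, w)" by (cases z)
  have "(norm (cscale \<mu> z))\<^sup>2 =
      (norm (Re \<mu> *\<^sub>R u - Im \<mu> *\<^sub>R w))\<^sup>2 + (norm (Im \<mu> *\<^sub>R u + Re \<mu> *\<^sub>R w))\<^sup>2"
    by (simp add: z cscale_def norm_Pair)
  also have "\<dots> = ((Re \<mu>)\<^sup>2 + (Im \<mu>)\<^sup>2) * ((norm u)\<^sup>2 + (norm w)\<^sup>2)"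
    by (simp only: power2_norm_eq_inner)
      (simp add: inner_diff_left inner_diff_right inner_add_left inner_add_right inner_commute
        algebra_simps power2_eq_square)
  also have "\<dots> = (cmod \<mu> * norm z)\<^sup>2"
    by (simp add: z norm_Pair power_mult_distrib cmod_power2)
  finally have "(norm (cscale \<mu> z))\<^sup>2 = (cmod \<mu> * norm z)\<^sup>2" .
  then show ?thesis by (simp add: power2_eq_iff_nonneg)
qed

locale complexified =
  fixes B :: "'a::euclidean_space \<Rightarrow> 'a"
  assumes lin: "linear B"
begin

definition BC :: "'a \<times> 'a \<Rightarrow> 'a \<times> 'a" where
  "BC z = (B (fst z), B (snd z))"

lemma BC_add: "BC (z + z') = BC z + BC z'"
  by (simp add: BC_def linear_add[OF lin])

lemma BC_diff: "BC (z - z') = BC z - BC z'"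
  by (simp add: BC_def linear_diff[OF lin])

lemma BC_0 [simp]: "BC 0 = 0"
  by (simp add: BC_def linear_0[OF lin] zero_prod_def)

lemma BC_cscale: "BC (cscale \<mu> z) = cscale \<mu> (BC z)"
  by (simp add: BC_def cscale_def linear_add[OF lin] linear_diff[OF lin] linear_scale[OF lin])

lemma BC_power_diff: "(BC ^^ k) (z - z') = (BC ^^ k) z - (BC ^^ k) z'"
  by (induction k) (simp_all add: BC_diff)

lemma BC_power_cscale: "(BC ^^ k) (cscale \<mu> z) = cscale \<mu> ((BC ^^ k) z)"
  by (induction k) (simp_all add: BC_cscale)

lemma BC_power_real: "(BC ^^ k) (v, 0) = ((B ^^ k) v, 0)"
  by (induction k) (simp_all add: BC_def linear_0[OF lin])

text \<open>The vector obtained by applying the polynomial \<open>p\<close> of the complexified map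
  to \<open>z\<close>, evaluated by Horner's rule.\<close>

definition act :: "complex poly \<Rightarrow> 'a \<times> 'a \<Rightarrow> 'a \<times> 'a" where
  "act p z = fold_coeffs (\<lambda>a y. cscale a z + BC y) p 0"

lemma act_0 [simp]: "act 0 z = 0"
  by (simp add: act_def)

lemma act_pCons: "act (pCons a p) z = cscale a z + BC (act p z)"
  by (cases "a = 0 \<and> p = 0") (auto simp: act_def)

lemma act_add: "act (p + q) z = act p z + act q z"
  by (induction p q rule: poly_induct2) (simp_all add: act_pCons BC_add cscale_add_left)

lemma act_smult: "act (smult c p) z = cscale c (act p z)"
  by (induction p) (simp_all add: act_pCons BC_cscale cscale_add_right cscale_mult)

lemma act_monom: "act (monom c n) z = cscale c ((BC ^^ n) z)"
  by (induction n) (simp_all add: monom_0 monom_Suc act_pCons BC_cscale)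

lemma act_sum: "act (sum p I) z = (\<Sum>i\<in>I. act (p i) z)"
  by (induction I rule: infinite_finite_induct) (simp_all add: act_add)

lemma act_linear_factor: "act ([:- \<mu>, 1:] * q) z = BC (act q z) - cscale \<mu> (act q z)"
proof -
  have "[:- \<mu>, 1:] * q = smult (- \<mu>) q + pCons 0 q" by simp
  then show ?thesis by (simp only: act_add act_smult act_pCons cscale_minus) simp
qed

lemma act_commute: "act q (BC z - cscale \<mu> z) = BC (act q z) - cscale \<mu> (act q z)"
proof (induction q)
  case (pCons a q)
  have "cscale a (BC z - cscale \<mu> z) = BC (cscale a z) - cscale \<mu> (cscale a z)"
    using cscale_add_right[of a "BC z - cscale \<mu> z" "cscale \<mu> z"]
    by (simp add: BC_cscale cscale_mult[symmetric] mult.commute eq_diff_eq)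
  then show ?case
    by (simp add: act_pCons pCons.IH BC_add BC_diff BC_cscale cscale_add_right)
qed simp

text \<open>The constants may depend on \<open>z\<close>. A uniform rate is recovered later from the
  finitely many basis vectors.\<close>

definition decays :: "'a \<times> 'a \<Rightarrow> bool" where
  "decays z \<longleftrightarrow> (\<exists>C \<rho>. 0 < \<rho> \<and> \<rho> < 1 \<and> (\<forall>k. norm ((BC ^^ k) z) \<le> C * \<rho> ^ k))"

lemma decays_factor:
  assumes "decays (BC z - cscale \<mu> z)" "cmod \<mu> < 1"
  shows "decays z"
proof -
  from assms(1) obtain C \<rho> where \<rho>: "0 < \<rho>" "\<rho> < 1"
    and C: "\<And>k. norm ((BC ^^ k) (BC z - cscale \<mu> z)) \<le> C * \<rho> ^ k"
    unfolding decays_def by blast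
  have C0: "C \<ge> 0" using order_trans[OF norm_ge_zero C[of 0]] by simp
  \<comment> \<open>A rate strictly above both \<rho> and \<open>cmod \<mu>\<close> absorbs the
    polynomial factor that resonance of the two would produce.\<close>
  obtain \<sigma> where \<sigma>: "max \<rho> (cmod \<mu>) < \<sigma>" "\<sigma> < 1"
    using \<rho> assms(2) dense[of "max \<rho> (cmod \<mu>)" 1] by auto
  \<comment> \<open>The first entry starts the induction; the second gives
    \<open>cmod \<mu> * C' + C \<le> \<sigma> * C'\<close>, which carries it on.\<close>
  define C' where "C' = max (norm z) (C / (\<sigma> - cmod \<mu>))"
  have "C = (\<sigma> - cmod \<mu>) * (C / (\<sigma> - cmod \<mu>))" using \<sigma> by auto
  also have "\<dots> \<le> (\<sigma> - cmod \<mu>) * C'"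
    using \<sigma> by (intro mult_left_mono) (auto simp: C'_def)
  finally have C': "norm z \<le> C'" "C \<le> (\<sigma> - cmod \<mu>) * C'"
    by (auto simp: C'_def)
  have "norm ((BC ^^ k) z) \<le> C' * \<sigma> ^ k" for k
  proof (induction k)
    case (Suc k)
    have "(BC ^^ Suc k) z = cscale \<mu> ((BC ^^ k) z) + (BC ^^ k) (BC z - cscale \<mu> z)"
      by (simp add: BC_power_diff BC_power_cscale funpow_swap1)
    then have "norm ((BC ^^ Suc k) z) \<le> cmod \<mu> * norm ((BC ^^ k) z) + C * \<rho> ^ k"
      using norm_triangle_ineq[of "cscale \<mu> ((BC ^^ k) z)"] C[of k]
      by (metis norm_cscale add_left_mono order_trans)
    also have "\<dots> \<le> cmod \<mu> * (C' * \<sigma> ^ k) + ((\<sigma> - cmod \<mu>) * C') * \<sigma> ^ k"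
      using Suc \<rho> \<sigma> C' C0 by (intro add_mono mult_left_mono mult_mono power_mono) auto
    also have "\<dots> = C' * \<sigma> ^ Suc k" by (simp add: algebra_simps)
    finally show ?case .
  qed (use C' in simp)
  then show ?thesis unfolding decays_def using \<sigma> \<rho> by (intro exI[of _ C'] exI[of _ \<sigma>]) auto
qed

text \<open>Splitting off a linear factor \<open>B - \<mu>\<close> of the annihilating polynomial either is harmless,
  since \<open>B - \<mu>\<close> is injective, or leads to a scalar recurrence with ratio \<open>\<mu>\<close> inside the unit disc.\<close>

lemma annihilated_decays:
  assumes spec: "\<And>\<mu> z. z \<noteq> 0 \<Longrightarrow> BC z = cscale \<mu> z \<Longrightarrow> cmod \<mu> < 1"
  shows "p \<noteq> 0 \<Longrightarrow> act p z = 0 \<Longrightarrow> decays z"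
\<comment> \<open>The vector is kept arbitrary because the hypothesis is applied to
  \<open>BC z - cscale \<mu> z\<close> as well as to \<open>z\<close>.\<close>
proof (induction "degree p" arbitrary: p z rule: less_induct)
  case less
  show ?case
  proof (cases "degree p = 0")
    case True
    then obtain c where c: "p = [:c:]" "c \<noteq> 0" using less.prems(1) by (metis degree_eq_zeroE pCons_0_0)
    then have "cmod c * norm z = 0" using less.prems(2) by (simp add: act_pCons norm_cscale[symmetric])
    then have "z = 0" using c by simp
    moreover have "(BC ^^ k) 0 = 0" for k by (induction k) simp_all
    ultimately show ?thesis unfolding decays_def by (intro exI[of _ 0] exI[of _ "1/2"]) simp
  next
    case False
    then obtain \<mu> where "poly p \<mu> = 0"
      using fundamental_theorem_of_algebra[of p] by (auto simp: constant_degree)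
    then obtain q where q: "p = [:- \<mu>, 1:] * q" by (auto simp: poly_eq_0_iff_dvd)
    have "q \<noteq> 0" using q less.prems(1) by auto
    then have "degree p = Suc (degree q)" unfolding q by (subst degree_mult_eq) auto
    then have deg: "degree q < degree p" by simp
    have *: "BC (act q z) - cscale \<mu> (act q z) = 0"
      using less.prems(2) by (simp only: q act_linear_factor)
    show ?thesis
    proof (cases "act q z = 0")
      case True
      then show ?thesis using less.hyps deg \<open>q \<noteq> 0\<close> by blast
    next
      case False
      \<comment> \<open>Now \<open>act q z\<close> is itself an eigenvector for \<mu>. Moreover
        \<open>q\<close> annihilates \<open>BC z - cscale \<mu> z\<close>, since polynomials of one
        map commute.\<close>
      then have "cmod \<mu> < 1" using spec * by simp
      moreover have "decays (BC z - cscale \<mu> z)"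
        using less.hyps[OF deg \<open>q \<noteq> 0\<close>] * by (simp add: act_commute)
      ultimately show ?thesis using decays_factor by blast
    qed
  qed
qed

text \<open>The d + 1 iterates of \<open>v\<close> up to exponent d = \<open>DIM('a)\<close> satisfy
  a linear relation. Its coefficients form a polynomial that annihilates this one vector, which is
  enough for its decay.\<close>

lemma annihilating_poly: "\<exists>p. p \<noteq> 0 \<and> act p (v, 0) = 0"
proof -
  define d where "d = DIM('a)"
  define y where "y i = (B ^^ i) v" for i
  have "\<exists>c. (\<exists>i\<le>d. c i \<noteq> 0) \<and> (\<Sum>i\<le>d. c i *\<^sub>R y i) = 0"
  proof (cases "inj_on y {..d}")
    case True
    have "dependent (y ` {..d})"
      using card_image[OF True] by (intro dependent_biggerset) (simp_all add: d_def)
    then obtain u where u: "\<exists>x\<in>y ` {..d}. u x \<noteq> 0" "(\<Sum>x\<in>y ` {..d}. u x *\<^sub>R x) = 0"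
      using dependent_finite[of "y ` {..d}"] by auto
    from u(2) have "(\<Sum>i\<le>d. u (y i) *\<^sub>R y i) = 0" by (simp add: sum.reindex[OF True])
    then show ?thesis using u(1) by (intro exI[of _ "\<lambda>i. u (y i)"]) auto
  next
    case False
    then obtain i j where ij: "i \<le> d" "j \<le> d" "i \<noteq> j" "y i = y j" by (auto simp: inj_on_def)
    \<comment> \<open>Linear dependence speaks of sets of vectors, so a repetition among the
      iterates has to supply its own relation.\<close>
    define c :: "nat \<Rightarrow> real" where "c k = (if k = i then 1 else 0) - (if k = j then 1 else 0)" for k
    have "(\<Sum>k\<le>d. c k *\<^sub>R y k)
        = (\<Sum>k\<le>d. if k = i then y k else 0) - (\<Sum>k\<le>d. if k = j then y k else 0)"
      unfolding sum_subtractf[symmetric] by (intro sum.cong) (auto simp: c_def)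
    also have "\<dots> = 0" using ij by simp
    finally show ?thesis using ij by (intro exI[of _ c]) (auto simp: c_def)
  qed
  then obtain c i where c: "i \<le> d" "c i \<noteq> 0" "(\<Sum>i\<le>d. c i *\<^sub>R y i) = 0" by blast
  define p where "p = (\<Sum>i\<le>d. monom (complex_of_real (c i)) i)"
  have "coeff p i = of_real (c i)" using c(1) by (simp add: p_def coeff_sum)
  then have "p \<noteq> 0" using c(2) by auto
  moreover have "act p (v, 0) = (\<Sum>i\<le>d. (c i *\<^sub>R y i, 0))"
    by (simp add: p_def act_sum act_monom BC_power_real cscale_of_real y_def)
  moreover have "\<dots> = 0"
    using c(3) by (simp add: prod_eq_iff fst_sum snd_sum)
  ultimately show ?thesis by auto
qed

end

text \<open>Each basis vector is annihilated by some polynomial and decays at its own rate. The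
  slowest of these rates and the sum of the constants serve for all vectors, without a normal form
  of \<open>B\<close>.\<close>

lemma power_decay:
  fixes B :: "'a::euclidean_space \<Rightarrow> 'a"
  assumes lin: "linear B"
    and spec: "\<And>\<mu> u w. \<lbrakk>u \<noteq> 0 \<or> w \<noteq> 0; B u = Re \<mu> *\<^sub>R u - Im \<mu> *\<^sub>R w;
      B w = Im \<mu> *\<^sub>R u + Re \<mu> *\<^sub>R w\<rbrakk> \<Longrightarrow> cmod \<mu> < 1"
  shows "\<exists>C \<rho>. 0 < \<rho> \<and> \<rho> < 1 \<and> (\<forall>k v. norm ((B ^^ k) v) \<le> C * \<rho> ^ k * norm v)"
proof -
  interpret complexified B by (rule complexified.intro[OF lin])
  have "decays (v, 0)" for v
  proof -
    obtain p where "p \<noteq> 0" "act p (v, 0) = 0" using annihilating_poly by blast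
    then show ?thesis
    proof (rule annihilated_decays[rotated])
      show "cmod \<mu> < 1" if "z \<noteq> 0" "BC z = cscale \<mu> z" for \<mu> z
        using that spec[of "fst z" "snd z" \<mu>] by (auto simp: BC_def cscale_def prod_eq_iff)
    qed
  qed
  then have "\<exists>C \<rho>. 0 < \<rho> \<and> \<rho> < 1 \<and> (\<forall>k. norm ((B ^^ k) v) \<le> C * \<rho> ^ k)" for v
    unfolding decays_def BC_power_real by simp
  then obtain C \<rho> where C: "\<And>v. 0 < \<rho> v" "\<And>v. \<rho> v < 1" "\<And>v k. norm ((B ^^ k) v) \<le> C v * \<rho> v ^ k"
    by metis
  have C0: "C v \<ge> 0" for v using order_trans[OF norm_ge_zero C(3)[of 0 v]] by simp
  define r where "r = Max (\<rho> ` Basis)"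
  have r: "r < 1" "\<And>b. b \<in> Basis \<Longrightarrow> \<rho> b \<le> r" using C(2) by (auto simp: r_def)
  obtain b0 :: 'a where "b0 \<in> Basis" using nonempty_Basis by blast
  then have r0: "0 < r" using r(2)[of b0] C(1)[of b0] by simp
  note linp = linear_funpow[OF lin]
  have "norm ((B ^^ k) v) \<le> (\<Sum>b\<in>Basis. C b) * r ^ k * norm v" for k v
  proof -
    have "(B ^^ k) v = (B ^^ k) (\<Sum>b\<in>Basis. (v \<bullet> b) *\<^sub>R b)" by (simp add: euclidean_representation)
    also have "\<dots> = (\<Sum>b\<in>Basis. (v \<bullet> b) *\<^sub>R (B ^^ k) b)"
      by (simp add: linear_sum[OF linp] linear_scale[OF linp])
    also have "norm \<dots> \<le> (\<Sum>b\<in>Basis. norm v * (C b * r ^ k))"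
    proof (rule sum_norm_le)
      fix b :: 'a assume b: "b \<in> Basis"
      have "norm ((B ^^ k) b) \<le> C b * \<rho> b ^ k" by (rule C(3))
      also have "\<dots> \<le> C b * r ^ k"
        using C0 C(1)[of b] r(2)[OF b] by (intro mult_left_mono power_mono) auto
      finally show "norm ((v \<bullet> b) *\<^sub>R (B ^^ k) b) \<le> norm v * (C b * r ^ k)"
        using Basis_le_norm[OF b, of v] by (auto intro!: mult_mono)
    qed
    also have "\<dots> = (\<Sum>b\<in>Basis. C b) * r ^ k * norm v"
      by (simp add: sum_distrib_left sum_distrib_right mult_ac)
    finally show ?thesis .
  qed
  then show ?thesis using r r0 by blast
qed

section \<open>The return map and the monodromy\<close>

text \<open>The periodic solution is parametrized so that it passes through \<open>p\<close> at the
  time 0, and \<open>m\<close> is the gradient of \<open>g\<close> at \<open>p\<close>. The number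
  \<open>T\<close> is some period and is not assumed to be the return time
  \<open>\<tau> p\<close>.\<close>

locale return_map = C1_field f f' + Z: evolution "\<lambda>s. f' (\<phi> s)" Z
  for f :: "'a::euclidean_space \<Rightarrow> 'a" and f' :: "'a \<Rightarrow> 'a \<Rightarrow>\<^sub>L 'a"
    and \<phi> :: "real \<Rightarrow> 'a" and Z :: "real \<Rightarrow> real \<Rightarrow> 'a \<Rightarrow>\<^sub>L 'a" +
  fixes T :: real and p m :: 'a and S U N :: "'a set" and g :: "'a \<Rightarrow> real"
    and A P :: "'a \<Rightarrow> 'a" and \<tau> :: "'a \<Rightarrow> real"
  assumes \<phi>_deriv: "(\<phi> has_vector_derivative f (\<phi> t)) (at t)"
    and T_pos: "T > 0" and \<phi>_periodic: "\<phi> (t + T) = \<phi> t" and \<phi>_0: "\<phi> 0 = p"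
    and U: "open U" and S_def: "S = {x \<in> U. g x = 0}" and p_S: "p \<in> S"
    and g_cont: "continuous_on U g" and g_deriv: "(g has_derivative (\<lambda>v. m \<bullet> v)) (at p)"
    and transversal: "m \<bullet> f p \<noteq> 0"
    and P_p: "P p = p" and N: "open N" "p \<in> N" and \<tau>_cont: "continuous_on (S \<inter> N) \<tau>"
    and return: "q \<in> S \<Longrightarrow> q \<in> N \<Longrightarrow> first_return f S q (\<tau> q) (P q)"
    and P_deriv: "(P has_derivative A) (at p within S)"
    and spectrum: "eigenvalue_on {v. m \<bullet> v = 0} A \<mu> \<Longrightarrow> cmod \<mu> < 1"
begin

section \<open>Compactness of the cycle and the splitting along the flow direction\<close>

lemma \<phi>_cont: "continuous_on J \<phi>"
  using \<phi>_deriv by (meson continuous_at_imp_continuous_on has_vector_derivative_continuous)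

lemma \<phi>_deriv_within: "(\<phi> has_vector_derivative f (\<phi> t)) (at t within J)"
  using \<phi>_deriv by (rule has_vector_derivative_at_within)

lemma \<phi>_mod: "\<exists>s\<in>{0..T}. \<phi> t = \<phi> s"
proof -
  have nat: "\<phi> (s + real k * T) = \<phi> s" for s k
  proof (induction k)
    case (Suc k)
    have "s + real (Suc k) * T = (s + real k * T) + T" by (simp add: algebra_simps)
    then show ?case using Suc \<phi>_periodic[of "s + real k * T"] by (simp only:)
  qed simp
  have int: "\<phi> (s + of_int k * T) = \<phi> s" for s k
  proof (cases k rule: int_cases2)
    case (nonpos n)
    then show ?thesis using nat[of "s - real n * T" n] by simp
  qed (use nat in simp)
  define k where "k = \<lfloor>t / T\<rfloor>"
  have "of_int k \<le> t / T" "t / T < of_int k + 1" by (simp_all add: k_def)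
  then have "t - of_int k * T \<in> {0..T}" using T_pos by (auto simp: field_simps)
  moreover have "\<phi> (t - of_int k * T) = \<phi> t" using int[of "t - of_int k * T" k] by simp
  ultimately show ?thesis by metis
qed

lemma range_\<phi>: "range \<phi> = \<phi> ` {0..T}"
  using \<phi>_mod by auto

lemma compact_range_\<phi>: "compact (range \<phi>)"
  unfolding range_\<phi> by (intro compact_continuous_image \<phi>_cont) simp

definition "T0 = \<tau> p"

abbreviation "e \<equiv> f p"

text \<open>The monodromy: the variational equation along the cycle, followed over the return time
  of \<open>p\<close>.\<close>

definition "M = blinfun_apply (Z T0 0)"

text \<open>The coordinate along \<open>e\<close> in the splitting of the space into the tangent
  space of the section and the flow direction; \<open>\<pi>\<close> below is the complementary
  projection. Transversality provides the splitting.\<close>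

definition "c v = (m \<bullet> v) / (m \<bullet> e)"

definition "\<pi> v = v - c v *\<^sub>R e"

text \<open>A map on the whole space that takes values in the tangent space and kills
  \<open>e\<close>. Besides its restriction to the tangent space it thus contributes only the
  eigenvalue 0.\<close>

definition "B v = \<pi> (M v)"

lemma e_nonzero: "e \<noteq> 0"
  using transversal by auto

lemma T0_pos: "T0 > 0"
  using return[OF p_S N(2)] by (simp add: T0_def first_return_def)

lemma return_orbit:
  assumes "q \<in> S" "q \<in> N"
  obtains y where "\<And>t. t \<in> {0..\<tau> q} \<Longrightarrow> (y has_vector_derivative f (y t)) (at t within {0..\<tau> q})"
    "y 0 = q" "y (\<tau> q) = P q" "\<tau> q > 0" "P q \<in> S"
  using return[OF assms] unfolding first_return_def solves_def by blast

text \<open>By uniqueness, the orbit that realizes the return of \<open>p\<close> is \<phi>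
  itself.\<close>

lemma \<phi>_T0: "\<phi> T0 = p"
proof -
  obtain y where y: "\<And>t. t \<in> {0..T0} \<Longrightarrow> (y has_vector_derivative f (y t)) (at t within {0..T0})"
    "y 0 = p" "y T0 = p"
    using return_orbit[OF p_S N(2)] by (metis T0_def P_p)
  have "y T0 = \<phi> T0"
    by (rule autonomous_unique[OF y(1) \<phi>_deriv_within]) (use y T0_pos \<phi>_0 in auto)
  then show ?thesis using y by simp
qed

text \<open>The velocity of a solution solves the variational equation along it.\<close>

lemma Z_e: "t \<ge> 0 \<Longrightarrow> Z t 0 e = f (\<phi> t)"
proof -
  assume t: "t \<ge> 0"
  have "((\<lambda>t. f (\<phi> t)) has_vector_derivative f' (\<phi> t) (f (\<phi> t))) (at t within {0..b})" for t b
  proof -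
    have "(f \<circ> \<phi> has_derivative blinfun_apply (f' (\<phi> t)) \<circ> (\<lambda>h. h *\<^sub>R f (\<phi> t))) (at t)"
      using \<phi>_deriv f_deriv unfolding has_vector_derivative_def by (rule diff_chain_at)
    then have "((\<lambda>t. f (\<phi> t)) has_vector_derivative f' (\<phi> t) (f (\<phi> t))) (at t)"
      unfolding has_vector_derivative_def by (simp add: o_def blinfun.scaleR_right)
    then show ?thesis by (rule has_vector_derivative_at_within)
  qed
  from Z.X_unique[OF order_refl this, of t t] show ?thesis using t by (simp add: \<phi>_0)
qed

lemma M_e: "M e = e"
  using Z_e[of T0] T0_pos by (simp add: M_def \<phi>_T0)

subsection \<open>Linear algebra of the projection along the flow\<close>

lemma c_linear: "linear c"
  by (rule linearI) (simp_all add: c_def inner_add_right add_divide_distrib)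

lemma c_e: "c e = 1"
  using transversal by (simp add: c_def)

lemma \<pi>_linear: "linear \<pi>"
  by (rule linearI) (simp_all add: \<pi>_def linear_add[OF c_linear] linear_scale[OF c_linear] algebra_simps)

lemma \<pi>_e: "\<pi> e = 0"
  by (simp add: \<pi>_def c_e)

lemma M_linear: "linear M"
  unfolding M_def by (rule bounded_linear.linear[OF blinfun.bounded_linear_right])

lemma B_linear: "linear B"
  using linear_compose[OF M_linear \<pi>_linear] by (simp add: B_def[abs_def] o_def)

lemma inner_\<pi>: "m \<bullet> \<pi> v = 0"
  using transversal by (simp add: \<pi>_def c_def inner_diff_right)

lemma split_\<pi>: "v = \<pi> v + c v *\<^sub>R e"
  by (simp add: \<pi>_def)

text \<open>As \<open>M\<close> fixes \<open>e\<close>, it induces a map modulo \<open>e\<close>,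
  and \<open>B\<close> represents this map. Iteration gives the same relation between the powers of
  \<open>M\<close> and of \<open>B\<close>.\<close>

lemma B_\<pi>: "B (\<pi> v) = \<pi> (M v)"
proof -
  have "M v = M (\<pi> v) + c v *\<^sub>R e"
    using arg_cong[OF split_\<pi>[of v], of M]
    by (simp add: linear_add[OF M_linear] linear_scale[OF M_linear] M_e)
  then have "\<pi> (M v) = \<pi> (M (\<pi> v)) + c v *\<^sub>R \<pi> e"
    by (simp add: linear_add[OF \<pi>_linear] linear_scale[OF \<pi>_linear])
  then show ?thesis by (simp add: \<pi>_e B_def)
qed

subsection \<open>Expansion of the return map at the periodic point\<close>

text \<open>Neighbourhoods of \<open>p\<close> within \<open>S\<close> with \<open>p\<close>
  included: \<open>P\<close> may map points to \<open>p\<close>, and it still has to preserve the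
  filter.\<close>

definition "near = inf (nhds p) (principal S)"

lemma eventually_near: "eventually Q near \<longleftrightarrow> (\<exists>d>0. \<forall>q\<in>S. norm (q - p) < d \<longrightarrow> Q q)"
  unfolding near_def eventually_inf_principal eventually_nhds_metric dist_norm by blast

lemma eventually_return_time:
  assumes "\<eta> > 0"
  shows "eventually (\<lambda>q. q \<in> S \<and> q \<in> N \<and> \<bar>\<tau> q - T0\<bar> < \<eta>) near"
proof -
  obtain d1 where d1: "d1 > 0" "\<And>q. norm (q - p) < d1 \<Longrightarrow> q \<in> N"
    using N unfolding open_dist dist_norm by blast
  obtain d2 where d2: "d2 > 0" "\<And>q. q \<in> S \<inter> N \<Longrightarrow> dist q p < d2 \<Longrightarrow> dist (\<tau> q) (\<tau> p) < \<eta>"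
    using \<tau>_cont p_S N(2) assms unfolding continuous_on_iff by (metis IntI)
  show ?thesis
    unfolding eventually_near
    using d1 d2 by (intro exI[of _ "min d1 d2"]) (auto simp: dist_norm T0_def)
qed

lemma eventually_P_deriv:
  assumes "\<eta> > 0"
  shows "eventually (\<lambda>q. norm (P q - p - A (q - p)) \<le> \<eta> * norm (q - p)) near"
  using P_deriv assms unfolding has_derivative_within_alt eventually_near P_p by blast

lemma A_bounded_linear: "bounded_linear A"
  using P_deriv by (rule has_derivative_bounded_linear)

lemma eventually_P_Lipschitz:
  obtains C where "C > 0" "eventually (\<lambda>q. norm (P q - p) \<le> C * norm (q - p)) near"
proof -
  obtain K where K: "K > 0" "\<And>v. norm (A v) \<le> norm v * K"
    using bounded_linear.pos_bounded[OF A_bounded_linear] by blast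
  have "eventually (\<lambda>q. norm (P q - p) \<le> (K + 1) * norm (q - p)) near"
    using eventually_P_deriv[of 1]
  proof (rule eventually_mono)
    fix q assume "norm (P q - p - A (q - p)) \<le> 1 * norm (q - p)"
    then show "norm (P q - p) \<le> (K + 1) * norm (q - p)"
      using norm_triangle_ineq[of "P q - p - A (q - p)" "A (q - p)"] K(2)[of "q - p"]
      by (simp add: algebra_simps)
  qed simp
  then show ?thesis using that[of "K + 1"] K by simp
qed

lemma \<phi>_bounded: obtains R where "\<And>t. norm (\<phi> t) \<le> R"
  using compact_imp_bounded[OF compact_range_\<phi>] by (auto simp: bounded_iff)

lemma return_orbit_deviation:
  assumes "\<And>t. t \<in> J \<Longrightarrow> (y has_vector_derivative f (y t)) (at t within J)" "t \<in> J"
  shows "((\<lambda>t. y t - \<phi> t) has_vector_derivative f ((y t - \<phi> t) + \<phi> t) - f (\<phi> t)) (at t within J)"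
  using has_vector_derivative_diff[OF assms(1)[OF assms(2)] \<phi>_deriv_within[of t J]] by simp

text \<open>The return point is compared with the cycle at the same time \<open>\<tau> q\<close>,
  because the deviation of \<open>\<tau> q\<close> from \<open>T0\<close> is so far known only to be
  small, not to be of the order of \<open>q - p\<close>.\<close>

lemma eventually_return_bound:
  obtains C where "C > 0" "eventually (\<lambda>q. norm (P q - \<phi> (\<tau> q)) \<le> C * norm (q - p)) near"
proof -
  obtain R where R: "\<And>t. norm (\<phi> t) \<le> R" using \<phi>_bounded by blast
  have "T0 + 1 \<ge> 0" using T0_pos by simp
  from deviation_bound[OF this, of R] obtain C d where C: "C \<ge> 1" "d > 0"
    and dev: "\<And>a b x w. \<lbrakk>b - a \<le> T0 + 1; \<And>t. t \<in> {a..b} \<Longrightarrow> norm (x t) \<le> R;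
       \<And>t. t \<in> {a..b} \<Longrightarrow> (w has_vector_derivative f (w t + x t) - f (x t)) (at t within {a..b});
       norm (w a) < d\<rbrakk> \<Longrightarrow> \<forall>t\<in>{a..b}. norm (w t) \<le> C * norm (w a)" by metis
  have "eventually (\<lambda>q. norm (q - p) < d) near"
    unfolding eventually_near using C(2) by blast
  then have "eventually (\<lambda>q. norm (P q - \<phi> (\<tau> q)) \<le> C * norm (q - p)) near"
    using eventually_return_time[of 1, OF zero_less_one]
  proof eventually_elim
    case (elim q)
    obtain y where y: "\<And>t. t \<in> {0..\<tau> q} \<Longrightarrow> (y has_vector_derivative f (y t)) (at t within {0..\<tau> q})"
      "y 0 = q" "y (\<tau> q) = P q" "\<tau> q > 0"
      using return_orbit[of q] elim by metis
    have "\<forall>t\<in>{0..\<tau> q}. norm (y t - \<phi> t) \<le> C * norm (y 0 - \<phi> 0)"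
      by (rule dev[where x = \<phi>]) (use elim R y \<phi>_0 return_orbit_deviation[OF y(1)] in auto)
    then have "norm (y (\<tau> q) - \<phi> (\<tau> q)) \<le> C * norm (y 0 - \<phi> 0)" using y(4) by simp
    then show ?case by (simp add: y(2,3) \<phi>_0)
  qed
  then show ?thesis using that[of C] C by simp
qed

lemma eventually_return_linear:
  assumes "\<eta> > 0"
  shows "eventually (\<lambda>q. norm (P q - \<phi> (\<tau> q) - Z (\<tau> q) 0 (q - p)) \<le> \<eta> * norm (q - p)) near"
proof -
  obtain R where R: "\<And>t. norm (\<phi> t) \<le> R" using \<phi>_bounded by blast
  have D: "T0 + 1 \<ge> 0" using T0_pos by simp
  \<comment> \<open>The linearization error grows with the elapsed time, which is below
    \<open>T0 + 1\<close> near \<open>p\<close>.\<close>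
  have "\<eta> / (T0 + 1) > 0" using assms T0_pos by simp
  from deviation_linearization[OF D this, of R] obtain d where "d > 0" and
    lin: "\<And>a b x w u. \<lbrakk>b - a \<le> T0 + 1; \<And>t. t \<in> {a..b} \<Longrightarrow> norm (x t) \<le> R;
       \<And>t. t \<in> {a..b} \<Longrightarrow> (w has_vector_derivative f (w t + x t) - f (x t)) (at t within {a..b});
       \<And>t. t \<in> {a..b} \<Longrightarrow> (u has_vector_derivative f' (x t) (u t)) (at t within {a..b});
       u a = w a; norm (w a) < d\<rbrakk>
      \<Longrightarrow> \<forall>t\<in>{a..b}. norm (w t - u t) \<le> \<eta> / (T0 + 1) * (t - a) * norm (w a)" by metis
  have "eventually (\<lambda>q. norm (q - p) < d) near"
    unfolding eventually_near using \<open>d > 0\<close> by blast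
  then show ?thesis
    using eventually_return_time[of 1, OF zero_less_one]
  proof eventually_elim
    case (elim q)
    obtain y where y: "\<And>t. t \<in> {0..\<tau> q} \<Longrightarrow> (y has_vector_derivative f (y t)) (at t within {0..\<tau> q})"
      "y 0 = q" "y (\<tau> q) = P q" "\<tau> q > 0"
      using return_orbit[of q] elim by metis
    have "\<forall>t\<in>{0..\<tau> q}. norm (y t - \<phi> t - Z t 0 (q - p)) \<le> \<eta> / (T0 + 1) * (t - 0) * norm (y 0 - \<phi> 0)"
      by (rule lin[where x = \<phi>])
        (use elim R y \<phi>_0 return_orbit_deviation[OF y(1)] Z.X_diag Z.X_apply_deriv in auto)
    then have "norm (P q - \<phi> (\<tau> q) - Z (\<tau> q) 0 (q - p)) \<le> \<eta> / (T0 + 1) * \<tau> q * norm (q - p)"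
      using y(4) by (auto dest!: bspec[where x = "\<tau> q"] simp: y(2,3) \<phi>_0)
    also have "\<eta> / (T0 + 1) * \<tau> q \<le> \<eta> / (T0 + 1) * (T0 + 1)"
      using elim assms T0_pos by (intro mult_left_mono) auto
    also have "\<dots> = \<eta>" using T0_pos by simp
    finally show ?case by (simp add: mult_right_mono)
  qed
qed

lemma \<phi>_expansion:
  assumes "\<eta> > 0"
  obtains d where "d > 0" "\<And>t. \<bar>t - T0\<bar> < d \<Longrightarrow> norm (\<phi> t - p - (t - T0) *\<^sub>R e) \<le> \<eta> * \<bar>t - T0\<bar>"
  using \<phi>_deriv[of T0] assms
  unfolding has_vector_derivative_def has_derivative_at_alt \<phi>_T0 real_norm_def by blast

text \<open>The cycle passes \<open>p\<close> with velocity \<open>e \<noteq> 0\<close>, so the time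
  shift is controlled by the distance of \<open>\<phi> (\<tau> q)\<close> from \<open>p\<close>.
  That distance is at most the sum of those from \<open>P q\<close> to both points, each of the
  order of \<open>q - p\<close>.\<close>

lemma eventually_time_Lipschitz:
  obtains C where "C > 0" "eventually (\<lambda>q. \<bar>\<tau> q - T0\<bar> \<le> C * norm (q - p)) near"
proof -
  obtain C1 where C1: "C1 > 0" "eventually (\<lambda>q. norm (P q - p) \<le> C1 * norm (q - p)) near"
    using eventually_P_Lipschitz by blast
  obtain C2 where C2: "C2 > 0" "eventually (\<lambda>q. norm (P q - \<phi> (\<tau> q)) \<le> C2 * norm (q - p)) near"
    using eventually_return_bound by blast
  \<comment> \<open>Half the speed: the remainder in the expansion of \<phi> then takes away at most
    half of the displacement.\<close>
  define E where "E = norm e / 2"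
  have E: "E > 0" "norm e = 2 * E" using e_nonzero by (simp_all add: E_def)
  obtain d where d: "d > 0" "\<And>t. \<bar>t - T0\<bar> < d \<Longrightarrow> norm (\<phi> t - p - (t - T0) *\<^sub>R e) \<le> E * \<bar>t - T0\<bar>"
    using \<phi>_expansion[OF E(1)] by blast
  have "eventually (\<lambda>q. \<bar>\<tau> q - T0\<bar> \<le> (C1 + C2) / E * norm (q - p)) near"
    using C1(2) C2(2) eventually_return_time[OF d(1)]
  proof eventually_elim
    case (elim q)
    have "2 * (E * \<bar>\<tau> q - T0\<bar>) = norm ((\<tau> q - T0) *\<^sub>R e)" by (simp add: E(2))
    also have "\<dots> \<le> norm (\<phi> (\<tau> q) - p) + norm (\<phi> (\<tau> q) - p - (\<tau> q - T0) *\<^sub>R e)"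
      using norm_triangle_ineq4[of "\<phi> (\<tau> q) - p" "\<phi> (\<tau> q) - p - (\<tau> q - T0) *\<^sub>R e"] by simp
    also have "\<dots> \<le> norm (\<phi> (\<tau> q) - p) + E * \<bar>\<tau> q - T0\<bar>" using d(2)[of "\<tau> q"] elim by simp
    finally have "2 * (E * \<bar>\<tau> q - T0\<bar>) \<le> norm (\<phi> (\<tau> q) - p) + E * \<bar>\<tau> q - T0\<bar>" .
    moreover have "norm (\<phi> (\<tau> q) - p) \<le> norm (P q - p) + norm (P q - \<phi> (\<tau> q))"
      using norm_triangle_ineq4[of "P q - p" "P q - \<phi> (\<tau> q)"] by simp
    ultimately have "E * \<bar>\<tau> q - T0\<bar> \<le> (C1 + C2) * norm (q - p)"
      using elim by (simp add: distrib_right)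
    then show ?case using E(1) by (simp add: field_simps)
  qed
  then show ?thesis using that[of "(C1 + C2) / E"] C1 C2 E by simp
qed

lemma eventually_section_tangent:
  assumes "\<eta> > 0"
  shows "eventually (\<lambda>q. \<bar>m \<bullet> (q - p)\<bar> \<le> \<eta> * norm (q - p)) near"
proof -
  have "g p = 0" using p_S by (simp add: S_def)
  obtain d where "d > 0" "\<And>q. norm (q - p) < d \<Longrightarrow> norm (g q - g p - m \<bullet> (q - p)) \<le> \<eta> * norm (q - p)"
    using g_deriv assms unfolding has_derivative_at_alt by blast
  then show ?thesis
    unfolding eventually_near using \<open>g p = 0\<close>
    by (intro exI[of _ d]) (force simp: S_def)
qed

text \<open>Lets the tangency estimate for points of \<open>S\<close> be applied at
  \<open>P q\<close>.\<close>

lemma filterlim_P_near: "filterlim P near near"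
proof -
  obtain C where C: "C > 0" "eventually (\<lambda>q. norm (P q - p) \<le> C * norm (q - p)) near"
    using eventually_P_Lipschitz by blast
  show ?thesis
    unfolding filterlim_iff
  proof (intro allI impI)
    fix Q assume "eventually Q near"
    then obtain d where d: "d > 0" "\<And>q. q \<in> S \<Longrightarrow> norm (q - p) < d \<Longrightarrow> Q q"
      unfolding eventually_near by blast
    have "eventually (\<lambda>q. norm (q - p) < d / C) near"
      unfolding eventually_near using d(1) C(1) by (metis divide_pos_pos)
    then show "eventually (\<lambda>q. Q (P q)) near"
      using C(2) eventually_return_time[OF zero_less_one]
    proof eventually_elim
      case (elim q)
      have "P q \<in> S" using return_orbit[of q] elim by blast
      moreover have "norm (P q - p) < d" using elim C(1) by (simp add: field_simps)
      ultimately show ?case by (rule d(2))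
    qed
  qed
qed

lemma eventually_Z_close:
  assumes "\<eta> > 0"
  shows "eventually (\<lambda>q. \<forall>v. norm (Z (\<tau> q) 0 v - M v) \<le> \<eta> * norm v) near"
proof -
  have "continuous_on {0..T0 + 1} (\<lambda>t. Z t 0)"
    using Z.X_deriv[of 0 _ "T0 + 1"] by (intro has_vector_derivative_imp_continuous_on) auto
  then obtain d where d: "d > 0" "\<And>t. t \<in> {0..T0 + 1} \<Longrightarrow> dist t T0 < d \<Longrightarrow> dist (Z t 0) (Z T0 0) < \<eta>"
    using assms T0_pos unfolding continuous_on_iff
    by (metis atLeastAtMost_iff less_eq_real_def less_add_one)
  have "min d (min 1 T0) > 0" using d T0_pos by simp
  from eventually_return_time[OF this] show ?thesis
  proof (rule eventually_mono)
    fix q assume "q \<in> S \<and> q \<in> N \<and> \<bar>\<tau> q - T0\<bar> < min d (min 1 T0)"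
    then have "\<tau> q \<in> {0..T0 + 1}" "dist (\<tau> q) T0 < d" unfolding dist_real_def by auto
    then have le: "norm (Z (\<tau> q) 0 - Z T0 0) \<le> \<eta>" using d(2) by (simp add: dist_norm less_imp_le)
    show "\<forall>v. norm (Z (\<tau> q) 0 v - M v) \<le> \<eta> * norm v"
    proof
      fix v
      have "norm ((Z (\<tau> q) 0 - Z T0 0) v) \<le> norm (Z (\<tau> q) 0 - Z T0 0) * norm v" by (rule norm_blinfun)
      also have "\<dots> \<le> \<eta> * norm v" using le by (intro mult_right_mono) auto
      finally show "norm (Z (\<tau> q) 0 v - M v) \<le> \<eta> * norm v" by (simp add: blinfun.diff_left M_def)
    qed
  qed
qed

text \<open>Up to small terms, \<open>P q - p\<close> is \<open>M (q - p)\<close> plus a multiple of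
  \<open>e\<close> coming from the time shift. The projection removes this multiple, and the
  component of \<open>P q - p\<close> along \<open>e\<close> is itself negligible because
  \<open>P q\<close> lies in \<open>S\<close>, which is tangent to the kernel of
  \<open>c\<close>.\<close>

lemma eventually_P_expansion:
  assumes "\<eta> > 0"
  shows "eventually (\<lambda>q. norm (P q - p - B (q - p)) \<le> \<eta> * norm (q - p)) near"
proof -
  obtain C1 where C1: "C1 > 0" "eventually (\<lambda>q. norm (P q - p) \<le> C1 * norm (q - p)) near"
    using eventually_P_Lipschitz by blast
  obtain C2 where C2: "C2 > 0" "eventually (\<lambda>q. \<bar>\<tau> q - T0\<bar> \<le> C2 * norm (q - p)) near"
    using eventually_time_Lipschitz by blast
  obtain C3 where C3: "C3 > 0" "\<And>v. norm (\<pi> v) \<le> C3 * norm v"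
    using linear_bounded_pos[OF \<pi>_linear] by blast
  define a where "a = norm e / \<bar>m \<bullet> e\<bar>"
  have a: "a \<ge> 0" by (simp add: a_def)
  \<comment> \<open>Three remainders pass through the projection, with weights 1, \<open>C2\<close>
    and 1; the term \<open>C1 * a\<close> bounds the component along \<open>e\<close>.\<close>
  define G where "G = C3 * (2 + C2) + C1 * a"
  have G: "G > 0" using C1 C2 C3 a by (simp add: G_def add_pos_nonneg)
  define \<theta> where "\<theta> = \<eta> / G"
  have \<theta>: "\<theta> > 0" "G * \<theta> = \<eta>" using assms G by (simp_all add: \<theta>_def)
  obtain d where d: "d > 0" "\<And>t. \<bar>t - T0\<bar> < d \<Longrightarrow> norm (\<phi> t - p - (t - T0) *\<^sub>R e) \<le> \<theta> * \<bar>t - T0\<bar>"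
    using \<phi>_expansion[OF \<theta>(1)] by blast
  have "eventually (\<lambda>q. \<bar>m \<bullet> (P q - p)\<bar> \<le> \<theta> * norm (P q - p)) near"
    using eventually_section_tangent[OF \<theta>(1)] filterlim_P_near by (rule eventually_compose_filterlim)
  then show ?thesis
    using C1(2) C2(2) eventually_return_time[OF d(1)] eventually_Z_close[OF \<theta>(1)]
      eventually_return_linear[OF \<theta>(1)]
  proof eventually_elim
    case (elim q)
    define v where "v = q - p"
    define s1 where "s1 = P q - \<phi> (\<tau> q) - Z (\<tau> q) 0 v"
    define s2 where "s2 = \<phi> (\<tau> q) - p - (\<tau> q - T0) *\<^sub>R e"
    define s3 where "s3 = Z (\<tau> q) 0 v - M v"
    have s1: "norm s1 \<le> \<theta> * norm v" using elim by (simp add: s1_def v_def)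
    have "norm s2 \<le> \<theta> * \<bar>\<tau> q - T0\<bar>" unfolding s2_def by (rule d(2)) (use elim in auto)
    also have "\<dots> \<le> \<theta> * (C2 * norm v)" using elim \<theta> by (auto simp: v_def)
    finally have s2: "norm s2 \<le> \<theta> * (C2 * norm v)" .
    have s3: "norm s3 \<le> \<theta> * norm v" using elim by (simp add: s3_def)
    have "P q - p = s1 + s2 + s3 + M v + (\<tau> q - T0) *\<^sub>R e"
      by (simp add: s1_def s2_def s3_def)
    then have "\<pi> (P q - p) = \<pi> (s1 + s2 + s3) + B v"
      by (simp add: linear_add[OF \<pi>_linear] linear_scale[OF \<pi>_linear] \<pi>_e B_def)
    moreover have "P q - p - B v = (\<pi> (P q - p) - B v) + c (P q - p) *\<^sub>R e"
      by (simp add: \<pi>_def)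
    ultimately have "P q - p - B v = \<pi> (s1 + s2 + s3) + c (P q - p) *\<^sub>R e" by simp
    then have "norm (P q - p - B v) \<le> norm (\<pi> (s1 + s2 + s3)) + norm (c (P q - p) *\<^sub>R e)"
      by (simp only: norm_triangle_ineq)
    also have "norm (\<pi> (s1 + s2 + s3)) \<le> C3 * norm (s1 + s2 + s3)" by (rule C3(2))
    also have "norm (s1 + s2 + s3) \<le> \<theta> * norm v + \<theta> * (C2 * norm v) + \<theta> * norm v"
      using norm_triangle_ineq[of "s1 + s2" s3] norm_triangle_ineq[of s1 s2] s1 s2 s3 by linarith
    also have "norm (c (P q - p) *\<^sub>R e) = \<bar>m \<bullet> (P q - p)\<bar> * a"
      by (simp add: c_def a_def abs_divide)
    also have "\<bar>m \<bullet> (P q - p)\<bar> \<le> \<theta> * norm (P q - p)" using elim by simp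
    also have "norm (P q - p) \<le> C1 * norm v" using elim by (simp add: v_def)
    finally have "norm (P q - p - B v)
        \<le> C3 * (\<theta> * norm v + \<theta> * (C2 * norm v) + \<theta> * norm v) + \<theta> * (C1 * norm v) * a"
      using C3 a \<theta> by (simp add: mult_left_mono mult_right_mono)
    also have "\<dots> = G * \<theta> * norm v" by (simp add: G_def algebra_simps)
    finally show ?case by (simp add: \<theta> v_def)
  qed
qed

section \<open>Tangent vectors of the section and the spectrum of the projected monodromy\<close>

text \<open>Every vector orthogonal to \<open>m\<close> is a limit of rescaled chords of
  \<open>S\<close> from \<open>p\<close>. In place of an implicit function, the point
  \<open>p + s *\<^sub>R h\<close> is moved along \<open>e\<close> until \<open>g\<close> vanishes;
  transversality gives a change of sign.\<close>

lemma tangent_vector: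
  assumes h: "m \<bullet> h = 0" and \<eta>: "\<eta> > 0" and d: "d > 0"
  shows "\<exists>s>0. \<exists>q\<in>S. norm (q - p) < d \<and> norm (q - p - s *\<^sub>R h) \<le> \<eta> * s"
proof -
  define a where "a = m \<bullet> e"
  have a: "a \<noteq> 0" using transversal by (simp add: a_def)
  have ne: "norm e > 0" using e_nonzero by simp
  define \<sigma> where "\<sigma> = \<eta> / norm e"
  have \<sigma>: "\<sigma> > 0" using \<eta> ne by (simp add: \<sigma>_def)
  \<comment> \<open>With this accuracy the linearization error of \<open>g\<close> at all points
    considered is at most half of \<open>\<sigma> * s * \<bar>a\<bar>\<close>, the size of the
    linear term at the ends of the segment.\<close>
  define \<zeta> where "\<zeta> = \<sigma> * \<bar>a\<bar> / (2 * (norm h + \<eta>))"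
  have hp: "norm h + \<eta> > 0" using \<eta> by (simp add: add_nonneg_pos)
  have \<zeta>: "\<zeta> > 0" "\<zeta> * (norm h + \<eta>) = \<sigma> * \<bar>a\<bar> / 2"
    using \<sigma> a hp by (auto simp: \<zeta>_def divide_simps)
  have gp: "g p = 0" "p \<in> U" using p_S by (auto simp: S_def)
  obtain d1 where d1: "d1 > 0"
    "\<And>q. norm (q - p) < d1 \<Longrightarrow> norm (g q - g p - m \<bullet> (q - p)) \<le> \<zeta> * norm (q - p)"
    using g_deriv \<zeta> unfolding has_derivative_at_alt by blast
  obtain d2 where d2: "d2 > 0" "\<And>q. norm (q - p) < d2 \<Longrightarrow> q \<in> U"
    using U gp(2) unfolding open_dist dist_norm by blast
  define s where "s = min d (min d1 d2) / (2 * (norm h + \<eta>))"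
  have s: "s > 0" using d d1 d2 hp by (simp add: s_def)
  have "s * (norm h + \<eta>) = min d (min d1 d2) / 2"
    using hp unfolding s_def by (metis less_irrefl nonzero_mult_div_cancel_right times_divide_eq_left divide_divide_eq_left)
  moreover have "min d (min d1 d2) > 0" using d d1 d2 by simp
  ultimately have s_small: "s * (norm h + \<eta>) < min d (min d1 d2)" by linarith
  define q where "q r = p + s *\<^sub>R h + r *\<^sub>R e" for r
  have q: "norm (q r - p) \<le> s * (norm h + \<eta>)" "norm (q r - p - s *\<^sub>R h) \<le> \<eta> * s"
    if "\<bar>r\<bar> \<le> \<sigma> * s" for r
  proof -
    have "norm (r *\<^sub>R e) \<le> \<sigma> * s * norm e" using that by (simp add: mult_right_mono)
    also have "\<dots> = \<eta> * s" using ne by (simp add: \<sigma>_def)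
    finally have *: "norm (r *\<^sub>R e) \<le> \<eta> * s" .
    then show "norm (q r - p - s *\<^sub>R h) \<le> \<eta> * s" by (simp add: q_def)
    show "norm (q r - p) \<le> s * (norm h + \<eta>)"
      using * s norm_triangle_ineq[of "s *\<^sub>R h" "r *\<^sub>R e"] by (simp add: q_def algebra_simps)
  qed
  \<comment> \<open>The factor \<open>a\<close> makes the signs at the two ends independent of the
    direction in which the flow crosses the section.\<close>
  define k where "k r = a * g (q r)" for r
  have k: "\<bar>k r - r * a\<^sup>2\<bar> < \<sigma> * s * a\<^sup>2" if "\<bar>r\<bar> \<le> \<sigma> * s" for r
  proof -
    have "norm (q r - p) < d1" using q(1)[OF that] s_small by linarith
    then have "\<bar>g (q r) - m \<bullet> (q r - p)\<bar> \<le> \<zeta> * norm (q r - p)" using d1(2)[of "q r"] gp by simp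
    also have "m \<bullet> (q r - p) = r * a" by (simp add: q_def inner_add_right h a_def)
    also have "\<zeta> * norm (q r - p) \<le> \<zeta> * (s * (norm h + \<eta>))"
      using q(1)[OF that] \<zeta> by (intro mult_left_mono) auto
    also have "\<dots> = s * (\<zeta> * (norm h + \<eta>))" by simp
    also have "\<dots> = s * (\<sigma> * \<bar>a\<bar> / 2)" by (simp only: \<zeta>(2))
    also have "\<dots> < \<sigma> * s * \<bar>a\<bar>" using s \<sigma> a by simp
    finally have "\<bar>a\<bar> * \<bar>g (q r) - r * a\<bar> < \<bar>a\<bar> * (\<sigma> * s * \<bar>a\<bar>)" using a by simp
    then have "\<bar>a * (g (q r) - r * a)\<bar> < \<sigma> * s * (\<bar>a\<bar> * \<bar>a\<bar>)" by (simp only: abs_mult) (simp add: mult_ac)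
    then show ?thesis by (simp add: k_def power2_eq_square algebra_simps)
  qed
  have ss: "0 < \<sigma> * s" using \<sigma> s by simp
  have "k (- (\<sigma> * s)) \<le> 0" "0 \<le> k (\<sigma> * s)"
    using k[of "- (\<sigma> * s)"] k[of "\<sigma> * s"] ss by (simp_all add: abs_if split: if_splits)
  moreover have "continuous_on {- (\<sigma> * s)..\<sigma> * s} k"
    unfolding k_def
  proof (intro continuous_intros continuous_on_compose2[OF g_cont])
    show "continuous_on {- (\<sigma> * s)..\<sigma> * s} q" unfolding q_def by (intro continuous_intros)
    show "q ` {- (\<sigma> * s)..\<sigma> * s} \<subseteq> U"
    proof clarify
      fix r assume "r \<in> {- (\<sigma> * s)..\<sigma> * s}"
      then have "\<bar>r\<bar> \<le> \<sigma> * s" by auto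
      then show "q r \<in> U" using q(1)[of r] s_small by (intro d2(2)) linarith
    qed
  qed
  ultimately obtain r where r: "- (\<sigma> * s) \<le> r" "r \<le> \<sigma> * s" "k r = 0"
    using IVT'[of k "- (\<sigma> * s)" 0 "\<sigma> * s"] ss by auto
  then have ra: "\<bar>r\<bar> \<le> \<sigma> * s" by auto
  have "norm (q r - p) < d" "q r \<in> U" using q(1)[OF ra] s_small by (linarith, intro d2(2), linarith)
  moreover have "g (q r) = 0" using r(3) a by (simp add: k_def)
  ultimately show ?thesis using s q(2)[OF ra] by (auto simp: S_def)
qed

text \<open>Both maps describe \<open>P\<close> to first order along \<open>S\<close>, so their
  difference is negligible on chords of \<open>S\<close> at \<open>p\<close>, and these approximate
  every tangent vector.\<close>

lemma A_eq_B:
  assumes h: "m \<bullet> h = 0"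
  shows "A h = B h"
proof -
  define D where "D v = A v - B v" for v
  have D: "linear D"
    using linear_compose_sub[OF bounded_linear.linear[OF A_bounded_linear] B_linear] by (simp add: D_def[abs_def])
  obtain K where K: "K > 0" "\<And>v. norm (D v) \<le> K * norm v" using linear_bounded_pos[OF D] by blast
  have est: "norm (D h) \<le> \<eta> * (2 * norm h + 2 + K)" if \<eta>: "0 < \<eta>" "\<eta> \<le> 1" for \<eta>
  proof -
    have "eventually (\<lambda>q. norm (D (q - p)) \<le> 2 * \<eta> * norm (q - p)) near"
      using eventually_P_deriv[OF \<eta>(1)] eventually_P_expansion[OF \<eta>(1)]
    proof eventually_elim
      case (elim q)
      then show ?case
        using norm_triangle_ineq4[of "P q - p - B (q - p)" "P q - p - A (q - p)"]
        by (simp add: D_def algebra_simps)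
    qed
    then obtain d where d: "d > 0" "\<And>q. q \<in> S \<Longrightarrow> norm (q - p) < d \<Longrightarrow> norm (D (q - p)) \<le> 2 * \<eta> * norm (q - p)"
      unfolding eventually_near by blast
    obtain s q where s: "s > 0" "q \<in> S" "norm (q - p) < d" "norm (q - p - s *\<^sub>R h) \<le> \<eta> * s"
      using tangent_vector[OF h \<eta>(1) d(1)] by blast
    have "s * norm (D h) = norm (D (q - p) - D (q - p - s *\<^sub>R h))"
      using s(1) by (simp add: linear_diff[OF D] linear_scale[OF D])
    also have "\<dots> \<le> 2 * \<eta> * norm (q - p) + K * (\<eta> * s)"
      using norm_triangle_ineq4[of "D (q - p)" "D (q - p - s *\<^sub>R h)"] d(2)[OF s(2,3)]
        K(2)[of "q - p - s *\<^sub>R h"] mult_left_mono[OF s(4), of K] K(1) by linarith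
    also have "norm (q - p) \<le> s * norm h + 1 * s"
      using norm_triangle_ineq[of "q - p - s *\<^sub>R h" "s *\<^sub>R h"] s(1,4) mult_right_mono[OF \<eta>(2) less_imp_le[OF s(1)]] by (simp only: diff_add_cancel norm_scaleR abs_of_pos)
    finally have "s * norm (D h) \<le> s * (\<eta> * (2 * norm h + 2 + K))"
      using \<eta> by (simp add: algebra_simps)
    then show ?thesis using s(1) by simp
  qed
  have "norm (D h) \<le> 0 + x" if x: "x > 0" for x
  proof -
    define G where "G = 2 * norm h + 2 + K"
    have G: "G > 0" using K by (simp add: G_def add_nonneg_pos add_pos_pos)
    \<comment> \<open>The minimum with 1 respects the restriction \<open>\<eta> \<le> 1\<close> in
      the estimate.\<close>
    have "norm (D h) \<le> min 1 (x / G) * G" unfolding G_def by (rule est) (use x G in \<open>simp_all add: G_def\<close>)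
    also have "\<dots> \<le> x / G * G" using G by (intro mult_right_mono) auto
    finally show ?thesis using G by simp
  qed
  then have "norm (D h) \<le> 0" by (rule field_le_epsilon)
  then show ?thesis by (simp add: D_def)
qed

text \<open>An eigenvector of \<open>B\<close> for a nonzero eigenvalue lies in the complexified
  range of \<open>B\<close>, hence in the tangent space, where \<open>B\<close> is
  \<open>A\<close>.\<close>

lemma B_power_decay: "\<exists>C \<rho>. 0 < \<rho> \<and> \<rho> < 1 \<and> (\<forall>k v. norm ((B ^^ k) v) \<le> C * \<rho> ^ k * norm v)"
proof (rule power_decay[OF B_linear])
  fix \<mu> and u w :: 'a
  assume nz: "u \<noteq> 0 \<or> w \<noteq> 0" and u: "B u = Re \<mu> *\<^sub>R u - Im \<mu> *\<^sub>R w"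
    and w: "B w = Im \<mu> *\<^sub>R u + Re \<mu> *\<^sub>R w"
  show "cmod \<mu> < 1"
  proof (cases "\<mu> = 0")
    case False
    then have nz2: "(Re \<mu>)\<^sup>2 + (Im \<mu>)\<^sup>2 \<noteq> 0" by (auto simp: complex_eq_iff sum_power2_eq_zero_iff)
    have "m \<bullet> B u = 0" "m \<bullet> B w = 0" by (simp_all add: B_def inner_\<pi>)
    then have eqs: "Re \<mu> * (m \<bullet> u) - Im \<mu> * (m \<bullet> w) = 0" "Im \<mu> * (m \<bullet> u) + Re \<mu> * (m \<bullet> w) = 0"
      by (simp_all add: u w inner_diff_right inner_add_right)
    \<comment> \<open>The two equations say that the complex number with parts
      \<open>m \<bullet> u\<close> and \<open>m \<bullet> w\<close> is annihilated by \<mu>; they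
      are solved with the determinant of multiplication by \<mu>.\<close>
    have "((Re \<mu>)\<^sup>2 + (Im \<mu>)\<^sup>2) * (m \<bullet> u) =
        Re \<mu> * (Re \<mu> * (m \<bullet> u) - Im \<mu> * (m \<bullet> w)) + Im \<mu> * (Im \<mu> * (m \<bullet> u) + Re \<mu> * (m \<bullet> w))"
      by (simp add: power2_eq_square algebra_simps)
    then have mu: "m \<bullet> u = 0" using nz2 unfolding eqs by (simp only: mult_zero_right add_0_right mult_eq_0_iff simp_thms)
    have "((Re \<mu>)\<^sup>2 + (Im \<mu>)\<^sup>2) * (m \<bullet> w) =
        Re \<mu> * (Im \<mu> * (m \<bullet> u) + Re \<mu> * (m \<bullet> w)) - Im \<mu> * (Re \<mu> * (m \<bullet> u) - Im \<mu> * (m \<bullet> w))"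
      by (simp add: power2_eq_square algebra_simps)
    then have mw: "m \<bullet> w = 0" using nz2 unfolding eqs by (simp only: mult_zero_right diff_zero mult_eq_0_iff simp_thms)
    have "eigenvalue_on {v. m \<bullet> v = 0} A \<mu>"
      unfolding eigenvalue_on_def using nz u w mu mw A_eq_B by auto
    then show ?thesis by (rule spectrum)
  qed simp
qed

text \<open>With respect to the splitting along \<open>e\<close>, \<open>M\<close> is block
  triangular with a 1 in the flow direction. The projected part of the powers decays geometrically,
  and the coordinate along \<open>e\<close> only collects a geometric series from it.\<close>

lemma M_power_bounded: "\<exists>K\<ge>1. \<forall>k v. norm ((M ^^ k) v) \<le> K * norm v"
proof -
  obtain C \<rho> where \<rho>: "0 < \<rho>" "\<rho> < 1" and C: "\<And>k v. norm ((B ^^ k) v) \<le> C * \<rho> ^ k * norm v"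
    using B_power_decay by blast
  obtain b :: 'a where b: "b \<in> Basis" using nonempty_Basis by blast
  have C0: "C \<ge> 0" using order_trans[OF norm_ge_zero C[of 0 b]] b by simp
  obtain C1 where C1: "C1 > 0" "\<And>v. norm (c v) \<le> C1 * norm v" using linear_bounded_pos[OF c_linear] by blast
  obtain C2 where C2: "C2 > 0" "\<And>v. norm (M v) \<le> C2 * norm v" using linear_bounded_pos[OF M_linear] by blast
  obtain C3 where C3: "C3 > 0" "\<And>v. norm (\<pi> v) \<le> C3 * norm v" using linear_bounded_pos[OF \<pi>_linear] by blast
  have \<pi>M: "\<pi> ((M ^^ k) v) = (B ^^ k) (\<pi> v)" for k v
    by (induction k) (simp_all add: B_\<pi>[symmetric])
  define G where "G = C1 * (C2 * (C * C3))"
  have G: "G \<ge> 0" using C0 C1 C2 C3 by (simp add: G_def)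
  have B\<pi>: "norm ((B ^^ k) (\<pi> v)) \<le> C * C3 * norm v * \<rho> ^ k" for k v
  proof -
    have "norm ((B ^^ k) (\<pi> v)) \<le> C * \<rho> ^ k * norm (\<pi> v)" by (rule C)
    also have "\<dots> \<le> C * \<rho> ^ k * (C3 * norm v)" using C3 C0 \<rho> by (intro mult_left_mono) auto
    finally show ?thesis by (simp add: mult_ac)
  qed
  have cM: "\<bar>c ((M ^^ k) v)\<bar> \<le> C1 * norm v + G * norm v * (\<Sum>j<k. \<rho> ^ j)" for k v
  proof (induction k)
    case 0
    then show ?case using C1(2)[of v] by simp
  next
    case (Suc k)
    define x where "x = (M ^^ k) v"
    have "M x = M (\<pi> x) + c x *\<^sub>R e"
      using arg_cong[OF split_\<pi>[of x], of M]
      by (simp add: linear_add[OF M_linear] linear_scale[OF M_linear] M_e)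
    then have "c (M x) = c (M (\<pi> x)) + c x"
      by (simp add: linear_add[OF c_linear] linear_scale[OF c_linear] c_e)
    moreover have "\<bar>c (M (\<pi> x))\<bar> \<le> G * norm v * \<rho> ^ k"
    proof -
      have "\<bar>c (M (\<pi> x))\<bar> \<le> C1 * norm (M (\<pi> x))" using C1(2)[of "M (\<pi> x)"] by simp
      also have "\<dots> \<le> C1 * (C2 * norm (\<pi> x))" using C1 C2 by (intro mult_left_mono) auto
      also have "\<dots> \<le> C1 * (C2 * (C * C3 * norm v * \<rho> ^ k))"
        using C1 C2 B\<pi>[of k v] by (intro mult_left_mono) (auto simp: x_def \<pi>M)
      finally show ?thesis by (simp add: G_def mult_ac)
    qed
    ultimately show ?case using Suc by (simp add: x_def algebra_simps)
  qed
  have geo: "(\<Sum>j<k. \<rho> ^ j) \<le> 1 / (1 - \<rho>)" for k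
    using \<rho> by (simp add: sum_gp_strict divide_right_mono)
  define K where "K = C * C3 + (C1 + G / (1 - \<rho>)) * norm e"
  have "norm ((M ^^ k) v) \<le> K * norm v" for k v
  proof -
    have "norm ((M ^^ k) v) \<le> norm ((B ^^ k) (\<pi> v)) + \<bar>c ((M ^^ k) v)\<bar> * norm e"
      using split_\<pi>[of "(M ^^ k) v"] norm_triangle_ineq[of "\<pi> ((M ^^ k) v)" "c ((M ^^ k) v) *\<^sub>R e"]
      by (simp add: \<pi>M)
    also have "norm ((B ^^ k) (\<pi> v)) \<le> C * C3 * norm v"
      using order_trans[OF B\<pi>[of k v] mult_left_le[of "\<rho> ^ k"]] \<rho> C0 C3 by (simp add: power_le_one)
    also have "\<bar>c ((M ^^ k) v)\<bar> \<le> C1 * norm v + G * norm v * (1 / (1 - \<rho>))"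
      using cM[of k v] geo[of k] G mult_left_mono[OF geo[of k], of "G * norm v"] by simp
    finally show ?thesis by (simp add: K_def algebra_simps mult_right_mono)
  qed
  then have "norm ((M ^^ k) v) \<le> max 1 K * norm v" for k v
    by (meson max.cobounded2 mult_right_mono norm_ge_zero order_trans)
  then show ?thesis by (intro exI[of _ "max 1 K"]) auto
qed

end

section \<open>The variational equation along the attracted orbit\<close>

locale attracted_orbit = return_map f f' \<phi> Z T p m S U N g A P \<tau> + X: evolution "\<lambda>t. f' (x t)" X
  for f :: "'a::euclidean_space \<Rightarrow> 'a" and f' \<phi> Z T p m S U N g A P \<tau>
    and x :: "real \<Rightarrow> 'a" and X :: "real \<Rightarrow> real \<Rightarrow> 'a \<Rightarrow>\<^sub>L 'a" +
  fixes \<epsilon> :: real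
  assumes \<epsilon>: "\<epsilon> > 0"
    and hoelder: "\<exists>r>0. \<exists>C. \<forall>y\<in>ball z r. \<forall>y'\<in>ball z r. norm (f' y - f' y') \<le> C * dist y y' powr \<epsilon>"
    and x_solves: "solves (\<lambda>_. f) {0..} x" and x_falls: "falls_into x (range \<phi>)"
begin

section \<open>Boundedness of the orbit and shadowing of the cycle\<close>

lemma x_deriv: "t \<ge> 0 \<Longrightarrow> (x has_vector_derivative f (x t)) (at t within {0..})"
  using x_solves by (simp add: solves_def)

lemma x_cont: "J \<subseteq> {0..} \<Longrightarrow> continuous_on J x"
proof (rule continuous_on_subset)
  show "continuous_on {0..} x"
    by (rule has_vector_derivative_imp_continuous_on[OF x_deriv]) simp
qed

lemma x_shift_deriv:
  assumes "a \<ge> 0" "s \<in> {0..b}"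
  shows "((\<lambda>s. x (a + s)) has_vector_derivative f (x (a + s))) (at s within {0..b})"
proof -
  have "((\<lambda>s. a + s) has_vector_derivative 1) (at s within {0..b})"
    by (auto intro!: derivative_eq_intros)
  moreover have "(x has_vector_derivative f (x (a + s))) (at (a + s) within (\<lambda>s. a + s) ` {0..b})"
    using assms by (intro has_vector_derivative_within_subset[OF x_deriv]) auto
  ultimately show ?thesis
    using vector_diff_chain_within[of "\<lambda>s. a + s" 1 s "{0..b}" x] by (simp add: o_def)
qed

lemma \<phi>_shift_deriv: "((\<lambda>s. \<phi> (a + s)) has_vector_derivative f (\<phi> (a + s))) (at s within J)"
proof -
  have "((\<lambda>s. a + s) has_vector_derivative 1) (at s within J)"
    by (auto intro!: derivative_eq_intros)
  from vector_diff_chain_within[OF this \<phi>_deriv_within] show ?thesis by (simp add: o_def)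
qed

lemma close_to_cycle:
  assumes "\<eta> > 0"
  shows "eventually (\<lambda>t. \<exists>s\<in>{0..T}. norm (x t - \<phi> s) < \<eta>) at_top"
proof -
  have "eventually (\<lambda>t. infdist (x t) (range \<phi>) < \<eta>) at_top"
    using x_falls assms unfolding falls_into_def by (rule order_tendstoD)
  then show ?thesis
  proof (rule eventually_mono)
    fix t assume *: "infdist (x t) (range \<phi>) < \<eta>"
    obtain y where "y \<in> range \<phi>" "infdist (x t) (range \<phi>) = dist (x t) y"
      using infdist_attains_inf[OF compact_imp_closed[OF compact_range_\<phi>]] by blast
    then show "\<exists>s\<in>{0..T}. norm (x t - \<phi> s) < \<eta>"
      using * unfolding range_\<phi> by (auto simp: dist_norm)
  qed
qed

lemma orbits_bounded:
  obtains R where "\<And>t. norm (\<phi> t) \<le> R" "\<And>t. t \<ge> 0 \<Longrightarrow> norm (x t) \<le> R"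
proof -
  obtain R0 where R0: "\<And>t. norm (\<phi> t) \<le> R0" using \<phi>_bounded by blast
  obtain t1 where t1: "\<And>t. t \<ge> t1 \<Longrightarrow> \<exists>s\<in>{0..T}. norm (x t - \<phi> s) < 1"
    using close_to_cycle[of 1] unfolding eventually_at_top_linorder by auto
  have "compact (x ` {0..t1})" by (intro compact_continuous_image x_cont) auto
  then obtain R1 where R1: "\<And>t. t \<in> {0..t1} \<Longrightarrow> norm (x t) \<le> R1"
    by (meson bounded_iff compact_imp_bounded image_eqI)
  have "norm (x t) \<le> max (R0 + 1) R1" if "t \<ge> 0" for t
  proof (cases "t \<le> t1")
    case True
    then show ?thesis using R1[of t] that by simp
  next
    case False
    then obtain s where "norm (x t - \<phi> s) < 1" using t1[of t] by auto
    then show ?thesis using R0[of s] norm_triangle_ineq[of "x t - \<phi> s" "\<phi> s"] by simp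
  qed
  moreover have "norm (\<phi> t) \<le> max (R0 + 1) R1" for t using R0[of t] by simp
  ultimately show ?thesis using that by blast
qed

text \<open>Both curves stay for all time in one ball, on which \<open>f\<close> is Lipschitz, so no
  smallness of the initial distance is required and the phases \<open>a\<close>, \<open>b\<close>
  are arbitrary.\<close>

lemma shadow:
  assumes "D \<ge> 0"
  obtains C where "C \<ge> 1" "\<And>a b s. \<lbrakk>a \<ge> 0; 0 \<le> s; s \<le> D\<rbrakk> \<Longrightarrow>
    norm (x (a + s) - \<phi> (b + s)) \<le> C * norm (x a - \<phi> b)"
proof -
  obtain R where R: "\<And>t. norm (\<phi> t) \<le> R" "\<And>t. t \<ge> 0 \<Longrightarrow> norm (x t) \<le> R"
    using orbits_bounded by blast
  obtain L where L: "L \<ge> 0"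
    "\<And>y z. norm y \<le> R \<Longrightarrow> norm z \<le> R \<Longrightarrow> norm (f y - f z) \<le> L * norm (y - z)"
    using lipschitz_ball[of R] by metis
  have "norm (x (a + s) - \<phi> (b + s)) \<le> exp (L * D) * norm (x a - \<phi> b)"
    if a: "a \<ge> 0" and s: "0 \<le> s" "s \<le> D" for a b s
  proof -
    have "norm (x (a + s) - \<phi> (b + s)) \<le> exp (L * (s - 0)) * (norm (x (a + 0) - \<phi> (b + 0)) + 0 * (s - 0))"
    proof (rule gronwall[where b = D])
      show "((\<lambda>s. x (a + s) - \<phi> (b + s)) has_vector_derivative f (x (a + r)) - f (\<phi> (b + r)))
          (at r within {0..D})" if "r \<in> {0..D}" for r
        by (rule has_vector_derivative_diff[OF x_shift_deriv[OF a that] \<phi>_shift_deriv])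
      show "norm (f (x (a + r)) - f (\<phi> (b + r))) \<le> L * norm (x (a + r) - \<phi> (b + r)) + 0"
        if "r \<in> {0<..<D}" for r
        using L(2) R a that by simp
    qed (use L s in auto)
    also have "\<dots> \<le> exp (L * D) * norm (x a - \<phi> b)"
      using s L by (auto intro!: mult_right_mono mult_left_mono)
    finally show ?thesis .
  qed
  moreover have "exp (L * D) \<ge> 1" using L assms by simp
  ultimately show ?thesis using that by blast
qed

section \<open>Successive hits of the section and their convergence\<close>

text \<open>The cycle crosses the section transversally at \<open>p\<close>, so \<open>g\<close>
  changes sign along it between the times -\<eta> and \<eta>. An orbit that follows the cycle
  closely inherits the change of sign.\<close>

lemma hits_section:
  assumes \<delta>: "\<delta> > 0"
  obtains t where "t \<ge> 0" "x t \<in> S" "norm (x t - p) < \<delta>"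
proof -
  define a where "a = m \<bullet> e"
  have a: "a \<noteq> 0" using transversal by (simp add: a_def)
  have gp: "g p = 0" "p \<in> U" using p_S by (auto simp: S_def)
  obtain d0 where d0: "d0 > 0" "\<And>q. norm (q - p) < d0 \<Longrightarrow> q \<in> U"
    using U gp(2) unfolding open_dist dist_norm by blast
  define d where "d = min \<delta> d0"
  have d: "d > 0" "d \<le> \<delta>" "\<And>q. norm (q - p) < d \<Longrightarrow> q \<in> U" using \<delta> d0 by (auto simp: d_def)
  have "continuous (at 0) \<phi>" using \<phi>_deriv has_vector_derivative_continuous by blast
  then obtain h1 where h1: "h1 > 0" "\<And>s. \<bar>s\<bar> < h1 \<Longrightarrow> norm (\<phi> s - p) < d / 2"
    using d(1) unfolding continuous_at_eps_delta dist_norm \<phi>_0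
    by (metis diff_zero half_gt_zero real_norm_def)
  have "((\<lambda>s. g (\<phi> s)) has_vector_derivative a) (at 0)"
  proof -
    have "(g \<circ> \<phi> has_derivative (\<lambda>v. m \<bullet> v) \<circ> (\<lambda>h. h *\<^sub>R f (\<phi> 0))) (at 0)"
      using \<phi>_deriv[of 0] g_deriv unfolding has_vector_derivative_def
      by (intro diff_chain_at) (simp_all add: \<phi>_0)
    then show ?thesis by (simp add: has_vector_derivative_def o_def \<phi>_0 a_def)
  qed
  then obtain h2 where h2: "h2 > 0" "\<And>s. \<bar>s\<bar> < h2 \<Longrightarrow> \<bar>g (\<phi> s) - s * a\<bar> \<le> \<bar>a\<bar> / 2 * \<bar>s\<bar>"
    using a unfolding has_vector_derivative_def has_derivative_at_alt
    by (metis \<phi>_0 diff_zero gp(1) half_gt_zero real_norm_def real_scaleR_def zero_less_abs_iff)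
  define \<eta> where "\<eta> = min T (min h1 h2) / 2"
  have "min T (min h1 h2) > 0" using T_pos h1 h2 by simp
  then have \<eta>: "0 < \<eta>" "\<eta> < T" "\<eta> < h1" "\<eta> < h2" unfolding \<eta>_def by linarith+
  have sgn: "\<bar>a * g (\<phi> s) - s * a\<^sup>2\<bar> \<le> \<bar>s\<bar> * a\<^sup>2 / 2" if "\<bar>s\<bar> < h2" for s
  proof -
    have "\<bar>a\<bar> * \<bar>g (\<phi> s) - s * a\<bar> \<le> \<bar>a\<bar> * (\<bar>a\<bar> / 2 * \<bar>s\<bar>)"
      using h2(2)[OF that] by (intro mult_left_mono) auto
    then have "\<bar>a * (g (\<phi> s) - s * a)\<bar> \<le> (\<bar>a\<bar> * \<bar>a\<bar>) * \<bar>s\<bar> / 2" by (simp only: abs_mult)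
    then show ?thesis by (simp add: power2_eq_square algebra_simps)
  qed
  have \<eta>a: "\<eta> * a\<^sup>2 > 0" using \<eta> a by simp
  have pos: "a * g (\<phi> \<eta>) > 0" and neg: "a * g (\<phi> (- \<eta>)) < 0"
    using sgn[of \<eta>] sgn[of "- \<eta>"] \<eta> \<eta>a by (auto simp: abs_if split: if_splits)
  have near\<phi>: "norm (\<phi> s - p) < d / 2" if "\<bar>s\<bar> \<le> \<eta>" for s using h1(2)[of s] that \<eta> by simp
  have \<phi>U: "\<phi> \<eta> \<in> U" "\<phi> (- \<eta>) \<in> U"
    using near\<phi>[of \<eta>] near\<phi>[of "- \<eta>"] \<eta> d by (auto intro!: d(3))
  have ag: "continuous_on U (\<lambda>q. a * g q)" by (intro continuous_intros g_cont)
  have "open (U \<inter> (\<lambda>q. a * g q) -` {0<..})" "open (U \<inter> (\<lambda>q. a * g q) -` {..<0})"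
    by (auto intro!: continuous_open_preimage[OF ag U])
  then obtain k1 k2 where k: "k1 > 0" "\<And>q. norm (q - \<phi> \<eta>) < k1 \<Longrightarrow> a * g q > 0"
    "k2 > 0" "\<And>q. norm (q - \<phi> (- \<eta>)) < k2 \<Longrightarrow> a * g q < 0"
    using pos neg \<phi>U unfolding open_dist dist_norm
    by (metis (no_types, lifting) IntD2 IntI greaterThan_iff lessThan_iff vimage_eq)
  define \<kappa> where "\<kappa> = min (min k1 k2) (d / 2)"
  have \<kappa>: "\<kappa> > 0" using k d by (simp add: \<kappa>_def)
  have "3 * T \<ge> 0" using T_pos by simp
  from shadow[OF this] obtain C where C: "C \<ge> 1" "\<And>a b s. \<lbrakk>a \<ge> 0; 0 \<le> s; s \<le> 3 * T\<rbrakk> \<Longrightarrow>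
    norm (x (a + s) - \<phi> (b + s)) \<le> C * norm (x a - \<phi> b)" by metis
  have "\<kappa> / C > 0" using \<kappa> C by simp
  from eventually_conj[OF close_to_cycle[OF this] eventually_ge_at_top[of 0]]
  obtain t1 \<sigma> where t1: "t1 \<ge> 0" "\<sigma> \<in> {0..T}" "norm (x t1 - \<phi> \<sigma>) < \<kappa> / C"
    unfolding eventually_at_top_linorder by blast
  \<comment> \<open>The delay carries the phase \<sigma> to \<open>2 * T\<close>, hence to
    \<open>p\<close>. As \<open>\<sigma> \<le> T\<close> and \<open>\<eta> < T\<close>, the whole
    window of radius \<eta> around \<open>t2\<close> lies in the shadowing range of length
    \<open>3 * T\<close> after \<open>t1\<close>.\<close>
  define t2 where "t2 = t1 + (2 * T - \<sigma>)"
  have close: "norm (x (t2 + s) - \<phi> s) < \<kappa>" if "\<bar>s\<bar> \<le> \<eta>" for s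
  proof -
    have "norm (x (t1 + (2 * T - \<sigma> + s)) - \<phi> (\<sigma> + (2 * T - \<sigma> + s))) \<le> C * norm (x t1 - \<phi> \<sigma>)"
      using t1 that \<eta> by (intro C(2)) auto
    also have "\<dots> < \<kappa>" using t1(3) C(1) by (simp add: field_simps)
    also have "\<phi> (\<sigma> + (2 * T - \<sigma> + s)) = \<phi> s"
      using \<phi>_periodic[of s] \<phi>_periodic[of "s + T"] by (simp add: algebra_simps)
    finally show ?thesis by (simp add: t2_def algebra_simps)
  qed
  have close_p: "norm (x (t2 + s) - p) < d" if "\<bar>s\<bar> \<le> \<eta>" for s
    using close[OF that] near\<phi>[OF that] norm_triangle_ineq[of "x (t2 + s) - \<phi> s" "\<phi> s - p"]
    by (simp add: \<kappa>_def)
  have t2: "t2 - \<eta> \<ge> 0" using t1 \<eta> by (auto simp: t2_def)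
  have "continuous_on {- \<eta>..\<eta>} (\<lambda>s. a * g (x (t2 + s)))"
  proof (rule continuous_on_compose2[OF ag])
    show "continuous_on {- \<eta>..\<eta>} (\<lambda>s. x (t2 + s))"
      by (rule continuous_on_compose2[OF x_cont[of "{0..}"]]) (use t2 in \<open>auto intro!: continuous_intros\<close>)
    show "(\<lambda>s. x (t2 + s)) ` {- \<eta>..\<eta>} \<subseteq> U"
      using close_p by (auto intro!: d(3) simp: abs_le_iff)
  qed
  moreover have "a * g (x (t2 + - \<eta>)) \<le> 0" "0 \<le> a * g (x (t2 + \<eta>))"
    using k(2)[of "x (t2 + \<eta>)"] k(4)[of "x (t2 + - \<eta>)"] close[of \<eta>] close[of "- \<eta>"] \<eta>
    by (auto simp: \<kappa>_def)
  ultimately obtain s where s: "- \<eta> \<le> s" "s \<le> \<eta>" "a * g (x (t2 + s)) = 0"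
    using IVT'[of "\<lambda>s. a * g (x (t2 + s))" "- \<eta>" 0 \<eta>] \<eta> by auto
  show ?thesis
  proof (rule that)
    show "t2 + s \<ge> 0" using t2 s by simp
    have "\<bar>s\<bar> \<le> \<eta>" using s by auto
    from close_p[OF this] show "norm (x (t2 + s) - p) < \<delta>" using d(2) by simp
    show "x (t2 + s) \<in> S" using s(3) a d(3)[OF close_p[OF \<open>\<bar>s\<bar> \<le> \<eta>\<close>]] by (simp add: S_def)
  qed
qed

lemma x_return:
  assumes "t \<ge> 0" "x t \<in> S" "x t \<in> N"
  shows "x (t + \<tau> (x t)) = P (x t)"
proof -
  obtain y where y: "\<And>s. s \<in> {0..\<tau> (x t)} \<Longrightarrow> (y has_vector_derivative f (y s)) (at s within {0..\<tau> (x t)})"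
    "y 0 = x t" "y (\<tau> (x t)) = P (x t)" "\<tau> (x t) > 0"
    using return_orbit[OF assms(2,3)] by metis
  have "y (\<tau> (x t)) = x (t + \<tau> (x t))"
    by (rule autonomous_unique[OF y(1) x_shift_deriv[OF assms(1)]]) (use y in auto)
  then show ?thesis using y(3) by simp
qed

text \<open>In the norm \<open>W\<close> the linear part \<open>B\<close> contracts by the factor
  \<open>\<rho>0\<close>, and close to \<open>p\<close> the nonlinear map \<open>P\<close> still
  contracts by a factor \<rho> < 1. One hit close enough to \<open>p\<close> starts the iteration;
  the return times converge at the same rate by their Lipschitz bound.\<close>

lemma return_times:
  assumes \<delta>: "\<delta> > 0"
  obtains t :: "nat \<Rightarrow> real" and \<rho> C where "0 < \<rho>" "\<rho> < 1" "C \<ge> 0" "t 0 \<ge> 0"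
    "\<And>k. norm (x (t k) - p) \<le> \<delta> * \<rho> ^ k" "\<And>k. \<bar>t (Suc k) - t k - T0\<bar> \<le> C * \<rho> ^ k"
    "\<And>k. \<bar>t (Suc k) - t k - T0\<bar> < T0 / 2"
proof -
  obtain C0 \<rho>0 where \<rho>0: "0 < \<rho>0" "\<rho>0 < 1"
    and C0: "\<And>k v. norm ((B ^^ k) v) \<le> C0 * \<rho>0 ^ k * norm v"
    using B_power_decay by blast
  define K where "K = max C0 1"
  have K: "K \<ge> 1" "C0 \<le> K" by (auto simp: K_def)
  define \<Lambda> where "\<Lambda> k v = inverse (\<rho>0 ^ k) *\<^sub>R (B ^^ k) v" for k v
  note linp = linear_funpow[OF B_linear]
  interpret W: bounded_family UNIV \<Lambda> K
  proof (rule bounded_family.intro)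
    show "linear (\<Lambda> k)" for k
      unfolding \<Lambda>_def using linp by (intro linear_compose_scale_right)
    show "norm (\<Lambda> k v) \<le> K * norm v" for k v
    proof -
      have "norm (\<Lambda> k v) \<le> inverse (\<rho>0 ^ k) * (K * \<rho>0 ^ k * norm v)"
        unfolding \<Lambda>_def norm_scaleR
        using \<rho>0 K by (intro mult_mono order_trans[OF C0[of k v]]) (auto intro!: mult_right_mono)
      also have "\<dots> = K * norm v" using \<rho>0 by (simp add: field_simps)
      finally show ?thesis .
    qed
  qed simp
  define W where "W = sup_norm UNIV \<Lambda>"
  have normW: "norm v \<le> W v" for v
    using W.le_sup_norm[of 0 v] by (simp add: W_def \<Lambda>_def)
  have WB: "W (B v) \<le> \<rho>0 * W v" for v
    unfolding W_def
  proof (rule W.sup_norm_leI)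
    fix k
    have "\<Lambda> k (B v) = \<rho>0 *\<^sub>R \<Lambda> (Suc k) v"
      using \<rho>0 by (simp add: \<Lambda>_def funpow_swap1)
    then show "norm (\<Lambda> k (B v)) \<le> \<rho>0 * sup_norm UNIV \<Lambda> v"
      using \<rho>0 W.le_sup_norm[of "Suc k" v] by (simp add: mult_left_mono)
  qed
  define \<rho> where "\<rho> = (1 + \<rho>0) / 2"
  have \<rho>: "0 < \<rho>" "\<rho> < 1" "\<rho>0 < \<rho>" using \<rho>0 by (auto simp: \<rho>_def)
  \<comment> \<open>The remainder costs \<open>K * \<theta>\<close> in \<open>W\<close>, which uses
    up exactly the margin between \<open>\<rho>0\<close> and \<rho>.\<close>
  define \<theta> where "\<theta> = (\<rho> - \<rho>0) / K"
  have \<theta>: "\<theta> > 0" "K * \<theta> = \<rho> - \<rho>0" using \<rho> K by (auto simp: \<theta>_def)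
  obtain C where C: "C > 0" "eventually (\<lambda>q. \<bar>\<tau> q - T0\<bar> \<le> C * norm (q - p)) near"
    using eventually_time_Lipschitz by blast
  have "T0 / 2 > 0" using T0_pos by simp
  from eventually_conj[OF C(2) eventually_conj[OF eventually_return_time[OF this] eventually_P_expansion[OF \<theta>(1)]]]
  obtain d where d: "d > 0" and dq: "\<And>q. q \<in> S \<Longrightarrow> norm (q - p) < d \<Longrightarrow>
      \<bar>\<tau> q - T0\<bar> \<le> C * norm (q - p) \<and> q \<in> N \<and> \<bar>\<tau> q - T0\<bar> < T0 / 2 \<and>
      norm (P q - p - B (q - p)) \<le> \<theta> * norm (q - p)"
    unfolding eventually_near by blast
  have contr: "W (P q - p) \<le> \<rho> * W (q - p)" if q: "q \<in> S" "norm (q - p) < d" for q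
  proof -
    have "W (P q - p) \<le> W (B (q - p)) + K * norm (P q - p - B (q - p))"
      unfolding W_def by (rule W.sup_norm_perturb)
    also have "\<dots> \<le> \<rho>0 * W (q - p) + K * (\<theta> * W (q - p))"
    proof (intro add_mono mult_left_mono WB)
      show "norm (P q - p - B (q - p)) \<le> \<theta> * W (q - p)"
        using dq[OF q] \<theta> normW[of "q - p"] mult_left_mono[of "norm (q - p)" "W (q - p)" \<theta>] by linarith
    qed (use K in auto)
    also have "\<dots> = (\<rho>0 + K * \<theta>) * W (q - p)" by (simp add: algebra_simps)
    finally show ?thesis by (simp add: \<theta>)
  qed
  \<comment> \<open>Being below \<open>d\<close>, it keeps all iterates where the contraction
    estimate is valid; the first hit within \<open>\<delta>0 / K\<close> gives \<open>W\<close> at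
    most \<open>\<delta>0\<close>.\<close>
  define \<delta>0 where "\<delta>0 = min \<delta> d / 2"
  have \<delta>0: "0 < \<delta>0" "\<delta>0 < \<delta>" "\<delta>0 < d" using \<delta> d by (auto simp: \<delta>0_def min_def)
  obtain t0 where t0: "t0 \<ge> 0" "x t0 \<in> S" "norm (x t0 - p) < \<delta>0 / K"
    using hits_section[of "\<delta>0 / K"] \<delta>0 K by auto
  define t where "t = rec_nat t0 (\<lambda>_ s. s + \<tau> (x s))"
  have t: "t 0 = t0" "t (Suc k) = t k + \<tau> (x (t k))" for k by (simp_all add: t_def)
  have \<rho>k: "\<rho> ^ k \<le> 1" for k using \<rho> by (simp add: power_le_one)
  have inv: "t k \<ge> 0 \<and> x (t k) \<in> S \<and> W (x (t k) - p) \<le> \<delta>0 * \<rho> ^ k" for k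
  proof (induction k)
    case 0
    have "W (x t0 - p) \<le> K * norm (x t0 - p)" unfolding W_def by (rule W.sup_norm_le)
    also have "\<dots> \<le> \<delta>0" using t0(3) K by (simp add: field_simps)
    finally show ?case using t0 by (simp add: t)
  next
    case (Suc k)
    have "norm (x (t k) - p) < d"
      using normW[of "x (t k) - p"] Suc \<delta>0 mult_left_le[OF \<rho>k[of k], of \<delta>0] by linarith
    note q = dq[OF _ this] contr[OF _ this]
    have "x (t (Suc k)) = P (x (t k))" using x_return[of "t k"] Suc q by (simp add: t)
    moreover have "P (x (t k)) \<in> S" using return_orbit[of "x (t k)"] Suc q by blast
    moreover have "W (P (x (t k)) - p) \<le> \<delta>0 * \<rho> ^ Suc k"
    proof -
      have "W (P (x (t k)) - p) \<le> \<rho> * W (x (t k) - p)" using q(2) Suc by blast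
      also have "\<dots> \<le> \<rho> * (\<delta>0 * \<rho> ^ k)" using Suc \<rho> by (intro mult_left_mono) auto
      finally show ?thesis by (simp add: mult_ac)
    qed
    moreover have "\<bar>\<tau> (x (t k)) - T0\<bar> < T0 / 2" using q(1) Suc by blast
    then have "t (Suc k) \<ge> 0" using Suc T0_pos unfolding t abs_less_iff by linarith
    ultimately show ?case by simp
  qed
  have bnd: "norm (x (t k) - p) \<le> \<delta>0 * \<rho> ^ k" "norm (x (t k) - p) < d" for k
    using normW[of "x (t k) - p"] inv[of k] \<delta>0 mult_left_le[OF \<rho>k[of k], of \<delta>0] by linarith+
  show ?thesis
  proof (rule that[of \<rho> "C * \<delta>0" t])
    fix k
    show "norm (x (t k) - p) \<le> \<delta> * \<rho> ^ k"
      by (rule order_trans[OF bnd(1)]) (use \<delta>0 \<rho> in \<open>auto intro: mult_right_mono\<close>)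
    have q: "\<bar>\<tau> (x (t k)) - T0\<bar> \<le> C * norm (x (t k) - p)" "\<bar>\<tau> (x (t k)) - T0\<bar> < T0 / 2"
      using dq[of "x (t k)"] inv[of k] bnd(2)[of k] by auto
    show "\<bar>t (Suc k) - t k - T0\<bar> < T0 / 2" using q by (simp add: t)
    show "\<bar>t (Suc k) - t k - T0\<bar> \<le> C * \<delta>0 * \<rho> ^ k"
      using order_trans[OF q(1) mult_left_mono[OF bnd(1)[of k] less_imp_le[OF C(1)]]]
      by (simp add: t mult.assoc)
  qed (use \<rho> C \<delta>0 t0 in \<open>auto simp: t\<close>)
qed

section \<open>Products of the variations over successive returns\<close>

text \<open>A Lebesgue number of a finite cover of the cycle turns the local Hoelder estimates into
  one on a tube.\<close>

lemma hoelder_on_cycle: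
  obtains r C where "r > 0" "C \<ge> 0"
    "\<And>s z. norm (z - \<phi> s) < r \<Longrightarrow> norm (f' z - f' (\<phi> s)) \<le> C * norm (z - \<phi> s) powr \<epsilon>"
proof -
  from hoelder obtain \<rho> K where K: "\<And>c. \<rho> c > 0"
    "\<And>c y y'. y \<in> ball c (\<rho> c) \<Longrightarrow> y' \<in> ball c (\<rho> c) \<Longrightarrow> norm (f' y - f' y') \<le> K c * dist y y' powr \<epsilon>"
    by metis
  have "range \<phi> \<subseteq> (\<Union>c\<in>range \<phi>. ball c (\<rho> c))"
    using K(1) by (intro subsetI UN_I) auto
  then obtain I where I: "I \<subseteq> range \<phi>" "finite I" "range \<phi> \<subseteq> (\<Union>c\<in>I. ball c (\<rho> c))"
    using compactE_image[OF compact_range_\<phi>, of "range \<phi>" "\<lambda>c. ball c (\<rho> c)"] by blast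
  obtain r where r: "r > 0" "\<And>y. y \<in> range \<phi> \<Longrightarrow> \<exists>G\<in>(\<lambda>c. ball c (\<rho> c)) ` I. ball y r \<subseteq> G"
    using Heine_Borel_lemma[OF compact_range_\<phi>, of "(\<lambda>c. ball c (\<rho> c)) ` I"] I(3) by auto
  define C where "C = (\<Sum>c\<in>I. \<bar>K c\<bar>)"
  have "norm (f' z - f' (\<phi> s)) \<le> C * norm (z - \<phi> s) powr \<epsilon>" if "norm (z - \<phi> s) < r" for s z
  proof -
    obtain c where c: "c \<in> I" "ball (\<phi> s) r \<subseteq> ball c (\<rho> c)" using r(2)[of "\<phi> s"] by auto
    have "z \<in> ball (\<phi> s) r" "\<phi> s \<in> ball (\<phi> s) r"
      using that r(1) by (auto simp: dist_norm norm_minus_commute)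
    then have "norm (f' z - f' (\<phi> s)) \<le> K c * dist z (\<phi> s) powr \<epsilon>"
      using c(2) by (intro K(2)) blast+
    also have "\<dots> \<le> \<bar>K c\<bar> * dist z (\<phi> s) powr \<epsilon>" by (intro mult_right_mono) auto
    also have "\<dots> \<le> C * dist z (\<phi> s) powr \<epsilon>"
      unfolding C_def using c I by (intro mult_right_mono member_le_sum) auto
    finally show ?thesis by (simp add: dist_norm)
  qed
  then show ?thesis using that[of r C] r(1) by (auto simp: C_def sum_nonneg)
qed

text \<open>Two comparisons. Over the same duration, the coefficients along \<open>x\<close> and
  along the cycle differ by a Hoelder term of rate \<open>\<rho> powr \<epsilon>\<close>; then
  replacing the actual duration by \<open>T0\<close> costs a term of rate \<rho>.\<close>

lemma return_variation:
  obtains t :: "nat \<Rightarrow> real" and \<beta> G where "0 < \<beta>" "\<beta> < 1" "G \<ge> 0" "t 0 \<ge> 0"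
    "\<And>k. \<bar>t (Suc k) - t k - T0\<bar> < T0 / 2"
    "\<And>k v. t k \<ge> 0 \<Longrightarrow> norm (X (t (Suc k)) (t k) v - M v) \<le> G * \<beta> ^ k * norm v"
proof -
  \<comment> \<open>The gaps between returns differ from \<open>T0\<close> by less than
    \<open>T0 / 2\<close>, so \<open>D\<close> exceeds them all.\<close>
  define D where "D = 2 * T0"
  have D: "D > 0" using T0_pos by (simp add: D_def)
  obtain R where R: "\<And>t. norm (\<phi> t) \<le> R" "\<And>t. t \<ge> 0 \<Longrightarrow> norm (x t) \<le> R"
    using orbits_bounded by blast
  obtain L where L: "L \<ge> 0" "\<And>y. norm y \<le> R \<Longrightarrow> norm (f' y) \<le> L"
    using lipschitz_ball[of R] by metis
  obtain C1 where C1: "C1 \<ge> 1" "\<And>a b s. \<lbrakk>a \<ge> 0; 0 \<le> s; s \<le> D\<rbrakk> \<Longrightarrow>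
    norm (x (a + s) - \<phi> (b + s)) \<le> C1 * norm (x a - \<phi> b)"
    using shadow[OF less_imp_le[OF D]] by metis
  obtain r C2 where r: "r > 0" and C2: "C2 \<ge> 0"
    "\<And>s z. norm (z - \<phi> s) < r \<Longrightarrow> norm (f' z - f' (\<phi> s)) \<le> C2 * norm (z - \<phi> s) powr \<epsilon>"
    using hoelder_on_cycle by metis
  \<comment> \<open>Shadowing enlarges distances at most by \<open>C1\<close>, so the orbit stays in
    the tube of radius \<open>r\<close> between the hits.\<close>
  define \<delta> where "\<delta> = r / (2 * C1)"
  have \<delta>: "\<delta> > 0" "C1 * \<delta> < r" using r C1 by (auto simp: \<delta>_def)
  obtain t :: "nat \<Rightarrow> real" and \<rho> C3 where \<rho>: "0 < \<rho>" "\<rho> < 1" and C3: "C3 \<ge> 0" and t0: "t 0 \<ge> 0"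
    and q: "\<And>k. norm (x (t k) - p) \<le> \<delta> * \<rho> ^ k" and \<tau>: "\<And>k. \<bar>t (Suc k) - t k - T0\<bar> \<le> C3 * \<rho> ^ k"
    and gap: "\<And>k. \<bar>t (Suc k) - t k - T0\<bar> < T0 / 2"
    using return_times[OF \<delta>(1)] by metis
  define \<beta> where "\<beta> = max \<rho> (\<rho> powr \<epsilon>)"
  have "\<rho> powr \<epsilon> < 1 powr \<epsilon>" using \<rho> \<epsilon> by (intro powr_less_mono2) auto
  then have \<beta>: "0 < \<beta>" "\<beta> < 1" "\<rho> \<le> \<beta>" "\<rho> powr \<epsilon> \<le> \<beta>" using \<rho> by (auto simp: \<beta>_def)
  define E where "E = exp (L * D)"
  have E: "E > 0" by (simp add: E_def)
  define G1 where "G1 = C2 * (C1 * \<delta>) powr \<epsilon> * E"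
  have G1: "G1 \<ge> 0" using C2 E by (simp add: G1_def)
  define G where "G = E * (G1 * D) + L * E * C3"
  have G: "G \<ge> 0" using G1 E D L C3 by (simp add: G_def)
  have Zb: "norm (Z s 0 v) \<le> E * norm v" if "0 \<le> s" "s \<le> D" for s v
  proof -
    have "norm (Z s 0 v) \<le> exp (L * (s - 0)) * norm v"
      by (rule Z.X_bound) (use that L R in auto)
    also have "\<dots> \<le> E * norm v"
      unfolding E_def using that L by (intro mult_right_mono) (auto intro!: mult_left_mono)
    finally show ?thesis .
  qed
  have main: "norm (X (t (Suc k)) (t k) v - M v) \<le> G * \<beta> ^ k * norm v" if tk: "t k \<ge> 0" for k v
  proof -
    define s1 where "s1 = t (Suc k) - t k"
    have s1: "0 \<le> s1" "s1 \<le> D" using gap[of k] T0_pos unfolding s1_def D_def abs_less_iff by linarith+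
    define c where "c = G1 * \<beta> ^ k * norm v"
    have X_shift: "((\<lambda>s. X (t k + s) (t k) v) has_vector_derivative
        f' (x (t k + s)) (X (t k + s) (t k) v)) (at s within {0..D})" if s: "s \<in> {0..D}" for s
    proof -
      have "((\<lambda>s. t k + s) has_vector_derivative 1) (at s within {0..D})"
        by (auto intro!: derivative_eq_intros)
      moreover have "((\<lambda>t'. X t' (t k) v) has_vector_derivative
          f' (x (t k + s)) (X (t k + s) (t k) v)) (at (t k + s) within (\<lambda>s. t k + s) ` {0..D})"
        using s X.X_apply_deriv[OF tk, of "t k + s" "t k + D" v]
        by (auto elim!: has_vector_derivative_within_subset)
      ultimately show ?thesis
        using vector_diff_chain_within[of "\<lambda>s. t k + s" 1 s "{0..D}" "\<lambda>t'. X t' (t k) v"]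
        by (simp add: o_def)
    qed
    have "norm (X (t k + s1) (t k) v - Z s1 0 v)
        \<le> exp (L * (s1 - 0)) * (norm (X (t k + 0) (t k) v - Z 0 0 v) + c * (s1 - 0))"
    proof (rule gronwall[where b = D])
      show "((\<lambda>s. X (t k + s) (t k) v - Z s 0 v) has_vector_derivative
          f' (x (t k + s)) (X (t k + s) (t k) v) - f' (\<phi> s) (Z s 0 v)) (at s within {0..D})"
        if "s \<in> {0..D}" for s
        by (rule has_vector_derivative_diff[OF X_shift[OF that] Z.X_apply_deriv[OF order_refl that]])
      fix s assume "s \<in> {0<..<D}"
      then have s: "0 \<le> s" "s \<le> D" by auto
      define u where "u = X (t k + s) (t k) v"
      define z where "z = Z s 0 v"
      define \<Delta> where "\<Delta> = norm (x (t k + s) - \<phi> s)"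
      have "\<Delta> \<le> C1 * norm (x (t k) - p)"
        using C1(2)[OF tk s, of 0] by (simp add: \<phi>_0 \<Delta>_def)
      also have "\<dots> \<le> C1 * (\<delta> * \<rho> ^ k)" using q[of k] C1(1) by (intro mult_left_mono) auto
      finally have \<Delta>: "\<Delta> \<le> (C1 * \<delta>) * \<rho> ^ k" by simp
      also have "\<dots> \<le> C1 * \<delta>" using \<rho> \<delta> C1 by (intro mult_left_le) (auto simp: power_le_one)
      finally have "\<Delta> < r" using \<delta> by simp
      then have "norm (f' (x (t k + s)) - f' (\<phi> s)) \<le> C2 * \<Delta> powr \<epsilon>"
        unfolding \<Delta>_def by (rule C2(2))
      also have "\<Delta> powr \<epsilon> \<le> ((C1 * \<delta>) * \<rho> ^ k) powr \<epsilon>"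
        using \<Delta> \<epsilon> by (intro powr_mono2) (auto simp: \<Delta>_def)
      also have "\<dots> = (C1 * \<delta>) powr \<epsilon> * (\<rho> powr \<epsilon>) ^ k"
        using C1 \<delta> \<rho> by (simp add: powr_mult powr_realpow[symmetric] powr_powr mult.commute)
      also have "\<dots> \<le> (C1 * \<delta>) powr \<epsilon> * \<beta> ^ k"
        using \<beta> by (intro mult_left_mono power_mono) auto
      finally have diff: "norm (f' (x (t k + s)) - f' (\<phi> s)) \<le> C2 * ((C1 * \<delta>) powr \<epsilon> * \<beta> ^ k)"
        using C2(1) by (simp add: mult_left_mono)
      have "norm ((f' (x (t k + s)) - f' (\<phi> s)) z) \<le> norm (f' (x (t k + s)) - f' (\<phi> s)) * norm z"
        by (rule norm_blinfun)
      also have "\<dots> \<le> C2 * ((C1 * \<delta>) powr \<epsilon> * \<beta> ^ k) * (E * norm v)"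
        using diff Zb[OF s] C2(1) \<beta> by (intro mult_mono) (auto simp: z_def)
      also have "\<dots> = c" by (simp add: c_def G1_def)
      finally have 1: "norm ((f' (x (t k + s)) - f' (\<phi> s)) z) \<le> c" .
      have "norm (f' (x (t k + s)) (u - z)) \<le> norm (f' (x (t k + s))) * norm (u - z)"
        by (rule norm_blinfun)
      also have "\<dots> \<le> L * norm (u - z)" using L(2) R(2) tk s by (intro mult_right_mono) auto
      finally have "norm (f' (x (t k + s)) u - f' (\<phi> s) z) \<le> L * norm (u - z) + c"
        using 1 norm_triangle_ineq[of "f' (x (t k + s)) (u - z)" "(f' (x (t k + s)) - f' (\<phi> s)) z"]
        by (simp add: blinfun.diff_right blinfun.diff_left)
      then show "norm (f' (x (t k + s)) (X (t k + s) (t k) v) - f' (\<phi> s) (Z s 0 v))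
          \<le> L * norm (X (t k + s) (t k) v - Z s 0 v) + c"
        by (simp add: u_def z_def)
    qed (use L s1 G1 \<beta> in \<open>auto simp: c_def\<close>)
    also have "\<dots> = exp (L * s1) * (c * s1)" using tk by (simp add: X.X_diag Z.X_diag)
    also have "\<dots> \<le> E * (c * D)"
      unfolding E_def using s1 L G1 \<beta>
      by (intro mult_mono) (auto simp: c_def intro!: mult_left_mono)
    finally have 1: "norm (X (t (Suc k)) (t k) v - Z s1 0 v) \<le> E * (c * D)" by (simp add: s1_def)
    have "norm (Z s1 0 v - Z T0 0 v) \<le> (L * (E * norm v)) * norm (s1 - T0)"
    proof (rule differentiable_bound[where S = "{0..D}"])
      fix s assume s: "s \<in> {0..D}"
      show "((\<lambda>s. Z s 0 v) has_derivative (\<lambda>h. h *\<^sub>R f' (\<phi> s) (Z s 0 v))) (at s within {0..D})"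
        using Z.X_apply_deriv[OF order_refl s] by (simp add: has_vector_derivative_def)
      have "norm (f' (\<phi> s) (Z s 0 v)) \<le> norm (f' (\<phi> s)) * norm (Z s 0 v)" by (rule norm_blinfun)
      also have "\<dots> \<le> L * (E * norm v)" using L R Zb s by (intro mult_mono) auto
      finally have "norm (f' (\<phi> s) (Z s 0 v)) \<le> L * (E * norm v)" .
      then show "onorm (\<lambda>h. h *\<^sub>R f' (\<phi> s) (Z s 0 v)) \<le> L * (E * norm v)"
        using L E by (intro onorm_bound) (auto simp: mult.commute intro!: mult_left_mono)
    qed (use s1 T0_pos in \<open>auto simp: D_def\<close>)
    also have "\<dots> \<le> (L * (E * norm v)) * (C3 * \<beta> ^ k)"
    proof (rule mult_left_mono)
      have "C3 * \<rho> ^ k \<le> C3 * \<beta> ^ k" using C3 \<rho> \<beta> by (intro mult_left_mono power_mono) auto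
      then show "norm (s1 - T0) \<le> C3 * \<beta> ^ k" using \<tau>[of k] by (simp add: s1_def)
    qed (use L E in auto)
    finally have 2: "norm (Z s1 0 v - M v) \<le> L * E * C3 * \<beta> ^ k * norm v"
      by (simp add: M_def mult_ac)
    have "norm (X (t (Suc k)) (t k) v - M v) \<le> E * (c * D) + L * E * C3 * \<beta> ^ k * norm v"
      using 1 2 norm_triangle_ineq[of "X (t (Suc k)) (t k) v - Z s1 0 v" "Z s1 0 v - M v"] by simp
    also have "\<dots> = G * \<beta> ^ k * norm v" by (simp add: G_def c_def algebra_simps)
    finally show ?thesis .
  qed
  show ?thesis using that[OF \<beta>(1,2) G t0 gap main] .
qed

text \<open>In the norm \<open>V\<close> the monodromy does not expand, so the k-th return
  multiplies \<open>V\<close> by at most \<open>exp (K * G * \<beta> ^ k)\<close>. The exponents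
  form a convergent series, and a last factor \<open>K\<close> returns to the original norm.\<close>

lemma return_variation_bounded:
  obtains t :: "nat \<Rightarrow> real" and Q where "Q \<ge> 1" "t 0 \<ge> 0"
    "\<And>k. \<bar>t (Suc k) - t k - T0\<bar> < T0 / 2"
    "\<And>j k v. j \<le> k \<Longrightarrow> norm (X (t k) (t j) v) \<le> Q * norm v"
proof -
  obtain t \<beta> G where \<beta>: "0 < \<beta>" "\<beta> < 1" and G: "G \<ge> 0" and t0: "t 0 \<ge> 0"
    and gap: "\<And>k. \<bar>t (Suc k) - t k - T0\<bar> < T0 / 2"
    and var: "\<And>k v. t k \<ge> 0 \<Longrightarrow> norm (X (t (Suc k)) (t k) v - M v) \<le> G * \<beta> ^ k * norm v"
    using return_variation by metis
  have step: "t k \<le> t (Suc k)" for k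
    using gap[of k] T0_pos unfolding abs_less_iff by linarith
  then have mono: "t j \<le> t k" if "j \<le> k" for j k using that by (rule lift_Suc_mono_le)
  have tpos: "t k \<ge> 0" for k using mono[of 0 k] t0 by simp
  obtain K where K: "K \<ge> 1" "\<And>k v. norm ((M ^^ k) v) \<le> K * norm v" using M_power_bounded by blast
  interpret V: bounded_family UNIV "\<lambda>k. M ^^ k" K
    using K linear_funpow[OF M_linear] by (intro bounded_family.intro) auto
  define V where "V = sup_norm UNIV (\<lambda>k. M ^^ k)"
  have normV: "norm v \<le> V v" for v using V.le_sup_norm[of 0 v] by (simp add: V_def)
  have VM: "V (M v) \<le> V v" for v
    unfolding V_def
  proof (rule V.sup_norm_leI)
    show "norm ((M ^^ k) (M v)) \<le> sup_norm UNIV (\<lambda>k. M ^^ k) v" for k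
      using V.le_sup_norm[of "Suc k" v] by (simp add: funpow_swap1)
  qed
  have V0: "V v \<ge> 0" for v using normV[of v] norm_ge_zero order_trans by blast
  have one: "V (X (t (Suc k)) (t k) v) \<le> exp (K * G * \<beta> ^ k) * V v" for k v
  proof -
    have "V (X (t (Suc k)) (t k) v) \<le> V (M v) + K * norm (X (t (Suc k)) (t k) v - M v)"
      unfolding V_def by (rule V.sup_norm_perturb)
    also have "\<dots> \<le> V v + K * (G * \<beta> ^ k * V v)"
      using var[OF tpos, of k v] G \<beta> K normV[of v]
      by (intro add_mono VM mult_left_mono order_trans[OF var[OF tpos]]) auto
    also have "\<dots> = (1 + K * G * \<beta> ^ k) * V v" by (simp add: algebra_simps)
    also have "\<dots> \<le> exp (K * G * \<beta> ^ k) * V v"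
      using exp_ge_add_one_self V0 by (intro mult_right_mono)
    finally show ?thesis .
  qed
  have many: "V (X (t (j + n)) (t j) v) \<le> exp (K * G * (\<Sum>i<n. \<beta> ^ (j + i))) * V v" for j n v
  proof (induction n)
    case 0
    then show ?case using tpos by (simp add: X.X_diag)
  next
    case (Suc n)
    have "X (t (Suc (j + n))) (t j) v = X (t (Suc (j + n))) (t (j + n)) (X (t (j + n)) (t j) v)"
      using X.X_comp[OF tpos mono mono] by simp
    then have "V (X (t (j + Suc n)) (t j) v) \<le> exp (K * G * \<beta> ^ (j + n)) * V (X (t (j + n)) (t j) v)"
      using one[of "j + n"] by simp
    also have "\<dots> \<le> exp (K * G * \<beta> ^ (j + n)) * (exp (K * G * (\<Sum>i<n. \<beta> ^ (j + i))) * V v)"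
      using Suc by (intro mult_left_mono) auto
    also have "\<dots> = exp (K * G * (\<Sum>i<Suc n. \<beta> ^ (j + i))) * V v"
      by (simp add: mult.assoc[symmetric] exp_add[symmetric]) (simp add: algebra_simps)
    finally show ?case .
  qed
  define Q where "Q = exp (K * G * (1 / (1 - \<beta>))) * K"
  have geo: "(\<Sum>i<n. \<beta> ^ (j + i)) \<le> 1 / (1 - \<beta>)" for j n
  proof -
    have "(\<Sum>i<n. \<beta> ^ (j + i)) \<le> (\<Sum>i<n. \<beta> ^ i)"
      using \<beta> by (intro sum_mono power_decreasing) auto
    also have "\<dots> \<le> 1 / (1 - \<beta>)" using \<beta> by (simp add: sum_gp_strict divide_right_mono)
    finally show ?thesis .
  qed
  have Qb: "norm (X (t k) (t j) v) \<le> Q * norm v" if "j \<le> k" for j k v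
  proof -
    have "norm (X (t k) (t j) v) \<le> exp (K * G * (\<Sum>i<k - j. \<beta> ^ (j + i))) * V v"
      using many[of j "k - j" v] normV[of "X (t k) (t j) v"] that by simp
    also have "\<dots> \<le> exp (K * G * (1 / (1 - \<beta>))) * (K * norm v)"
    proof (rule mult_mono)
      show "V v \<le> K * norm v" unfolding V_def by (rule V.sup_norm_le)
      have "K * G * (\<Sum>i<k - j. \<beta> ^ (j + i)) \<le> K * G * (1 / (1 - \<beta>))"
        using geo K G by (intro mult_left_mono) auto
      then show "exp (K * G * (\<Sum>i<k - j. \<beta> ^ (j + i))) \<le> exp (K * G * (1 / (1 - \<beta>)))" by simp
    qed (use V0 in auto)
    finally show ?thesis by (simp add: Q_def mult.assoc)
  qed
  have "exp (K * G * (1 / (1 - \<beta>))) \<ge> 1" using K G \<beta> by simp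
  then have "Q \<ge> 1" using K mult_mono[of 1 "exp (K * G * (1 / (1 - \<beta>)))" 1 K] by (simp add: Q_def)
  then show ?thesis using that[OF _ t0 gap Qb] by blast
qed

text \<open>An arbitrary time interval is cut at the first and the last return time in it. The
  pieces at both ends have bounded length and obey Gronwall; the middle is a product over full
  returns.\<close>

lemma variation_bounded: "\<exists>K\<ge>1. \<forall>s t v. 0 \<le> s \<longrightarrow> s \<le> t \<longrightarrow> norm (X t s v) \<le> K * norm v"
proof -
  obtain t Q where Q: "Q \<ge> 1" and t0: "t 0 \<ge> 0"
    and gap: "\<And>k. \<bar>t (Suc k) - t k - T0\<bar> < T0 / 2"
    and Qb: "\<And>j k v. j \<le> k \<Longrightarrow> norm (X (t k) (t j) v) \<le> Q * norm v"
    using return_variation_bounded by metis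
  have gap': "t k + T0 / 2 \<le> t (Suc k)" "t (Suc k) \<le> t k + 2 * T0" for k
    using gap[of k] T0_pos unfolding abs_less_iff by linarith+
  have step: "t k \<le> t (Suc k)" for k using gap'[of k] T0_pos by linarith
  then have mono: "t j \<le> t k" if "j \<le> k" for j k using that by (rule lift_Suc_mono_le)
  have tpos: "t k \<ge> 0" for k using mono[of 0 k] t0 by simp
  have lower: "real k * (T0 / 2) \<le> t k" for k
  proof (induction k)
    case (Suc k)
    then show ?case using gap'(1)[of k] by (simp add: algebra_simps)
  qed (use t0 in simp)
  have unb: "\<exists>k. s < t k" for s
  proof -
    obtain k where "s < real k * (T0 / 2)"
      using reals_Archimedean3[of "T0 / 2"] T0_pos by auto
    then show ?thesis using lower[of k] by (intro exI[of _ k]) simp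
  qed
  obtain R where R: "\<And>t. t \<ge> 0 \<Longrightarrow> norm (x t) \<le> R" using orbits_bounded by metis
  obtain L where L: "L \<ge> 0" "\<And>y. norm y \<le> R \<Longrightarrow> norm (f' y) \<le> L"
    using lipschitz_ball[of R] by metis
  \<comment> \<open>\<open>t 0\<close> accounts for times before the first hit,
    \<open>2 * T0\<close> for pieces within one gap.\<close>
  define D where "D = max (t 0) (2 * T0)"
  have D: "D \<ge> 0" using t0 by (simp add: D_def)
  define E where "E = exp (L * D)"
  have E: "E \<ge> 1" using L D by (simp add: E_def)
  have local: "norm (X r s v) \<le> E * norm v" if "0 \<le> s" "s \<le> r" "r - s \<le> D" for r s v
  proof -
    have "norm (X r s v) \<le> exp (L * (r - s)) * norm v"
      using that L R by (intro X.X_bound) auto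
    also have "\<dots> \<le> E * norm v"
      unfolding E_def using that L by (intro mult_right_mono) (auto intro!: mult_left_mono)
    finally show ?thesis .
  qed
  define K where "K = E * (Q * E)"
  have "1 \<le> E * Q" using mult_mono[OF E Q] E by simp
  then have "E \<le> K" using E mult_right_mono[of 1 "E * Q" E] by (simp add: K_def)
  then have K: "E \<le> K" "K \<ge> 1" using E by simp_all
  have "norm (X r s v) \<le> K * norm v" if s: "0 \<le> s" "s \<le> r" for r s v
  proof -
    define j where "j = (LEAST j. s < t j)"
    have sj: "s < t j" unfolding j_def using unb by (rule LeastI_ex)
    have j: "t j - s \<le> D"
    proof (cases j)
      case 0
      then show ?thesis using s by (simp add: D_def)
    next
      case (Suc i)
      have "\<not> s < t i" using Suc unfolding j_def by (intro not_less_Least) simp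
      then show ?thesis using gap'(2)[of i] Suc by (simp add: D_def)
    qed
    show ?thesis
    proof (cases "r \<le> t j")
      case True
      then have "norm (X r s v) \<le> E * norm v" using s j by (intro local) auto
      also have "\<dots> \<le> K * norm v" using K by (intro mult_right_mono) auto
      finally show ?thesis .
    next
      case False
      \<comment> \<open>The first return time after \<open>r\<close>; its predecessor
        \<open>k\<close> is the last one not after \<open>r\<close>, and \<open>j \<le> k\<close>
        because \<open>t j < r\<close>.\<close>
      define k' where "k' = (LEAST k. r < t k)"
      have rk': "r < t k'" unfolding k'_def using unb by (rule LeastI_ex)
      have "j < k'" using rk' False mono[of k' j] by (cases "j < k'") auto
      then obtain k where k: "k' = Suc k" "j \<le> k" by (cases k') auto
      have "\<not> r < t k" using k unfolding k'_def by (intro not_less_Least) simp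
      then have rk: "t k \<le> r" "r - t k \<le> D" using rk' gap'(2)[of k] k by (simp_all add: D_def)
      have "norm (X r s v) = norm (X r (t k) (X (t k) (t j) (X (t j) s v)))"
        using X.X_comp[of s "t j" "t k" v] X.X_comp[of s "t k" r v] s sj mono[OF k(2)] rk by simp
      also have "\<dots> \<le> E * norm (X (t k) (t j) (X (t j) s v))" using rk tpos by (intro local)
      also have "\<dots> \<le> E * (Q * norm (X (t j) s v))" using E Qb[OF k(2)] by (intro mult_left_mono) auto
      also have "\<dots> \<le> E * (Q * (E * norm v))"
        using E Q s sj j by (intro mult_left_mono local) auto
      finally show ?thesis by (simp add: K_def mult.assoc)
    qed
  qed
  then show ?thesis using K by blast
qed

end

theorem theorem7p2:
  fixes f :: "real ^ 'n \<Rightarrow> real ^ 'n"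
    and x :: "real \<Rightarrow> real ^ 'n"
    and \<gamma> :: "(real ^ 'n) set"
    and \<epsilon> :: real
  assumes "\<epsilon> > 0"
    and "C1_hoelder \<epsilon> f"
    and "solves (\<lambda>_. f) {0..} x"
    and "hyperbolic_attracting_cycle f \<gamma>"
    and "falls_into x \<gamma>"
  shows "\<exists>K>0. \<forall>\<alpha>. error_scale \<alpha> \<longrightarrow> (\<forall>t\<ge>0. E_orbit f x \<alpha> t \<le> ereal (K * t))"
proof -
  obtain f' :: "real ^ 'n \<Rightarrow> ((real ^ 'n) \<Rightarrow>\<^sub>L (real ^ 'n))" where
    f': "\<And>x. (f has_derivative blinfun_apply (f' x)) (at x)" "continuous_on UNIV f'"
    and hoelder: "\<And>x. \<exists>r>0. \<exists>C. \<forall>y\<in>ball x r. \<forall>z\<in>ball x r. norm (f' y - f' z) \<le> C * dist y z powr \<epsilon>"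
    using assms(2) unfolding C1_hoelder_def by metis
  interpret C1: C1_field f f' using f' by unfold_locales
  obtain \<phi>0 T where \<phi>0: "solves (\<lambda>_. f) UNIV \<phi>0" "T > 0" "\<And>t. \<phi>0 (t + T) = \<phi>0 t" "\<gamma> = range \<phi>0"
    using assms(4) unfolding hyperbolic_attracting_cycle_def cycle_def by blast
  obtain H A where HA: "linearized_poincare f \<gamma> H A" and spec: "\<And>\<mu>. eigenvalue_on H A \<mu> \<Longrightarrow> cmod \<mu> < 1"
    using assms(4) unfolding hyperbolic_attracting_cycle_def by blast
  obtain p S P where p: "p \<in> \<gamma>" and cs: "cross_section f p S H" and pm: "poincare_map f p S P"
    and Pd: "(P has_derivative A) (at p within S)"
    using HA unfolding linearized_poincare_def by blast
  from cs obtain U and g :: "real ^ 'n \<Rightarrow> real" and n where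
    "open U \<and> S = {x \<in> U. g x = 0} \<and> p \<in> S \<and>
       (\<forall>x\<in>U. (g has_derivative (\<lambda>v. n x \<bullet> v)) (at x)) \<and> continuous_on U n \<and>
       (\<forall>x\<in>S. n x \<bullet> f x \<noteq> 0) \<and> H = {v. n p \<bullet> v = 0}"
    unfolding cross_section_def by (elim exE)
  then have U: "open U" "S = {x \<in> U. g x = 0}" "p \<in> S" "p \<in> U"
    and g: "\<And>x. x \<in> U \<Longrightarrow> (g has_derivative (\<lambda>v. n x \<bullet> v)) (at x)"
    and tr: "n p \<bullet> f p \<noteq> 0" and H: "H = {v. n p \<bullet> v = 0}" by auto
  from pm obtain N \<tau> where N: "open N" "p \<in> N" "continuous_on (S \<inter> N) \<tau>"
    and ret: "\<forall>q\<in>S \<inter> N. first_return f S q (\<tau> q) (P q)" and Pp: "P p = p"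
    unfolding poincare_map_def by (elim exE conjE)
  obtain a where a: "p = \<phi>0 a" using p \<phi>0(4) by blast
  \<comment> \<open>The phase is shifted so that the periodic solution starts at the base point of
    the section.\<close>
  define \<phi> where "\<phi> t = \<phi>0 (a + t)" for t
  have \<phi>_deriv: "(\<phi> has_vector_derivative f (\<phi> t)) (at t)" for t
  proof -
    have "((\<lambda>t. a + t) has_vector_derivative 1) (at t)" by (auto intro!: derivative_eq_intros)
    moreover have "(\<phi>0 has_vector_derivative f (\<phi>0 (a + t))) (at (a + t))"
      using \<phi>0(1) by (simp add: solves_def)
    ultimately show ?thesis
      using vector_diff_chain_at[of "\<lambda>t. a + t" 1 t \<phi>0] by (simp add: o_def \<phi>_def[abs_def])
  qed
  have "surj (\<lambda>t. a + t)" by (metis surj_plus)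
  then have range_\<phi>: "range \<phi> = \<gamma>"
    unfolding \<phi>0(4) \<phi>_def[abs_def] by (metis image_image)
  have "continuous_on {0..} x"
    using assms(3) unfolding solves_def by (intro has_vector_derivative_imp_continuous_on) auto
  then have cont_fx: "continuous_on {0..} (\<lambda>t. f' (x t))" and cx: "continuous_on {0..} x"
    by (auto intro: continuous_on_compose2[OF f'(2)])
  have "continuous_on {0..} \<phi>"
    using \<phi>_deriv by (meson continuous_at_imp_continuous_on has_vector_derivative_continuous)
  then have cont_f\<phi>: "continuous_on {0..} (\<lambda>t. f' (\<phi> t))"
    by (auto intro: continuous_on_compose2[OF f'(2)])
  obtain X where X: "evolution (\<lambda>t. f' (x t)) X" using evolution_exists[OF cont_fx] by blast
  obtain Z where Z: "evolution (\<lambda>t. f' (\<phi> t)) Z" using evolution_exists[OF cont_f\<phi>] by blast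
  interpret X: evolution "\<lambda>t. f' (x t)" X by (rule X)
  interpret Z: evolution "\<lambda>t. f' (\<phi> t)" Z by (rule Z)
  interpret attracted_orbit f f' \<phi> Z T p "n p" S U N g A P \<tau> x X \<epsilon>
  proof unfold_locales
    show "continuous_on U g"
      using g by (meson continuous_at_imp_continuous_on has_derivative_continuous)
    show "\<phi> (t + T) = \<phi> t" for t
      using \<phi>0(3)[of "a + t"] by (simp add: \<phi>_def add.assoc)
    show "falls_into x (range \<phi>)" using assms(5) by (simp add: range_\<phi>)
    show "\<phi> 0 = p" by (simp add: \<phi>_def a)
    show "(g has_derivative (\<lambda>v. n p \<bullet> v)) (at p)" by (rule g[OF U(4)])
    show "first_return f S q (\<tau> q) (P q)" if "q \<in> S" "q \<in> N" for q using ret that by blast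
    show "cmod \<mu> < 1" if "eigenvalue_on {v. n p \<bullet> v = 0} A \<mu>" for \<mu> using spec that by (simp add: H)
  qed (fact \<phi>_deriv \<phi>0(2) U tr Pp N Pd hoelder assms)+
  obtain K where K: "K \<ge> 1" "\<And>s t v. 0 \<le> s \<Longrightarrow> s \<le> t \<Longrightarrow> norm (X t s v) \<le> K * norm v"
    using variation_bounded by blast
  have "\<forall>\<alpha>. error_scale \<alpha> \<longrightarrow> (\<forall>t\<ge>0. E_orbit f x \<alpha> t \<le> ereal (3 * K * t))"
    using C1.E_orbit_le[OF cx X K] by blast
  then show ?thesis using K(1) by (intro exI[of _ "3 * K"]) auto
qed

end
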